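(* Let $\Omega,\nu,G,\mathcal{X},F,H$ be as in the context, and let $\{H_\lambda\}_{\lambda\in(0,1]}$ be an admissible family of regularized Hamiltonians for $H$ with associated function $\omega$ (as defined in the context). Assume moreover that: (i) $\langle G,\phi\rangle_{H^{-1}\times H_0^1}\ge 0$ for all $\phi\in H_0^1(\Omega)$ that are nonnegative a.e. in $\Omega$; (ii) there is a constant $c_F>0$ such that $\langle F[m_1]-F[m_2],m_1-m_2\rangle_{H^{-1}\times H_0^1}\ge c_F\|m_1-m_2\|_{\mathcal{X}}^2$ for all $m_1,m_2\in H_0^1(\Omega)$; (iii) there is a constant $L_F\ge0$ such that $\|F[m_1]-F[m_2]\|_{H^{-1}(\Omega)}\le L_F\|m_1-m_2\|_{\mathcal{X}}$ for all $m_1,m_2\in\mathcal{X}$. Let $(u,m)$ be the unique weak solution of the MFG partial differential inclusion and, for $\lambda\in(0,1]$, let $(u_\lambda,m_\lambda)$ be the unique weak solution of the regularized problem with parameter $\lambda$. Then $$\|u-u_\lambda\|_{H^1(\Omega)}+\|m-m_\lambda\|_{\mathcal{X}}\le C\,\omega(\lambda)^{1/2}$$ for all $\lambda$ sufficiently small, where the constant $C$ depends only on $\Omega$, $\nu$, $d$, $L_H$, $L_F$, $\sup_{\sigma\in[0,1]}\omega(\sigma)$, and $c_F$.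
   Context: Setting. $\Omega\subset\mathbb{R}^d$, $d\in\mathbb{N}$, is a bounded, open, connected set with Lipschitz boundary; $\nu>0$ is a constant; $G\in H^{-1}(\Omega)$. $(\mathcal{X},\|\cdot\|_{\mathcal{X}})$ is a real Banach space such that $H_0^1(\Omega)$ is embedded continuously and compactly in $\mathcal{X}$. $F:\mathcal{X}\to H^{-1}(\Omega)$ is a continuous (possibly nonlinear) operator such that, for some constant $C_F\ge 0$, $\|F[w]\|_{H^{-1}(\Omega)}\le C_F(\|w\|_{\mathcal{X}}+1)$ for all $w\in\mathcal{X}$. Hamiltonian. $\mathcal{A}$ is a compact metric space, $b:\overline\Omega\times\mathcal{A}\to\mathbb{R}^d$ and $f:\overline\Omega\times\mathcal{A}\to\mathbb{R}$ are (uniformly) continuous, and $H(x,p):=\sup_{\alpha\in\mathcal{A}}\{b(x,\alpha)\cdot p-f(x,\alpha)\}$ for $(x,p)\in\overline\Omega\times\mathbb{R}^d$. $H$ is convex in $p$ and satisfies $|H(x,p)-H(x,q)|\le L_H|p-q|$ for all $x\in\overline\Omega$, $p,q\in\mathbb{R}^d$, for a constant $L_H$ (e.g. $L_H=\|b\|_{C(\overline\Omega\times\mathcal{A};\mathbb{R}^d)}$). Write $H[\nabla v]:=H(\cdot,\nabla v)$, and similarly for $H_\lambda$ and $\frac{\partial H_\lambda}{\partial p}$. The subdifferential is $\partial_pH(x,p):=\{\tilde b\in\mathbb{R}^d: H(x,q)\ge H(x,p)+\tilde b\cdot(q-p)\ \forall q\in\mathbb{R}^d\}$, and for $v\in W^{1,1}(\Omega)$,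 $D_pH[v]:=\{\tilde b\in L^\infty(\Omega;\mathbb{R}^d):\tilde b(x)\in\partial_pH(x,\nabla v(x))\text{ for a.e. }x\in\Omega\}$. Weak solution of the MFG partial differential inclusion: a pair $(u,m)\in H_0^1(\Omega)\times H_0^1(\Omega)$ for which there exists $\tilde b_*\in D_pH[u]$ such that $\int_\Omega \nu\nabla u\cdot\nabla\psi+H[\nabla u]\psi\,dx=\langle F[m],\psi\rangle_{H^{-1}\times H_0^1}$ for all $\psi\in H_0^1(\Omega)$, and $\int_\Omega \nu\nabla m\cdot\nabla\phi+m\tilde b_*\cdot\nabla\phi\,dx=\langle G,\phi\rangle_{H^{-1}\times H_0^1}$ for all $\phi\in H_0^1(\Omega)$. Admissible family of regularized Hamiltonians: a family $\{H_\lambda\}_{\lambda\in(0,1]}$ of real-valued functions on $\overline\Omega\times\mathbb{R}^d$ for which there is a continuous $\omega:[0,1]\to[0,\infty)$ with $\omega(0)=0$ such that, for each $\lambda\in(0,1]$: $H_\lambda$ is continuous on $\overline\Omega\times\mathbb{R}^d$ and $|H_\lambda(x,p)-H_\lambda(x,q)|\le L_H|p-q|$ for all $x\in\overline\Omega$, $p,q\in\mathbb{R}^d$ (same constant $L_H$ as for $H$); $p\mapsto H_\lambda(x,p)$ is convex for each $x\in\overline\Omega$; the partial derivative $\frac{\partial H_\lambda}{\partial p}:\overline\Omega\times\mathbb{R}^d\to\mathbb{R}^d$ exists and is continuous; and $|H_\lambda(x,p)-H(x,p)|\le\omega(\lambda)$ for all $(x,p)\in\overline\Omega\times\mathbb{R}^d$.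 Weak solution of the regularized problem with parameter $\lambda$: a pair $(u_\lambda,m_\lambda)\in H_0^1(\Omega)\times H_0^1(\Omega)$ such that $\int_\Omega \nu\nabla u_\lambda\cdot\nabla\psi+H_\lambda[\nabla u_\lambda]\psi\,dx=\langle F[m_\lambda],\psi\rangle_{H^{-1}\times H_0^1}$ for all $\psi\in H_0^1(\Omega)$, and $\int_\Omega \nu\nabla m_\lambda\cdot\nabla\phi+m_\lambda\frac{\partial H_\lambda}{\partial p}[\nabla u_\lambda]\cdot\nabla\phi\,dx=\langle G,\phi\rangle_{H^{-1}\times H_0^1}$ for all $\phi\in H_0^1(\Omega)$. It is known that, under hypotheses (i) and (ii) of the claim, the MFG partial differential inclusion and each regularized problem have exactly one weak solution.
   Formalization: The constant C is also allowed to depend on the norm of G in H^{-1}(Ω), which the list of parameters omits; with C independent of G the claim is false, since scaling G up makes the ratio of the error to ω(λ)^{1/2} unbounded. *)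

theory Defs
  imports "HOL-Analysis.Analysis"
begin

(* Near every boundary point, Omega is the strict epigraph of a Lipschitz function over the
   hyperplane orthogonal to a unit vector e. *)
definition lipschitz_boundary :: "'a::euclidean_space set \<Rightarrow> bool" where
  "lipschitz_boundary \<Omega> \<longleftrightarrow>
     (\<forall>z\<in>frontier \<Omega>. \<exists>r>0. \<exists>e \<gamma> L. norm e = 1 \<and> L-lipschitz_on {y. y \<bullet> e = 0} \<gamma> \<and>
        \<Omega> \<inter> ball z r = {y \<in> ball z r. y \<bullet> e > \<gamma> (y - (y \<bullet> e) *\<^sub>R e)})"

definition lipschitz_domain :: "'a::euclidean_space set \<Rightarrow> bool" where
  "lipschitz_domain \<Omega> \<longleftrightarrow> bounded \<Omega> \<and> open \<Omega> \<and> connected \<Omega> \<and> lipschitz_boundary \<Omega>"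


section \<open>Lebesgue and Sobolev spaces\<close>

text \<open>Elements of function spaces on \<open>\<Omega>\<close> are represented by functions on the whole type;
  only their values almost everywhere in \<open>\<Omega>\<close> matter.\<close>

definition L2_set_on :: "'a::euclidean_space set \<Rightarrow> ('a \<Rightarrow> 'b::euclidean_space) set" where
  "L2_set_on \<Omega> = {f \<in> borel_measurable (lebesgue_on \<Omega>).
     integrable (lebesgue_on \<Omega>) (\<lambda>x. (norm (f x))\<^sup>2)}"

definition Linf_on :: "'a::euclidean_space set \<Rightarrow> ('a \<Rightarrow> 'b::euclidean_space) set" where
  "Linf_on \<Omega> = {f \<in> borel_measurable (lebesgue_on \<Omega>).
     \<exists>B. AE x in lebesgue_on \<Omega>. norm (f x) \<le> B}"

definition loc_integrable :: "'a::euclidean_space set \<Rightarrow> ('a \<Rightarrow> 'b::euclidean_space) \<Rightarrow> bool" where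
  "loc_integrable \<Omega> f \<longleftrightarrow> (\<forall>K. compact K \<and> K \<subseteq> \<Omega> \<longrightarrow> integrable (lebesgue_on K) f)"

primrec Ck_fun :: "nat \<Rightarrow> ('a::euclidean_space \<Rightarrow> real) \<Rightarrow> bool" where
  "Ck_fun 0 f \<longleftrightarrow> continuous_on UNIV f"
| "Ck_fun (Suc k) f \<longleftrightarrow> (\<forall>x. f differentiable (at x)) \<and>
     (\<forall>i\<in>Basis. Ck_fun k (\<lambda>x. frechet_derivative f (at x) i))"

definition test_functions :: "'a::euclidean_space set \<Rightarrow> ('a \<Rightarrow> real) set" where
  "test_functions \<Omega> =
     {\<phi>. (\<forall>k. Ck_fun k \<phi>) \<and> (\<exists>K. compact K \<and> K \<subseteq> \<Omega> \<and> (\<forall>x. x \<notin> K \<longrightarrow> \<phi> x = 0))}"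

definition has_weak_gradient ::
    "'a::euclidean_space set \<Rightarrow> ('a \<Rightarrow> real) \<Rightarrow> ('a \<Rightarrow> 'a) \<Rightarrow> bool" where
  "has_weak_gradient \<Omega> u g \<longleftrightarrow> loc_integrable \<Omega> u \<and> loc_integrable \<Omega> g \<and>
     (\<forall>\<phi>\<in>test_functions \<Omega>. \<forall>i\<in>Basis.
        (LINT x|lebesgue_on \<Omega>. u x * frechet_derivative \<phi> (at x) i)
          = - (LINT x|lebesgue_on \<Omega>. (g x \<bullet> i) * \<phi> x))"

(* Weak gradients are unique up to null sets, so the choice of representative is immaterial. *)
definition wgrad :: "'a::euclidean_space set \<Rightarrow> ('a \<Rightarrow> real) \<Rightarrow> 'a \<Rightarrow> 'a" where
  "wgrad \<Omega> u = (SOME g. has_weak_gradient \<Omega> u g)"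

definition H1 :: "'a::euclidean_space set \<Rightarrow> ('a \<Rightarrow> real) set" where
  "H1 \<Omega> = {u \<in> L2_set_on \<Omega>. \<exists>g\<in>L2_set_on \<Omega>. has_weak_gradient \<Omega> u g}"

definition H1_norm :: "'a::euclidean_space set \<Rightarrow> ('a \<Rightarrow> real) \<Rightarrow> real" where
  "H1_norm \<Omega> u = sqrt ((LINT x|lebesgue_on \<Omega>. (u x)\<^sup>2)
                      + (LINT x|lebesgue_on \<Omega>. (norm (wgrad \<Omega> u x))\<^sup>2))"

definition H10 :: "'a::euclidean_space set \<Rightarrow> ('a \<Rightarrow> real) set" where
  "H10 \<Omega> = {u \<in> H1 \<Omega>. \<exists>\<phi>::nat \<Rightarrow> 'a \<Rightarrow> real. (\<forall>n. \<phi> n \<in> test_functions \<Omega>) \<and>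
     (\<lambda>n. H1_norm \<Omega> (\<lambda>x. u x - \<phi> n x)) \<longlonglongrightarrow> 0}"

(* The dual space of H10. Functionals are only constrained on H10; boundedness makes them
   independent of representatives. *)
definition Hm1 :: "'a::euclidean_space set \<Rightarrow> (('a \<Rightarrow> real) \<Rightarrow> real) set" where
  "Hm1 \<Omega> = {G.
     (\<forall>\<phi>\<in>H10 \<Omega>. \<forall>\<psi>\<in>H10 \<Omega>. \<forall>s t. G (\<lambda>x. s * \<phi> x + t * \<psi> x) = s * G \<phi> + t * G \<psi>) \<and>
     (\<exists>B. \<forall>\<phi>\<in>H10 \<Omega>. \<bar>G \<phi>\<bar> \<le> B * H1_norm \<Omega> \<phi>)}"

definition Hm1_norm :: "'a::euclidean_space set \<Rightarrow> (('a \<Rightarrow> real) \<Rightarrow> real) \<Rightarrow> real" where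
  "Hm1_norm \<Omega> G = (SUP \<phi>\<in>{\<phi> \<in> H10 \<Omega>. H1_norm \<Omega> \<phi> \<le> 1}. \<bar>G \<phi>\<bar>)"


section \<open>The space X and the operator F\<close>

text \<open>The Banach space is a closed subspace \<open>X\<close> of a Banach space type. Taking \<open>UNIV\<close> for \<open>X\<close>
  gives every Banach space type; letting the subspace vary allows a constant to be chosen
  before (hence independently of) \<open>X\<close>, as any set of Banach spaces embeds isometrically into a
  common one. The compact metric space of controls below is treated in the same way.\<close>

definition compactly_embedded ::
    "'a::euclidean_space set \<Rightarrow> (('a \<Rightarrow> real) \<Rightarrow> 'x::banach) \<Rightarrow> 'x set \<Rightarrow> bool" where
  "compactly_embedded \<Omega> \<iota> X \<longleftrightarrow> subspace X \<and> closed X \<and>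
     (\<forall>u\<in>H10 \<Omega>. \<iota> u \<in> X) \<and>
     (\<forall>u\<in>H10 \<Omega>. \<forall>v\<in>H10 \<Omega>. \<forall>s t. \<iota> (\<lambda>x. s * u x + t * v x) = s *\<^sub>R \<iota> u + t *\<^sub>R \<iota> v) \<and>
     (\<forall>u\<in>H10 \<Omega>. \<iota> u = 0 \<longrightarrow> (AE x in lebesgue_on \<Omega>. u x = 0)) \<and>
     (\<exists>B. \<forall>u\<in>H10 \<Omega>. norm (\<iota> u) \<le> B * H1_norm \<Omega> u) \<and>
     compact (closure (\<iota> ` {u \<in> H10 \<Omega>. H1_norm \<Omega> u \<le> 1}))"

definition coupling_operator ::
    "'a::euclidean_space set \<Rightarrow> 'x::banach set \<Rightarrow> ('x \<Rightarrow> ('a \<Rightarrow> real) \<Rightarrow> real) \<Rightarrow> bool" where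
  "coupling_operator \<Omega> X F \<longleftrightarrow> (\<forall>w\<in>X. F w \<in> Hm1 \<Omega>) \<and>
     (\<forall>w\<in>X. \<forall>\<epsilon>>0. \<exists>\<delta>>0. \<forall>w'\<in>X. norm (w' - w) < \<delta> \<longrightarrow>
        Hm1_norm \<Omega> (\<lambda>\<phi>. F w' \<phi> - F w \<phi>) < \<epsilon>) \<and>
     (\<exists>C_F\<ge>0. \<forall>w\<in>X. Hm1_norm \<Omega> (F w) \<le> C_F * (norm w + 1))"


section \<open>Hamiltonians\<close>

definition control_data ::
    "'a::euclidean_space set \<Rightarrow> 'c::metric_space set \<Rightarrow> ('a \<Rightarrow> 'c \<Rightarrow> 'a) \<Rightarrow> ('a \<Rightarrow> 'c \<Rightarrow> real) \<Rightarrow> bool"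
  where
  "control_data \<Omega> A b f \<longleftrightarrow> compact A \<and> A \<noteq> {} \<and>
     continuous_on (closure \<Omega> \<times> A) (\<lambda>(x, \<alpha>). b x \<alpha>) \<and>
     continuous_on (closure \<Omega> \<times> A) (\<lambda>(x, \<alpha>). f x \<alpha>)"

definition hamiltonian ::
    "'c set \<Rightarrow> ('a::euclidean_space \<Rightarrow> 'c \<Rightarrow> 'a) \<Rightarrow> ('a \<Rightarrow> 'c \<Rightarrow> real) \<Rightarrow> 'a \<Rightarrow> 'a \<Rightarrow> real" where
  "hamiltonian A b f x p = (SUP \<alpha>\<in>A. b x \<alpha> \<bullet> p - f x \<alpha>)"

definition p_lipschitz ::
    "'a::euclidean_space set \<Rightarrow> real \<Rightarrow> ('a \<Rightarrow> 'a \<Rightarrow> real) \<Rightarrow> bool" where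
  "p_lipschitz \<Omega> L H \<longleftrightarrow> (\<forall>x\<in>closure \<Omega>. \<forall>p q. \<bar>H x p - H x q\<bar> \<le> L * norm (p - q))"

definition subdiff_p :: "('a::euclidean_space \<Rightarrow> 'a \<Rightarrow> real) \<Rightarrow> 'a \<Rightarrow> 'a \<Rightarrow> 'a set" where
  "subdiff_p H x p = {\<beta>. \<forall>q. H x q \<ge> H x p + \<beta> \<bullet> (q - p)}"

definition DpH ::
    "'a::euclidean_space set \<Rightarrow> ('a \<Rightarrow> 'a \<Rightarrow> real) \<Rightarrow> ('a \<Rightarrow> real) \<Rightarrow> ('a \<Rightarrow> 'a) set" where
  "DpH \<Omega> H v =
     {\<beta> \<in> Linf_on \<Omega>. AE x in lebesgue_on \<Omega>. \<beta> x \<in> subdiff_p H x (wgrad \<Omega> v x)}"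

definition grad_p :: "('a::euclidean_space \<Rightarrow> 'a \<Rightarrow> real) \<Rightarrow> 'a \<Rightarrow> 'a \<Rightarrow> 'a" where
  "grad_p H x p = (THE D. GDERIV (H x) p :> D)"

definition admissible_regularization ::
    "'a::euclidean_space set \<Rightarrow> real \<Rightarrow> ('a \<Rightarrow> 'a \<Rightarrow> real) \<Rightarrow> (real \<Rightarrow> 'a \<Rightarrow> 'a \<Rightarrow> real)
       \<Rightarrow> (real \<Rightarrow> real) \<Rightarrow> bool" where
  "admissible_regularization \<Omega> L_H H Hreg \<omega> \<longleftrightarrow>
     continuous_on {0..1} \<omega> \<and> (\<forall>\<sigma>\<in>{0..1}. 0 \<le> \<omega> \<sigma>) \<and> \<omega> 0 = 0 \<and>
     (\<forall>l\<in>{0<..1}.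
        continuous_on (closure \<Omega> \<times> UNIV) (\<lambda>(x, p). Hreg l x p) \<and>
        p_lipschitz \<Omega> L_H (Hreg l) \<and>
        (\<forall>x\<in>closure \<Omega>. convex_on UNIV (Hreg l x)) \<and>
        (\<forall>x\<in>closure \<Omega>. \<forall>p. \<exists>D. GDERIV (Hreg l x) p :> D) \<and>
        continuous_on (closure \<Omega> \<times> UNIV) (\<lambda>(x, p). grad_p (Hreg l) x p) \<and>
        (\<forall>x\<in>closure \<Omega>. \<forall>p. \<bar>Hreg l x p - H x p\<bar> \<le> \<omega> l))"


section \<open>Weak solutions\<close>

definition HJB_weak ::
    "'a::euclidean_space set \<Rightarrow> real \<Rightarrow> ('a \<Rightarrow> 'a \<Rightarrow> real) \<Rightarrow> (('a \<Rightarrow> real) \<Rightarrow> real)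
       \<Rightarrow> ('a \<Rightarrow> real) \<Rightarrow> bool" where
  "HJB_weak \<Omega> \<nu> H R u \<longleftrightarrow> (\<forall>\<psi>\<in>H10 \<Omega>.
     (LINT x|lebesgue_on \<Omega>. \<nu> * (wgrad \<Omega> u x \<bullet> wgrad \<Omega> \<psi> x) + H x (wgrad \<Omega> u x) * \<psi> x) = R \<psi>)"

definition KFP_weak ::
    "'a::euclidean_space set \<Rightarrow> real \<Rightarrow> ('a \<Rightarrow> 'a) \<Rightarrow> (('a \<Rightarrow> real) \<Rightarrow> real)
       \<Rightarrow> ('a \<Rightarrow> real) \<Rightarrow> bool" where
  "KFP_weak \<Omega> \<nu> \<beta> G m \<longleftrightarrow> (\<forall>\<phi>\<in>H10 \<Omega>.
     (LINT x|lebesgue_on \<Omega>. \<nu> * (wgrad \<Omega> m x \<bullet> wgrad \<Omega> \<phi> x) + m x * (\<beta> x \<bullet> wgrad \<Omega> \<phi> x)) = G \<phi>)"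

definition mfg_pdi_solution ::
    "'a::euclidean_space set \<Rightarrow> real \<Rightarrow> (('a \<Rightarrow> real) \<Rightarrow> real) \<Rightarrow> (('a \<Rightarrow> real) \<Rightarrow> 'x)
       \<Rightarrow> ('x \<Rightarrow> ('a \<Rightarrow> real) \<Rightarrow> real) \<Rightarrow> ('a \<Rightarrow> 'a \<Rightarrow> real) \<Rightarrow> ('a \<Rightarrow> real) \<Rightarrow> ('a \<Rightarrow> real) \<Rightarrow> bool"
  where
  "mfg_pdi_solution \<Omega> \<nu> G \<iota> F H u m \<longleftrightarrow> u \<in> H10 \<Omega> \<and> m \<in> H10 \<Omega> \<and>
     (\<exists>\<beta>\<in>DpH \<Omega> H u. HJB_weak \<Omega> \<nu> H (F (\<iota> m)) u \<and> KFP_weak \<Omega> \<nu> \<beta> G m)"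

definition regularized_solution ::
    "'a::euclidean_space set \<Rightarrow> real \<Rightarrow> (('a \<Rightarrow> real) \<Rightarrow> real) \<Rightarrow> (('a \<Rightarrow> real) \<Rightarrow> 'x)
       \<Rightarrow> ('x \<Rightarrow> ('a \<Rightarrow> real) \<Rightarrow> real) \<Rightarrow> ('a \<Rightarrow> 'a \<Rightarrow> real) \<Rightarrow> ('a \<Rightarrow> real) \<Rightarrow> ('a \<Rightarrow> real) \<Rightarrow> bool"
  where
  "regularized_solution \<Omega> \<nu> G \<iota> F Hl u m \<longleftrightarrow> u \<in> H10 \<Omega> \<and> m \<in> H10 \<Omega> \<and>
     HJB_weak \<Omega> \<nu> Hl (F (\<iota> m)) u \<and>
     KFP_weak \<Omega> \<nu> (\<lambda>x. grad_p Hl x (wgrad \<Omega> u x)) G m"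


section \<open>Structural assumptions on the data\<close>

definition nonneg_functional :: "'a::euclidean_space set \<Rightarrow> (('a \<Rightarrow> real) \<Rightarrow> real) \<Rightarrow> bool" where
  "nonneg_functional \<Omega> G \<longleftrightarrow>
     (\<forall>\<phi>\<in>H10 \<Omega>. (AE x in lebesgue_on \<Omega>. 0 \<le> \<phi> x) \<longrightarrow> 0 \<le> G \<phi>)"

definition strongly_monotone ::
    "'a::euclidean_space set \<Rightarrow> (('a \<Rightarrow> real) \<Rightarrow> 'x::banach) \<Rightarrow> ('x \<Rightarrow> ('a \<Rightarrow> real) \<Rightarrow> real)
       \<Rightarrow> real \<Rightarrow> bool" where
  "strongly_monotone \<Omega> \<iota> F c_F \<longleftrightarrow> (\<forall>m1\<in>H10 \<Omega>. \<forall>m2\<in>H10 \<Omega>.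
     F (\<iota> m1) (\<lambda>x. m1 x - m2 x) - F (\<iota> m2) (\<lambda>x. m1 x - m2 x) \<ge> c_F * (norm (\<iota> m1 - \<iota> m2))\<^sup>2)"

definition lipschitz_coupling ::
    "'a::euclidean_space set \<Rightarrow> 'x::banach set \<Rightarrow> ('x \<Rightarrow> ('a \<Rightarrow> real) \<Rightarrow> real) \<Rightarrow> real \<Rightarrow> bool" where
  "lipschitz_coupling \<Omega> X F L_F \<longleftrightarrow> (\<forall>w1\<in>X. \<forall>w2\<in>X.
     Hm1_norm \<Omega> (\<lambda>\<phi>. F w1 \<phi> - F w2 \<phi>) \<le> L_F * norm (w1 - w2))"

end

theory Submission
  imports Defs
begin

text \<open>Testing the difference of the two HJB equations with \<open>m - m\<^sub>\<lambda>\<close> and of the two KFP equations with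
  \<open>u - u\<^sub>\<lambda>\<close>, convexity of the Hamiltonians gives
  \<open>c\<^sub>F \<parallel>m - m\<^sub>\<lambda>\<parallel>\<^sub>X\<^sup>2 \<le> \<omega>(\<lambda>) \<integral> (m + m\<^sub>\<lambda>)\<close> because both densities are nonnegative.
  Their integrals are bounded by the data, and \<open>u - u\<^sub>\<lambda>\<close> solves a linearized HJB equation with bounded drift
  whose right-hand side is controlled by \<open>\<parallel>m - m\<^sub>\<lambda>\<parallel>\<^sub>X + \<omega>(\<lambda>)\<close>.

  The equations are not coercive, so the a priori bounds with constants uniform in the drift come from testing with
  truncations: by an averaging argument over translations, \<open>\<integral>\<^sub>E v\<^sup>2\<close> is a small multiple of the squared norm
  of the gradient of \<open>v\<close> when \<open>E\<close> has small measure, so the drift can be absorbed on slices between two levels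
  of the solution.\<close>

section \<open>Smooth functions\<close>

text \<open>The constant has to be fixed before the Hamiltonians, the coupling and the Banach space,
  so the two a priori bounds must be uniform over all drifts bounded by \<open>L\<close>. They are
  proved for the abstract problems \<open>kfp_problem\<close> and \<open>hjb_problem\<close>, which
  retain of the data only a bound on the drift and a bound of the right-hand side against the
  gradient of the test function. Of \<open>G\<close> only the sign and the dual norm
  \<open>N\<close> enter: the sign makes the densities nonnegative, the norm bounds their integrals.

  The exponent 1/2 has a single source: strong monotonicity controls the square of the distance of
  the densities by a multiple of \<omega>. Everything after that is linear, and a leftover term
  \<omega> is at most \<open>sqrt \<bar>W\<bar>\<close> times its own square root, \<open>W\<close>
  being the supremum of \<omega>.

  The inequality on small sets takes the place of a Sobolev embedding. It involves square integrals
  only and reads the same in every dimension. The price is that superlevel sets must be cut into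
  pieces of prescribed small measure, which level sets of positive measure obstruct.\<close>

lemma Ck_fun_SucI:
  assumes "\<And>x. (f has_derivative f' x) (at x)"
    and "\<And>i. i \<in> Basis \<Longrightarrow> Ck_fun k (\<lambda>x. f' x i)"
  shows "Ck_fun (Suc k) f"
proof -
  have "frechet_derivative f (at x) = f' x" for x
    using frechet_derivative_at[OF assms(1)] by metis
  then show ?thesis
    using assms by (auto simp: differentiable_def)
qed

lemma Ck_fun_SucD:
  assumes "Ck_fun (Suc k) f"
  shows "(f has_derivative frechet_derivative f (at x)) (at x)"
    and "i \<in> Basis \<Longrightarrow> Ck_fun k (\<lambda>x. frechet_derivative f (at x) i)"
  using assms by (auto simp: frechet_derivative_works)

lemma Ck_fun_pred: "Ck_fun (Suc k) f \<Longrightarrow> Ck_fun k f"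
proof (induction k arbitrary: f)
  case 0
  then show ?case
    by (auto simp: continuous_at_imp_continuous_on differentiable_imp_continuous_within)
qed auto

lemma Ck_fun_const: "Ck_fun k (\<lambda>x. c)"
proof (induction k arbitrary: c)
  case (Suc k)
  show ?case by (rule Ck_fun_SucI[OF has_derivative_const Suc.IH])
qed auto

lemma Ck_fun_inner: "Ck_fun k (\<lambda>x. x \<bullet> a)"
proof (cases k)
  case (Suc k)
  show ?thesis unfolding Suc
    by (rule Ck_fun_SucI[where f'="\<lambda>_ x. x \<bullet> a"]) (auto intro!: derivative_eq_intros Ck_fun_const)
qed (auto intro!: continuous_intros)

lemma Ck_fun_add: "Ck_fun k f \<Longrightarrow> Ck_fun k g \<Longrightarrow> Ck_fun k (\<lambda>x. f x + g x)"
proof (induction k arbitrary: f g)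
  case (Suc k)
  show ?case
    by (rule Ck_fun_SucI[OF has_derivative_add[OF Ck_fun_SucD(1)[OF Suc.prems(1)] Ck_fun_SucD(1)[OF Suc.prems(2)]]])
       (intro Suc.IH Ck_fun_SucD(2)[OF Suc.prems(1)] Ck_fun_SucD(2)[OF Suc.prems(2)])
qed (auto intro: continuous_intros)

lemma Ck_fun_mult: "Ck_fun k f \<Longrightarrow> Ck_fun k g \<Longrightarrow> Ck_fun k (\<lambda>x. f x * g x)"
proof (induction k arbitrary: f g)
  case (Suc k)
  show ?case
    by (rule Ck_fun_SucI[OF has_derivative_mult[OF Ck_fun_SucD(1)[OF Suc.prems(1)] Ck_fun_SucD(1)[OF Suc.prems(2)]]])
       (intro Ck_fun_add Suc.IH Ck_fun_pred[OF Suc.prems(1)] Ck_fun_pred[OF Suc.prems(2)]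
         Ck_fun_SucD(2)[OF Suc.prems(1)] Ck_fun_SucD(2)[OF Suc.prems(2)])
qed (auto intro: continuous_intros)

lemma Ck_fun_cmult: "Ck_fun k f \<Longrightarrow> Ck_fun k (\<lambda>x. c * f x)"
  by (intro Ck_fun_mult Ck_fun_const)

lemma Ck_fun_diff: "Ck_fun k f \<Longrightarrow> Ck_fun k g \<Longrightarrow> Ck_fun k (\<lambda>x. f x - g x)"
  using Ck_fun_add[of k f "\<lambda>x. -1 * g x"] Ck_fun_cmult[of k g "-1"] by simp

lemma Ck_fun_prod:
  "finite I \<Longrightarrow> (\<And>i. i \<in> I \<Longrightarrow> Ck_fun k (f i)) \<Longrightarrow> Ck_fun k (\<lambda>x. \<Prod>i\<in>I. f i x)"
  by (induction rule: finite_induct) (auto intro: Ck_fun_const Ck_fun_mult)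

lemma Ck_fun_real_SucI:
  fixes f :: "real \<Rightarrow> real"
  assumes "\<And>x. (f has_real_derivative f' x) (at x)" "Ck_fun k f'"
  shows "Ck_fun (Suc k) f"
  by (rule Ck_fun_SucI[OF assms(1)[unfolded has_field_derivative_def]]) (use assms(2) in auto)

lemma Ck_fun_compose:
  fixes g :: "real \<Rightarrow> real" and f :: "'a::euclidean_space \<Rightarrow> real"
  shows "Ck_fun k g \<Longrightarrow> Ck_fun k f \<Longrightarrow> Ck_fun k (\<lambda>x. g (f x))"
proof (induction k arbitrary: g f)
  case 0
  then show ?case by (auto intro: continuous_on_compose2)
next
  case (Suc k)
  \<comment> \<open>On the reals a derivative is multiplication by its value at 1, and 1 is the only
    basis vector. The outer derivative thus becomes a \<open>Ck_fun\<close> function of one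
    variable, to which the induction hypothesis applies.\<close>
  have g: "(g has_derivative (\<lambda>h. frechet_derivative g (at y) 1 * h)) (at y)" for y
  proof -
    have "frechet_derivative g (at y) h = frechet_derivative g (at y) 1 * h" for h
      using linear_scale[OF has_derivative_linear[OF Ck_fun_SucD(1)[OF Suc.prems(1)]], of y h 1]
      by (simp add: mult.commute)
    then show ?thesis
      using Ck_fun_SucD(1)[OF Suc.prems(1), of y] by (metis ext)
  qed
  show ?case
  proof (rule Ck_fun_SucI)
    show "((\<lambda>x. g (f x)) has_derivative
        (\<lambda>h. frechet_derivative g (at (f x)) 1 * frechet_derivative f (at x) h)) (at x)" for x
      using diff_chain_at[OF Ck_fun_SucD(1)[OF Suc.prems(2)] g] by (simp add: o_def)
    fix i :: 'a assume "i \<in> Basis"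
    then show "Ck_fun k (\<lambda>x. frechet_derivative g (at (f x)) 1 * frechet_derivative f (at x) i)"
      using Suc.IH[OF Ck_fun_SucD(2)[OF Suc.prems(1), of 1] Ck_fun_pred[OF Suc.prems(2)]]
      by (intro Ck_fun_mult Ck_fun_SucD(2)[OF Suc.prems(2)]) auto
  qed
qed

section \<open>Functions vanishing to infinite order at 0, and smooth bumps on boxes\<close>

definition flat :: "nat \<Rightarrow> real \<Rightarrow> real" where
  "flat n x = (if 0 < x then exp (- (1 / x)) / x ^ n else 0)"

text \<open>One term of the exponential series is bounded by the whole sum.\<close>

lemma power_le_fact_mult_exp:
  fixes y :: real
  assumes "0 \<le> y"
  shows "y ^ k \<le> fact k * exp y"
proof -
  have s: "(\<lambda>n. y ^ n /\<^sub>R fact n) sums exp y"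
    by (rule exp_converges)
  have "(\<Sum>n\<in>{k}. y ^ n /\<^sub>R fact n) \<le> exp y"
    using sum_le_suminf[OF sums_summable[OF s], of "{k}"] assms sums_unique[OF s] by auto
  then show ?thesis by (simp add: field_simps)
qed

text \<open>The previous inequality with argument \<open>1 / x\<close> and exponent
  \<open>n + k\<close>. It expresses vanishing to every order at 0; with \<open>k = 2\<close> the
  difference quotient at 0 tends to 0.\<close>

lemma flat_bound: "\<bar>flat n x\<bar> \<le> fact (n + k) * \<bar>x\<bar> ^ k"
proof (cases "0 < x")
  case True
  have "(1 / x) ^ (n + k) \<le> fact (n + k) * exp (1 / x)"
    using True by (intro power_le_fact_mult_exp) auto
  then have "(1 / x) ^ n * exp (- (1 / x)) \<le> fact (n + k) * x ^ k"
    using True by (simp add: field_simps power_add exp_minus)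
  then show ?thesis
    using True by (simp add: flat_def field_simps)
qed (auto simp: flat_def)

text \<open>The index \<open>n\<close> is there because differentiation then stays inside the
  family, so smoothness follows for all members at once by induction.\<close>

lemma flat_has_derivative:
  "(flat n has_real_derivative flat (n + 2) x - real n * flat (n + 1) x) (at x)"
proof -
  consider "x > 0" | "x < 0" | "x = 0" by linarith
  then show ?thesis
  proof cases
    case 1
    have "((\<lambda>x. exp (- (1 / x)) / x ^ n) has_real_derivative
        flat (n + 2) x - real n * flat (n + 1) x) (at x)"
    proof (cases n)
      case 0
      then show ?thesis using 1
        by (auto intro!: derivative_eq_intros simp: flat_def power2_eq_square)
    next
      case (Suc m)
      have "((\<lambda>x. exp (- (1 / x))) has_real_derivative exp (- (1 / x)) / x\<^sup>2) (at x)"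
        using 1 by (auto intro!: derivative_eq_intros simp: power2_eq_square)
      from DERIV_divide[OF this DERIV_pow[of n x]] 1
      have "((\<lambda>x. exp (- (1 / x)) / x ^ n) has_real_derivative
          (exp (- (1 / x)) / x\<^sup>2 * x ^ n - exp (- (1 / x)) * (real n * x ^ m)) / (x ^ n * x ^ n)) (at x)"
        using Suc by simp
      moreover have "(exp (- (1 / x)) / x\<^sup>2 * x ^ n - exp (- (1 / x)) * (real n * x ^ m)) / (x ^ n * x ^ n)
          = flat (n + 2) x - real n * flat (n + 1) x"
        unfolding flat_def diff_divide_distrib Suc using 1 by (simp add: power2_eq_square)
      ultimately show ?thesis by simp
    qed
    then show ?thesis
      by (rule has_field_derivative_transform_within_open[where S="{0<..}"]) (use 1 in \<open>auto simp: flat_def\<close>)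
  next
    case 2
    have "((\<lambda>x. 0) has_real_derivative flat (n + 2) x - real n * flat (n + 1) x) (at x)"
      using 2 by (auto simp: flat_def)
    then show ?thesis
      by (rule has_field_derivative_transform_within_open[where S="{..<0}"]) (use 2 in \<open>auto simp: flat_def\<close>)
  next
    case 3
    have "(\<lambda>h. (flat n (0 + h) - flat n 0) / h) \<midarrow>0\<rightarrow> 0"
    proof (rule Lim_null_comparison)
      show "\<forall>\<^sub>F h in at 0. norm ((flat n (0 + h) - flat n 0) / h) \<le> fact (n + 2) * \<bar>h\<bar>"
      proof (rule always_eventually, rule allI)
        fix h :: real
        show "norm ((flat n (0 + h) - flat n 0) / h) \<le> fact (n + 2) * \<bar>h\<bar>"
          using flat_bound[of n h 2]
          by (cases "h = 0") (auto simp: flat_def field_simps power2_eq_square)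
      qed
      show "(\<lambda>h::real. fact (n + 2) * \<bar>h\<bar>) \<midarrow>0\<rightarrow> 0"
        by (auto intro!: tendsto_eq_intros)
    qed
    then show ?thesis
      using 3 by (simp add: DERIV_def flat_def)
  qed
qed

lemma Ck_fun_flat: "Ck_fun k (flat n)"
proof (induction k arbitrary: n)
  case 0
  show ?case
    by (auto intro: continuous_at_imp_continuous_on DERIV_isCont flat_has_derivative)
next
  case (Suc k)
  show ?case
    by (rule Ck_fun_real_SucI[OF flat_has_derivative]) (intro Ck_fun_diff Ck_fun_cmult Suc.IH)
qed

lemma flat_0_bounds: "0 \<le> flat 0 x" "flat 0 x \<le> 1"
  by (auto simp: flat_def)

lemma flat_0_scaled_tendsto:
  assumes "0 < x"
  shows "(\<lambda>n. flat 0 (real n * x)) \<longlonglongrightarrow> 1"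
proof -
  have "(\<lambda>n. exp (- (inverse (real (Suc n)) * (1 / x)))) \<longlonglongrightarrow> exp (- (0 * (1 / x)))"
    by (intro tendsto_intros LIMSEQ_inverse_real_of_nat)
  then have "(\<lambda>n. flat 0 (real (Suc n) * x)) \<longlonglongrightarrow> 1"
    using assms by (simp add: flat_def field_simps add_pos_nonneg)
  then show ?thesis by (rule LIMSEQ_imp_Suc)
qed

text \<open>Two factors per coordinate, one for each face. As \<open>n\<close> grows the product
  approaches the indicator of the open box, which carries orthogonality to test functions over to
  integrals over boxes.\<close>

definition box_bump :: "'a::euclidean_space \<Rightarrow> 'a \<Rightarrow> nat \<Rightarrow> 'a \<Rightarrow> real" where
  "box_bump a b n x =
     (\<Prod>i\<in>Basis. flat 0 (real n * (x \<bullet> i - a \<bullet> i)) * flat 0 (real n * (b \<bullet> i - x \<bullet> i)))"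

lemma Ck_fun_box_bump: "Ck_fun k (box_bump a b n)"
  unfolding box_bump_def
  by (intro Ck_fun_prod Ck_fun_mult Ck_fun_compose[OF Ck_fun_flat] Ck_fun_cmult Ck_fun_diff
      Ck_fun_inner Ck_fun_const finite_Basis)

lemma box_bump_eq_0:
  assumes "x \<notin> box a b"
  shows "box_bump a b n x = 0"
proof -
  obtain i where i: "i \<in> Basis" "x \<bullet> i \<le> a \<bullet> i \<or> b \<bullet> i \<le> x \<bullet> i"
    using assms by (force simp: mem_box)
  then have "flat 0 (real n * (x \<bullet> i - a \<bullet> i)) * flat 0 (real n * (b \<bullet> i - x \<bullet> i)) = 0"
    by (auto simp: flat_def mult_le_0_iff not_less zero_less_mult_iff)
  then show ?thesis
    unfolding box_bump_def using i(1) by (intro prod_zero) auto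
qed

lemma box_bump_bounds: "0 \<le> box_bump a b n x" "box_bump a b n x \<le> 1"
  unfolding box_bump_def
  by (auto intro!: prod_nonneg prod_le_1 mult_le_one mult_nonneg_nonneg flat_0_bounds)

lemma box_bump_tendsto: "(\<lambda>n. box_bump a b n x) \<longlonglongrightarrow> indicator (box a b) x"
proof (cases "x \<in> box a b")
  case True
  have "(\<lambda>n. box_bump a b n x) \<longlonglongrightarrow> (\<Prod>i\<in>(Basis::'a set). 1 * 1)"
    unfolding box_bump_def using True
    by (intro tendsto_prod tendsto_mult flat_0_scaled_tendsto) (auto simp: mem_box)
  then show ?thesis using True by simp
qed (simp add: box_bump_eq_0)

lemma test_functions_box_bump:
  assumes "cbox a b \<subseteq> \<Omega>"
  shows "box_bump a b n \<in> test_functions \<Omega>"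
  using assms box_bump_eq_0[of _ a b n] box_subset_cbox[of a b] compact_cbox[of a b] Ck_fun_box_bump
  unfolding test_functions_def by blast

section \<open>Square integrable functions\<close>

text \<open>Stated for an arbitrary measure because it serves both
  \<open>lebesgue_on \<Omega>\<close> and, where translations act, \<open>lborel\<close>.\<close>

definition L2 :: "'a measure \<Rightarrow> ('a \<Rightarrow> 'b::euclidean_space) set" where
  "L2 M = {f \<in> borel_measurable M. integrable M (\<lambda>x. (norm (f x))\<^sup>2)}"

definition norm2 :: "'a measure \<Rightarrow> ('a \<Rightarrow> 'b::euclidean_space) \<Rightarrow> real" where
  "norm2 M f = sqrt (LINT x|M. (norm (f x))\<^sup>2)"

lemma L2_set_on_eq: "L2_set_on \<Omega> = L2 (lebesgue_on \<Omega>)"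
  by (simp add: L2_set_on_def L2_def)

lemma L2_measurable [measurable_dest]: "f \<in> L2 M \<Longrightarrow> f \<in> borel_measurable M"
  by (simp add: L2_def)

lemma L2_integrable_power2: "f \<in> L2 M \<Longrightarrow> integrable M (\<lambda>x. (norm (f x))\<^sup>2)"
  by (simp add: L2_def)

lemma norm2_nonneg [simp]: "0 \<le> norm2 M f"
  by (simp add: norm2_def)

lemma norm2_power2: "(norm2 M f)\<^sup>2 = (LINT x|M. (norm (f x))\<^sup>2)"
  by (simp add: norm2_def)

lemma L2_dominated:
  assumes "g \<in> L2 M" "f \<in> borel_measurable M" "AE x in M. norm (f x) \<le> norm (g x)"
  shows "f \<in> L2 M"
  unfolding L2_def
proof (intro CollectI conjI)
  show "integrable M (\<lambda>x. (norm (f x))\<^sup>2)"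
    by (rule Bochner_Integration.integrable_bound[OF L2_integrable_power2[OF assms(1)]])
       (use assms in \<open>auto elim!: eventually_mono intro!: power_mono\<close>)
qed (fact assms)

lemma norm2_mono:
  assumes "g \<in> L2 M" "f \<in> borel_measurable M" "AE x in M. norm (f x) \<le> norm (g x)"
  shows "norm2 M f \<le> norm2 M g"
  unfolding norm2_def
  by (rule real_sqrt_le_mono, rule integral_mono_AE)
     (use assms L2_dominated[OF assms] in \<open>auto simp: L2_def elim!: eventually_mono intro!: power_mono\<close>)

lemma L2_cong_AE:
  assumes "f \<in> L2 M" "g \<in> borel_measurable M" "AE x in M. f x = g x"
  shows "g \<in> L2 M"
  using assms by (intro L2_dominated[OF assms(1,2)]) auto

lemma norm2_cong_AE:
  assumes "f \<in> borel_measurable M" "g \<in> borel_measurable M" "AE x in M. norm (f x) = norm (g x)"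
  shows "norm2 M f = norm2 M g"
  unfolding norm2_def
  by (rule arg_cong[where f=sqrt], rule integral_cong_AE) (use assms in auto)

lemma L2_zero [simp]: "(\<lambda>x. 0) \<in> L2 M"
  by (simp add: L2_def)

lemma L2_scaleR: "f \<in> L2 M \<Longrightarrow> (\<lambda>x. c *\<^sub>R f x) \<in> L2 M"
  by (auto simp: L2_def power_mult_distrib)

lemma norm2_scaleR: "norm2 M (\<lambda>x. c *\<^sub>R f x) = \<bar>c\<bar> * norm2 M f"
  by (simp add: norm2_def power_mult_distrib real_sqrt_mult)

lemma integrable_norm_mult:
  fixes f :: "'a \<Rightarrow> 'b::euclidean_space" and g :: "'a \<Rightarrow> 'c::euclidean_space"
  assumes "f \<in> L2 M" "g \<in> L2 M"
  shows "integrable M (\<lambda>x. norm (f x) * norm (g x))"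
proof (rule Bochner_Integration.integrable_bound)
  show "integrable M (\<lambda>x. (norm (f x))\<^sup>2 + (norm (g x))\<^sup>2)"
    using assms by (auto simp: L2_def)
  show "AE x in M. norm (norm (f x) * norm (g x)) \<le> norm ((norm (f x))\<^sup>2 + (norm (g x))\<^sup>2)"
  proof (rule AE_I2)
    fix x
    have "2 * norm (f x) * norm (g x) \<le> (norm (f x))\<^sup>2 + (norm (g x))\<^sup>2"
      by (rule sum_squares_bound)
    moreover have "0 \<le> norm (f x) * norm (g x)" by simp
    ultimately have "norm (f x) * norm (g x) \<le> (norm (f x))\<^sup>2 + (norm (g x))\<^sup>2" by linarith
    then show "norm (norm (f x) * norm (g x)) \<le> norm ((norm (f x))\<^sup>2 + (norm (g x))\<^sup>2)"
      by (simp add: abs_mult)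
  qed
qed (use assms in \<open>auto simp: L2_def\<close>)

lemma integrable_inner_L2:
  assumes "f \<in> L2 M" "g \<in> L2 M"
  shows "integrable M (\<lambda>x. f x \<bullet> g x)"
  by (rule Bochner_Integration.integrable_bound[OF integrable_norm_mult[OF assms]])
     (use assms in \<open>auto simp: L2_def Cauchy_Schwarz_ineq2\<close>)

lemma integrable_mult_L2:
  fixes f g :: "'a \<Rightarrow> real"
  assumes "f \<in> L2 M" "g \<in> L2 M"
  shows "integrable M (\<lambda>x. f x * g x)"
  using integrable_inner_L2[OF assms] by simp

lemma L2_add:
  assumes "f \<in> L2 M" "g \<in> L2 M"
  shows "(\<lambda>x. f x + g x) \<in> L2 M"
  unfolding L2_def
proof (intro CollectI conjI)
  have "integrable M (\<lambda>x. (norm (f x))\<^sup>2 + 2 * (f x \<bullet> g x) + (norm (g x))\<^sup>2)"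
    using assms integrable_inner_L2[OF assms] by (auto simp: L2_def)
  then show "integrable M (\<lambda>x. (norm (f x + g x))\<^sup>2)"
    by (simp add: power2_norm_eq_inner inner_add inner_commute algebra_simps)
qed (use assms in \<open>auto simp: L2_def\<close>)

lemma L2_minus: "f \<in> L2 M \<Longrightarrow> (\<lambda>x. - f x) \<in> L2 M"
  by (auto simp: L2_def)

lemma norm2_minus: "norm2 M (\<lambda>x. - f x) = norm2 M f"
  by (simp add: norm2_def)

lemma norm2_minus_commute: "norm2 M (\<lambda>x. f x - g x) = norm2 M (\<lambda>x. g x - f x)"
  by (simp add: norm2_def norm_minus_commute)

lemma L2_diff: "f \<in> L2 M \<Longrightarrow> g \<in> L2 M \<Longrightarrow> (\<lambda>x. f x - g x) \<in> L2 M"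
  using L2_add[OF _ L2_minus, of f M g] by simp

lemma L2_norm: "f \<in> L2 M \<Longrightarrow> (\<lambda>x. norm (f x)) \<in> L2 M"
  by (auto simp: L2_def)

lemma norm2_eq_0:
  assumes "f \<in> L2 M" "norm2 M f = 0"
  shows "AE x in M. f x = 0"
proof -
  have "(LINT x|M. (norm (f x))\<^sup>2) = 0"
    using assms(2) by (simp add: norm2_def)
  then have "AE x in M. (norm (f x))\<^sup>2 = 0"
    by (subst (asm) integral_nonneg_eq_0_iff_AE) (use assms in \<open>auto simp: L2_def\<close>)
  then show ?thesis by simp
qed

lemma integral_norm_mult_le:
  fixes f :: "'a \<Rightarrow> 'b::euclidean_space" and g :: "'a \<Rightarrow> 'c::euclidean_space"
  assumes f: "f \<in> L2 M" and g: "g \<in> L2 M"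
  shows "(LINT x|M. norm (f x) * norm (g x)) \<le> norm2 M f * norm2 M g"
proof -
  let ?I = "LINT x|M. norm (f x) * norm (g x)"
  \<comment> \<open>Expands the square of \<open>s * norm (f x) - t * norm (g x)\<close>. The choice
    \<open>s = norm2 M g\<close>, \<open>t = norm2 M f\<close> gives the claim after division; if
    one norm is zero, the product vanishes almost everywhere.\<close>
  have scaled: "2 * s * t * ?I \<le> s\<^sup>2 * (norm2 M f)\<^sup>2 + t\<^sup>2 * (norm2 M g)\<^sup>2" for s t
  proof -
    have "0 \<le> (LINT x|M. (s * norm (f x) - t * norm (g x))\<^sup>2)" by simp
    also have "\<dots> = (LINT x|M. s\<^sup>2 * (norm (f x))\<^sup>2 + t\<^sup>2 * (norm (g x))\<^sup>2
        - 2 * s * t * (norm (f x) * norm (g x)))"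
      by (simp add: power2_diff power_mult_distrib algebra_simps)
    also have "\<dots> = s\<^sup>2 * (norm2 M f)\<^sup>2 + t\<^sup>2 * (norm2 M g)\<^sup>2 - 2 * s * t * ?I"
      using f g integrable_norm_mult[OF f g] by (simp add: norm2_power2 L2_integrable_power2)
    finally show ?thesis by simp
  qed
  show ?thesis
  proof (cases "norm2 M f = 0 \<or> norm2 M g = 0")
    case True
    then have "AE x in M. norm (f x) * norm (g x) = 0"
      using norm2_eq_0[OF f] norm2_eq_0[OF g] by (auto elim!: eventually_mono)
    then have "?I = (LINT x|M. 0)"
      using f g by (intro integral_cong_AE) (auto simp: L2_def)
    then show ?thesis using True by auto
  next
    case False
    then have pos: "0 < norm2 M f" "0 < norm2 M g"
      using norm2_nonneg[of M f] norm2_nonneg[of M g] by linarith+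
    have "2 * (norm2 M g * norm2 M f) * ?I \<le> 2 * (norm2 M g * norm2 M f) * (norm2 M f * norm2 M g)"
      using scaled[of "norm2 M g" "norm2 M f"] by (simp add: power2_eq_square algebra_simps)
    then show ?thesis
      using pos by (subst (asm) mult_le_cancel_left_pos) auto
  qed
qed

lemma abs_integral_inner_le:
  assumes "f \<in> L2 M" "g \<in> L2 M"
  shows "\<bar>LINT x|M. f x \<bullet> g x\<bar> \<le> norm2 M f * norm2 M g"
proof -
  have "\<bar>LINT x|M. f x \<bullet> g x\<bar> \<le> (LINT x|M. \<bar>f x \<bullet> g x\<bar>)"
    using integral_norm_bound[of M "\<lambda>x. f x \<bullet> g x"] by simp
  also have "\<dots> \<le> (LINT x|M. norm (f x) * norm (g x))"
    by (intro integral_mono integrable_abs integrable_inner_L2 integrable_norm_mult assms Cauchy_Schwarz_ineq2)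
  also have "\<dots> \<le> norm2 M f * norm2 M g"
    by (rule integral_norm_mult_le[OF assms])
  finally show ?thesis .
qed

lemma norm2_triangle:
  assumes f: "f \<in> L2 M" and g: "g \<in> L2 M"
  shows "norm2 M (\<lambda>x. f x + g x) \<le> norm2 M f + norm2 M g"
proof (rule power2_le_imp_le)
  have "(norm2 M (\<lambda>x. f x + g x))\<^sup>2 = (LINT x|M. (norm (f x))\<^sup>2 + 2 * (f x \<bullet> g x) + (norm (g x))\<^sup>2)"
    unfolding norm2_power2
    by (intro Bochner_Integration.integral_cong) (auto simp: power2_norm_eq_inner inner_add inner_commute)
  also have "\<dots> = (norm2 M f)\<^sup>2 + 2 * (LINT x|M. f x \<bullet> g x) + (norm2 M g)\<^sup>2"
    using f g integrable_inner_L2[OF f g] by (simp add: norm2_power2 L2_integrable_power2)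
  also have "\<dots> \<le> (norm2 M f)\<^sup>2 + 2 * (norm2 M f * norm2 M g) + (norm2 M g)\<^sup>2"
    using abs_integral_inner_le[OF f g] by linarith
  also have "\<dots> = (norm2 M f + norm2 M g)\<^sup>2" by (simp add: power2_sum)
  finally show "(norm2 M (\<lambda>x. f x + g x))\<^sup>2 \<le> (norm2 M f + norm2 M g)\<^sup>2" .
qed simp

lemma norm2_triangle3:
  assumes "f \<in> L2 M" "g \<in> L2 M" "h \<in> L2 M"
  shows "norm2 M (\<lambda>x. f x - h x) \<le> norm2 M (\<lambda>x. f x - g x) + norm2 M (\<lambda>x. g x - h x)"
  using norm2_triangle[OF L2_diff[OF assms(1,2)] L2_diff[OF assms(2,3)]] by simp

lemma norm2_triangle_le:
  assumes "f \<in> L2 M" "g \<in> L2 M"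
  shows "norm2 M f \<le> norm2 M g + norm2 M (\<lambda>x. f x - g x)"
  using norm2_triangle[OF assms(2) L2_diff[OF assms]] by simp

lemma norm2_dominated_convergence:
  fixes f :: "nat \<Rightarrow> 'a \<Rightarrow> 'b::euclidean_space" and w :: "'a \<Rightarrow> 'c::euclidean_space"
  assumes w: "w \<in> L2 M" and f: "\<And>n. f n \<in> borel_measurable M" and g: "g \<in> borel_measurable M"
    and lim: "AE x in M. (\<lambda>n. f n x) \<longlonglongrightarrow> g x"
    and bound: "\<And>n. AE x in M. norm (f n x) \<le> norm (w x)"
  shows "(\<lambda>n. norm2 M (\<lambda>x. f n x - g x)) \<longlonglongrightarrow> 0" and "g \<in> L2 M"
proof -
  have all: "AE x in M. \<forall>n. norm (f n x) \<le> norm (w x)"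
    using bound by (simp add: AE_all_countable)
  have gw: "AE x in M. norm (g x) \<le> norm (w x)"
    using all lim by eventually_elim (auto intro: tendsto_upperbound[OF tendsto_norm])
  show "g \<in> L2 M"
    by (rule L2_dominated[OF w g gw])
  have "(\<lambda>n. LINT x|M. (norm (f n x - g x))\<^sup>2) \<longlonglongrightarrow> (LINT x|M. 0)"
  proof (rule integral_dominated_convergence)
    show "integrable M (\<lambda>x. 4 * (norm (w x))\<^sup>2)"
      using w by (simp add: L2_def)
    show "AE x in M. (\<lambda>n. (norm (f n x - g x))\<^sup>2) \<longlonglongrightarrow> 0"
      using lim
    proof eventually_elim
      case (elim x)
      have "(\<lambda>n. (norm (f n x - g x))\<^sup>2) \<longlonglongrightarrow> (norm (g x - g x))\<^sup>2"
        by (intro tendsto_intros elim)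
      then show ?case by simp
    qed
    show "AE x in M. norm ((norm (f n x - g x))\<^sup>2) \<le> 4 * (norm (w x))\<^sup>2" for n
      using all gw
    proof eventually_elim
      case (elim x)
      have "norm (f n x - g x) \<le> norm (w x) + norm (w x)"
        using elim by (intro order_trans[OF norm_triangle_ineq4] add_mono) auto
      then have "(norm (f n x - g x))\<^sup>2 \<le> (2 * norm (w x))\<^sup>2"
        by (intro power_mono) auto
      then show ?case by (simp add: power_mult_distrib)
    qed
  qed (use f g in auto)
  then have "(\<lambda>n. sqrt (LINT x|M. (norm (f n x - g x))\<^sup>2)) \<longlonglongrightarrow> sqrt 0"
    by (intro tendsto_real_sqrt) simp
  then show "(\<lambda>n. norm2 M (\<lambda>x. f n x - g x)) \<longlonglongrightarrow> 0"
    by (simp add: norm2_def)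
qed

text \<open>The squared differences converge to zero in L1, which provides the subsequence.\<close>

lemma norm2_AE_subseq:
  assumes "\<And>n. f n \<in> L2 M" "g \<in> L2 M" "(\<lambda>n. norm2 M (\<lambda>x. f n x - g x)) \<longlonglongrightarrow> 0"
  obtains r where "strict_mono r" "AE x in M. (\<lambda>n. f (r n) x) \<longlonglongrightarrow> g x"
proof -
  have "(\<lambda>n. (norm2 M (\<lambda>x. f n x - g x))\<^sup>2) \<longlonglongrightarrow> 0\<^sup>2"
    by (intro tendsto_intros assms)
  then have "(\<lambda>n. LINT x|M. norm ((norm (f n x - g x))\<^sup>2)) \<longlonglongrightarrow> 0"
    by (simp add: norm2_power2)
  then obtain r where r: "strict_mono r" "AE x in M. (\<lambda>n. (norm (f (r n) x - g x))\<^sup>2) \<longlonglongrightarrow> 0"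
    using tendsto_L1_AE_subseq[of M "\<lambda>n x. (norm (f n x - g x))\<^sup>2"]
      L2_integrable_power2[OF L2_diff[OF assms(1) assms(2)]] by auto
  have "AE x in M. (\<lambda>n. f (r n) x) \<longlonglongrightarrow> g x"
    using r(2)
  proof eventually_elim
    case (elim x)
    have "(\<lambda>n. sqrt ((norm (f (r n) x - g x))\<^sup>2)) \<longlonglongrightarrow> sqrt 0"
      by (intro tendsto_real_sqrt elim)
    then show ?case by (simp add: tendsto_norm_zero_iff LIM_zero_cancel)
  qed
  with r(1) show ?thesis by (rule that)
qed

lemma norm2_tendsto:
  assumes "\<And>n. f n \<in> L2 M" "g \<in> L2 M" "(\<lambda>n. norm2 M (\<lambda>x. f n x - g x)) \<longlonglongrightarrow> 0"
  shows "(\<lambda>n. norm2 M (f n)) \<longlonglongrightarrow> norm2 M g"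
proof -
  have "\<bar>norm2 M (f n) - norm2 M g\<bar> \<le> norm2 M (\<lambda>x. f n x - g x)" for n
    using norm2_triangle_le[OF assms(1)[of n] assms(2)] norm2_triangle_le[OF assms(2) assms(1)[of n]]
    by (simp add: norm2_minus_commute[of M g "f n"] abs_le_iff)
  then have "(\<lambda>n. norm2 M (f n) - norm2 M g) \<longlonglongrightarrow> 0"
    by (intro Lim_null_comparison[OF _ assms(3)]) auto
  then show ?thesis by (simp add: LIM_zero_cancel)
qed

lemma integral_inner_tendsto:
  assumes "\<And>n. f n \<in> L2 M" "g \<in> L2 M" "h \<in> L2 M" "(\<lambda>n. norm2 M (\<lambda>x. f n x - g x)) \<longlonglongrightarrow> 0"
  shows "(\<lambda>n. LINT x|M. f n x \<bullet> h x) \<longlonglongrightarrow> (LINT x|M. g x \<bullet> h x)"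
proof -
  have "\<bar>(LINT x|M. f n x \<bullet> h x) - (LINT x|M. g x \<bullet> h x)\<bar> \<le> norm2 M (\<lambda>x. f n x - g x) * norm2 M h" for n
    using abs_integral_inner_le[OF L2_diff[OF assms(1)[of n] assms(2)] assms(3)]
      integrable_inner_L2[OF assms(1)[of n] assms(3)] integrable_inner_L2[OF assms(2,3)]
    by (simp add: inner_diff_left)
  then have "\<forall>\<^sub>F n in sequentially. norm ((LINT x|M. f n x \<bullet> h x) - (LINT x|M. g x \<bullet> h x))
      \<le> norm2 M (\<lambda>x. f n x - g x) * norm2 M h"
    by simp
  moreover have "(\<lambda>n. norm2 M (\<lambda>x. f n x - g x) * norm2 M h) \<longlonglongrightarrow> 0"
    using tendsto_mult_right[OF assms(4), of "norm2 M h"] by simp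
  ultimately have "(\<lambda>n. (LINT x|M. f n x \<bullet> h x) - (LINT x|M. g x \<bullet> h x)) \<longlonglongrightarrow> 0"
    by (rule Lim_null_comparison)
  then show ?thesis by (simp add: LIM_zero_cancel)
qed

lemma L2_restrict:
  assumes "f \<in> L2 M" "E \<in> sets M"
  shows "(\<lambda>x. indicator E x *\<^sub>R f x) \<in> L2 M"
  using assms by (intro L2_dominated[OF assms(1)]) (auto simp: L2_def indicator_def)

lemma norm2_restrict_le:
  assumes "f \<in> L2 M" "E \<in> sets M"
  shows "norm2 M (\<lambda>x. indicator E x *\<^sub>R f x) \<le> norm2 M f"
  using assms by (intro norm2_mono[OF assms(1)]) (auto simp: L2_def indicator_def)

lemma (in finite_measure) L2_const: "(\<lambda>x. c) \<in> L2 M"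
  by (auto simp: L2_def)

lemma (in finite_measure) L2_imp_integrable:
  assumes "f \<in> L2 M"
  shows "integrable M f"
  by (rule Bochner_Integration.integrable_bound[OF integrable_norm_mult[OF assms L2_const[of "1::real"]]])
     (use assms in \<open>auto simp: L2_def\<close>)

lemma (in finite_measure) L2_indicator:
  assumes "E \<in> sets M"
  shows "(\<lambda>x. indicator E x :: real) \<in> L2 M"
  using L2_restrict[OF L2_const[of "1::real"] assms] by simp

lemma (in finite_measure) norm2_indicator:
  assumes "E \<in> sets M"
  shows "norm2 M (\<lambda>x. indicator E x :: real) = sqrt (measure M E)"
proof -
  have "(LINT x|M. (norm (indicator E x :: real))\<^sup>2) = (LINT x|M. indicator E x)"
    by (intro Bochner_Integration.integral_cong) (auto simp: indicator_def)
  also have "\<dots> = measure M E"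
    using assms by (simp add: Int_absorb2 sets.sets_into_space)
  finally show ?thesis by (simp add: norm2_def)
qed

lemma (in finite_measure) integral_norm_le_norm2:
  assumes "f \<in> L2 M"
  shows "(LINT x|M. norm (f x)) \<le> norm2 M f * sqrt (measure M (space M))"
  using integral_norm_mult_le[OF assms L2_indicator[OF sets.top]] norm2_indicator[OF sets.top]
    Bochner_Integration.integral_cong[OF refl, of M "\<lambda>x. norm (f x) * norm (indicator (space M) x :: real)" "\<lambda>x. norm (f x)"]
  by simp

section \<open>Weak gradients\<close>

lemma integral_lebesgue_on_eq_lborel:
  fixes f :: "'a::euclidean_space \<Rightarrow> real"
  assumes "\<Omega> \<in> sets lebesgue" "f \<in> borel_measurable borel" "\<And>x. x \<notin> \<Omega> \<Longrightarrow> f x = 0"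
  shows "integral\<^sup>L (lebesgue_on \<Omega>) f = integral\<^sup>L lborel f"
proof -
  have "(\<lambda>x. indicator \<Omega> x *\<^sub>R f x) = f"
    using assms(3) by (auto simp: indicator_def fun_eq_iff)
  then show ?thesis
    using assms by (simp add: integral_restrict_space integral_completion)
qed

lemma borel_measurable_lebesgue_onI:
  "f \<in> borel_measurable borel \<Longrightarrow> f \<in> borel_measurable (lebesgue_on \<Omega>)"
  by (intro measurable_restrict_space1 measurable_completion) simp

lemma integrable_compact_support:
  fixes f :: "'a::euclidean_space \<Rightarrow> 'b::euclidean_space"
  assumes "continuous_on UNIV f" "compact K" "\<And>x. x \<notin> K \<Longrightarrow> f x = 0"
  shows "integrable lborel f"
proof -
  have "(\<lambda>x. indicator K x *\<^sub>R f x) = f"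
    using assms(3) by (auto simp: indicator_def fun_eq_iff)
  then show ?thesis
    using borel_integrable_compact[OF assms(2) continuous_on_subset[OF assms(1)]] by simp
qed

lemma bounded_compact_support:
  fixes f :: "'a::euclidean_space \<Rightarrow> 'b::euclidean_space"
  assumes "continuous_on UNIV f" "compact K" "\<And>x. x \<notin> K \<Longrightarrow> f x = 0"
  obtains B where "0 \<le> B" "\<And>x. norm (f x) \<le> B"
proof -
  have "bounded (f ` K)"
    using assms by (intro compact_imp_bounded compact_continuous_image continuous_on_subset[OF assms(1)]) auto
  then obtain B where "\<And>x. x \<in> K \<Longrightarrow> norm (f x) \<le> B"
    by (auto simp: bounded_iff)
  then have "norm (f x) \<le> max B 0" for x
    by (cases "x \<in> K") (auto simp: assms(3) le_max_iff_disj)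
  then show ?thesis by (intro that[of "max B 0"]) auto
qed

section \<open>Classical gradients, difference quotients and integration by parts\<close>

definition gradient :: "('a::euclidean_space \<Rightarrow> real) \<Rightarrow> 'a \<Rightarrow> 'a" where
  "gradient f x = (\<Sum>i\<in>Basis. frechet_derivative f (at x) i *\<^sub>R i)"

lemma gradient_inner_Basis: "i \<in> Basis \<Longrightarrow> gradient f x \<bullet> i = frechet_derivative f (at x) i"
  by (simp add: gradient_def)

lemma gradient_has_derivative:
  assumes "Ck_fun (Suc 0) f"
  shows "(f has_derivative (\<lambda>h. gradient f x \<bullet> h)) (at x)"
proof -
  have d: "(f has_derivative frechet_derivative f (at x)) (at x)"
    by (rule Ck_fun_SucD(1)[OF assms])
  have "frechet_derivative f (at x) h = gradient f x \<bullet> h" for h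
  proof -
    have lin: "linear (frechet_derivative f (at x))"
      using d by (rule has_derivative_linear)
    have "frechet_derivative f (at x) h = frechet_derivative f (at x) (\<Sum>i\<in>Basis. (h \<bullet> i) *\<^sub>R i)"
      by (simp add: euclidean_representation)
    also have "\<dots> = (\<Sum>i\<in>Basis. (h \<bullet> i) * frechet_derivative f (at x) i)"
      by (simp add: linear_sum[OF lin] linear_scale[OF lin] del: euclidean_representation)
    also have "\<dots> = gradient f x \<bullet> h"
      by (simp add: gradient_def inner_sum_left inner_commute[of h] mult.commute)
    finally show ?thesis .
  qed
  then show ?thesis using d by (metis ext)
qed

lemma gradient_eqI:
  assumes "(f has_derivative (\<lambda>h. D \<bullet> h)) (at x)"
  shows "gradient f x = D"
  using frechet_derivative_at[OF assms, symmetric] by (simp add: gradient_def euclidean_representation)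

lemma continuous_gradient:
  assumes "Ck_fun (Suc 0) f"
  shows "continuous_on UNIV (gradient f)"
  unfolding gradient_def using assms by (intro continuous_intros) auto

lemma gradient_eq_0_off_support:
  fixes f :: "'a::euclidean_space \<Rightarrow> real"
  assumes "closed K" "\<And>x. x \<notin> K \<Longrightarrow> f x = 0" "x \<notin> K"
  shows "gradient f x = 0"
proof (rule gradient_eqI)
  have "((\<lambda>x. 0) has_derivative (\<lambda>h. 0 \<bullet> h)) (at x)" by simp
  then show "(f has_derivative (\<lambda>h. 0 \<bullet> h)) (at x)"
    by (rule has_derivative_transform_within_open[where s="- K"]) (use assms in auto)
qed

lemma Ck_fun_lipschitz:
  fixes f :: "'a::euclidean_space \<Rightarrow> real"
  assumes "Ck_fun (Suc 0) f" "\<And>x. norm (gradient f x) \<le> B"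
  shows "\<bar>f y - f x\<bar> \<le> B * norm (y - x)"
proof -
  have "norm (f y - f x) \<le> B * norm (y - x)"
  proof (rule differentiable_bound[OF convex_UNIV])
    show "(f has_derivative (\<lambda>h. gradient f x \<bullet> h)) (at x within UNIV)" for x
      using gradient_has_derivative[OF assms(1)] by simp
    show "onorm (\<lambda>h. gradient f x \<bullet> h) \<le> B" for x
      using assms(2)[of x]
      by (intro onorm_le) (metis Cauchy_Schwarz_ineq2 mult_right_mono norm_ge_zero order_trans real_norm_def)
  qed auto
  then show ?thesis by simp
qed

lemma directional_difference_tendsto:
  fixes f :: "'a::euclidean_space \<Rightarrow> real"
  assumes "Ck_fun (Suc 0) f"
  shows "(\<lambda>n. real (Suc n) * (f (x + inverse (real (Suc n)) *\<^sub>R h) - f x)) \<longlonglongrightarrow> gradient f x \<bullet> h"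
proof -
  have line: "((\<lambda>t::real. x + t *\<^sub>R h) has_derivative (\<lambda>t. t *\<^sub>R h)) (at 0)"
    by (auto intro!: derivative_eq_intros)
  have "((\<lambda>t::real. f (x + t *\<^sub>R h)) has_derivative (\<lambda>t. gradient f x \<bullet> (t *\<^sub>R h))) (at 0)"
    using diff_chain_at[OF line, of f "\<lambda>v. gradient f x \<bullet> v"] gradient_has_derivative[OF assms]
    by (simp add: o_def)
  then have "((\<lambda>t. f (x + t *\<^sub>R h)) has_real_derivative (gradient f x \<bullet> h)) (at 0)"
    by (simp add: has_field_derivative_def mult.commute[of _ "gradient f x \<bullet> h"])
  then have lim: "((\<lambda>t. (f (x + t *\<^sub>R h) - f x) / t) \<longlongrightarrow> gradient f x \<bullet> h) (at 0)"
    by (simp add: DERIV_def)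
  have "filterlim (\<lambda>n. inverse (real (Suc n))) (at 0) sequentially"
    using LIMSEQ_inverse_real_of_nat by (auto simp: filterlim_at)
  from filterlim_compose[OF lim this] show ?thesis
    by (simp add: divide_inverse mult.commute)
qed

lemma distr_lborel_translate: "distr lborel borel (\<lambda>x. x + c) = (lborel :: 'a::euclidean_space measure)"
proof -
  have "(\<lambda>x. x + c) = (+) c" by (auto simp: add.commute)
  then show ?thesis using lborel_distr_plus[of c] by simp
qed

lemma integral_lborel_translate:
  fixes f :: "'a::euclidean_space \<Rightarrow> 'b::euclidean_space"
  assumes "f \<in> borel_measurable borel"
  shows "(LINT x|lborel. f (x + c)) = (LINT x|lborel. f x)"
proof -
  have "(LINT x|distr lborel borel (\<lambda>x. x + c). f x) = (LINT x|lborel. f (x + c))"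
    using assms by (intro integral_distr) auto
  then show ?thesis by (simp add: distr_lborel_translate)
qed

text \<open>An integrable majorant for dominated convergence. The quotient is at most the Lipschitz
  constant times \<open>norm h\<close>, and since the step is at most 1 it vanishes outside a ball
  that exceeds the support by \<open>norm h\<close>.\<close>

lemma difference_quotient_dominated:
  fixes f :: "'a::euclidean_space \<Rightarrow> real"
  assumes f: "Ck_fun (Suc 0) f" and K: "compact K" "\<And>x. x \<notin> K \<Longrightarrow> f x = 0"
  obtains c \<rho> where "0 \<le> c"
    "\<And>n x. \<bar>real (Suc n) * (f (x + inverse (real (Suc n)) *\<^sub>R h) - f x)\<bar> \<le> c * indicator (cball 0 \<rho>) x"
proof -
  have grad0: "gradient f x = 0" if "x \<notin> K" for x
    using gradient_eq_0_off_support[OF compact_imp_closed[OF K(1)] K(2) that] .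
  obtain B where B: "0 \<le> B" "\<And>x. norm (gradient f x) \<le> B"
    using bounded_compact_support[OF continuous_gradient[OF f] K(1) grad0] by metis
  obtain r where r: "\<And>x. x \<in> K \<Longrightarrow> norm x \<le> r"
    using compact_imp_bounded[OF K(1)] by (auto simp: bounded_iff)
  show ?thesis
  proof (rule that)
    show "0 \<le> B * norm h" using B by simp
    fix n x
    define t where "t = inverse (real (Suc n))"
    have t: "0 < t" "t \<le> 1" "real (Suc n) * t = 1" by (auto simp: t_def divide_simps)
    have "\<bar>real (Suc n) * (f (x + t *\<^sub>R h) - f x)\<bar> \<le> B * norm h * indicator (cball 0 (r + norm h)) x"
    proof (cases "x \<in> cball 0 (r + norm h)")
      case True
      have "real (Suc n) * \<bar>f (x + t *\<^sub>R h) - f x\<bar> \<le> real (Suc n) * (B * (t * norm h))"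
        using Ck_fun_lipschitz[OF f B(2), of "x + t *\<^sub>R h" x] t(1) by (intro mult_left_mono) (auto simp: ac_simps)
      also have "\<dots> = (real (Suc n) * t) * (B * norm h)" by (simp only: ac_simps)
      also have "\<dots> = B * norm h" unfolding t(3) by simp
      finally show ?thesis using True by (simp add: abs_mult del: of_nat_Suc)
    next
      case False
      have "norm (t *\<^sub>R h) \<le> norm h" using t by (simp add: mult_left_le_one_le)
      moreover have "norm (x + t *\<^sub>R h - t *\<^sub>R h) \<le> norm (x + t *\<^sub>R h) + norm (t *\<^sub>R h)"
        by (rule norm_triangle_ineq4)
      ultimately have "norm x \<le> norm (x + t *\<^sub>R h) + norm h"
        unfolding add_diff_cancel_right' by linarith
      then have "x \<notin> K" "x + t *\<^sub>R h \<notin> K"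
        using False r[of x] r[of "x + t *\<^sub>R h"] norm_ge_zero[of h] by auto
      then show ?thesis using B(1) by (simp add: K(2))
    qed
    then show "\<bar>real (Suc n) * (f (x + inverse (real (Suc n)) *\<^sub>R h) - f x)\<bar>
        \<le> B * norm h * indicator (cball 0 (r + norm h)) x"
      unfolding t_def .
  qed
qed

lemma integrable_indicator_cball:
  "integrable lborel (\<lambda>x::'a::euclidean_space. c * indicator (cball 0 \<rho>) x :: real)"
  by (intro integrable_mult_right integrable_real_indicator)
     (use emeasure_lborel_cball_finite[of "0::'a" \<rho>] in \<open>auto simp: less_top\<close>)

text \<open>By translation invariance every difference quotient has integral zero, and the quotients
  converge dominatedly to the directional derivative.\<close>

lemma integral_gradient_compact_support:
  fixes f :: "'a::euclidean_space \<Rightarrow> real"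
  assumes f: "Ck_fun (Suc 0) f" and K: "compact K" "\<And>x. x \<notin> K \<Longrightarrow> f x = 0"
  shows "(LINT x|lborel. gradient f x \<bullet> h) = 0"
proof -
  have cont: "continuous_on UNIV f" using Ck_fun_pred[OF f] by simp
  define D where "D n x = real (Suc n) * (f (x + inverse (real (Suc n)) *\<^sub>R h) - f x)" for n x
  obtain c \<rho> where dom: "\<And>n x. \<bar>D n x\<bar> \<le> c * indicator (cball 0 \<rho>) x"
    using difference_quotient_dominated[OF f K, of h] unfolding D_def by metis
  have "(LINT x|lborel. D n x) = 0" for n
  proof -
    have i: "integrable lborel f"
      by (rule integrable_compact_support[OF cont K])
    have j: "integrable lborel (\<lambda>x. f (x + inverse (real (Suc n)) *\<^sub>R h))"
    proof (rule integrable_compact_support)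
      show "compact ((\<lambda>x. x - inverse (real (Suc n)) *\<^sub>R h) ` K)"
        by (intro compact_continuous_image continuous_intros K)
      show "f (x + inverse (real (Suc n)) *\<^sub>R h) = 0" if "x \<notin> (\<lambda>x. x - inverse (real (Suc n)) *\<^sub>R h) ` K" for x
        using that by (intro K(2)) (metis add_diff_cancel_right' imageI)
    qed (intro continuous_intros continuous_on_compose2[OF cont], auto)
    show ?thesis
      unfolding D_def using i j
      by (simp add: integral_lborel_translate borel_measurable_continuous_onI[OF cont])
  qed
  moreover have "(\<lambda>n. LINT x|lborel. D n x) \<longlonglongrightarrow> (LINT x|lborel. gradient f x \<bullet> h)"
  proof (rule integral_dominated_convergence[OF _ _ integrable_indicator_cball])
    show "AE x in lborel. (\<lambda>n. D n x) \<longlonglongrightarrow> gradient f x \<bullet> h"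
      unfolding D_def using directional_difference_tendsto[OF f] by simp
    show "AE x in lborel. norm (D n x) \<le> c * indicator (cball 0 \<rho>) x" for n
      using dom by simp
  qed (use borel_measurable_continuous_onI[OF cont] borel_measurable_continuous_onI[OF continuous_gradient[OF f]]
      in \<open>auto simp: D_def\<close>)
  ultimately show ?thesis
    by (simp add: LIMSEQ_const_iff)
qed

lemma test_functionsD:
  assumes "\<phi> \<in> test_functions \<Omega>"
  shows "Ck_fun k \<phi>"
    and "\<exists>K. compact K \<and> K \<subseteq> \<Omega> \<and> (\<forall>x. x \<notin> K \<longrightarrow> \<phi> x = 0 \<and> gradient \<phi> x = 0)"
proof -
  show "Ck_fun k \<phi>" using assms by (simp add: test_functions_def)
  obtain K where K: "compact K" "K \<subseteq> \<Omega>" "\<And>x. x \<notin> K \<Longrightarrow> \<phi> x = 0"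
    using assms unfolding test_functions_def by blast
  moreover have "gradient \<phi> x = 0" if "x \<notin> K" for x
    by (rule gradient_eq_0_off_support[OF compact_imp_closed[OF K(1)] K(3) that])
  ultimately show "\<exists>K. compact K \<and> K \<subseteq> \<Omega> \<and> (\<forall>x. x \<notin> K \<longrightarrow> \<phi> x = 0 \<and> gradient \<phi> x = 0)"
    by auto
qed

lemma test_functions_continuous:
  assumes "\<phi> \<in> test_functions \<Omega>"
  shows "continuous_on UNIV \<phi>" "continuous_on UNIV (gradient \<phi>)"
  using test_functionsD(1)[OF assms, of 0] test_functionsD(1)[OF assms, of "Suc 0"]
  by (auto intro: continuous_gradient)

lemma test_functions_measurable:
  assumes "\<phi> \<in> test_functions \<Omega>"
  shows "\<phi> \<in> borel_measurable (lebesgue_on S)" "gradient \<phi> \<in> borel_measurable (lebesgue_on S)"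
  using test_functions_continuous[OF assms]
  by (auto intro!: borel_measurable_lebesgue_onI borel_measurable_continuous_onI)

lemma test_functions_bounded:
  assumes "\<phi> \<in> test_functions \<Omega>"
  obtains B where "0 \<le> B" "\<And>x. \<bar>\<phi> x\<bar> \<le> B" "\<And>x. norm (gradient \<phi> x) \<le> B"
proof -
  obtain K where K: "compact K" "\<And>x. x \<notin> K \<Longrightarrow> \<phi> x = 0" "\<And>x. x \<notin> K \<Longrightarrow> gradient \<phi> x = 0"
    using test_functionsD(2)[OF assms] by blast
  obtain A where "0 \<le> A" "\<And>x. norm (\<phi> x) \<le> A"
    using bounded_compact_support[OF test_functions_continuous(1)[OF assms] K(1,2)] by metis
  moreover obtain B where "0 \<le> B" "\<And>x. norm (gradient \<phi> x) \<le> B"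
    using bounded_compact_support[OF test_functions_continuous(2)[OF assms] K(1,3)] by metis
  ultimately show ?thesis
    by (intro that[of "max A B"]) (auto simp: le_max_iff_disj)
qed

text \<open>The gradient of \<open>\<phi> x * \<psi> x\<close> integrates to zero, and the product
  rule splits it into the two terms. Both are supported where \<phi> is, so integrals over \<Omega>
  and over the whole space agree.\<close>

lemma integral_by_parts_test_functions:
  fixes \<Omega> :: "'a::euclidean_space set"
  assumes \<Omega>: "\<Omega> \<in> sets lebesgue"
    and \<phi>: "\<phi> \<in> test_functions \<Omega>" and \<psi>: "\<psi> \<in> test_functions \<Omega>" and i: "i \<in> Basis"
  shows "(LINT x|lebesgue_on \<Omega>. \<phi> x * frechet_derivative \<psi> (at x) i)
    = - (LINT x|lebesgue_on \<Omega>. (gradient \<phi> x \<bullet> i) * \<psi> x)"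
proof -
  obtain K where K: "compact K" "K \<subseteq> \<Omega>" "\<And>x. x \<notin> K \<Longrightarrow> \<phi> x = 0" "\<And>x. x \<notin> K \<Longrightarrow> gradient \<phi> x = 0"
    using test_functionsD(2)[OF \<phi>] by blast
  define f where "f x = \<phi> x * \<psi> x" for x
  have f: "Ck_fun (Suc 0) f"
    unfolding f_def by (intro Ck_fun_mult test_functionsD(1)[OF \<phi>] test_functionsD(1)[OF \<psi>])
  have grad: "gradient f x = \<phi> x *\<^sub>R gradient \<psi> x + \<psi> x *\<^sub>R gradient \<phi> x" for x
  proof (rule gradient_eqI)
    show "(f has_derivative (\<lambda>h. (\<phi> x *\<^sub>R gradient \<psi> x + \<psi> x *\<^sub>R gradient \<phi> x) \<bullet> h)) (at x)"
      unfolding f_def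
      by (rule has_derivative_eq_rhs[OF has_derivative_mult[OF
            gradient_has_derivative[OF test_functionsD(1)[OF \<phi>]]
            gradient_has_derivative[OF test_functionsD(1)[OF \<psi>]]]])
         (auto simp: inner_add_left algebra_simps)
  qed
  have z: "(LINT x|lborel. gradient f x \<bullet> i) = 0"
    by (rule integral_gradient_compact_support[OF f K(1)]) (use K i in \<open>auto simp: f_def\<close>)
  have i1: "integrable lborel (\<lambda>x. \<phi> x * (gradient \<psi> x \<bullet> i))"
    by (rule integrable_compact_support[OF _ K(1)])
       (use K in \<open>auto intro!: continuous_intros test_functions_continuous[OF \<phi>] test_functions_continuous[OF \<psi>]\<close>)
  have i2: "integrable lborel (\<lambda>x. (gradient \<phi> x \<bullet> i) * \<psi> x)"
    by (rule integrable_compact_support[OF _ K(1)])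
       (use K in \<open>auto intro!: continuous_intros test_functions_continuous[OF \<phi>] test_functions_continuous[OF \<psi>]\<close>)
  have "(LINT x|lborel. \<phi> x * (gradient \<psi> x \<bullet> i)) + (LINT x|lborel. (gradient \<phi> x \<bullet> i) * \<psi> x) = 0"
    using z i1 i2 by (simp add: grad inner_add_left mult.commute[of "\<psi> _"] flip: Bochner_Integration.integral_add)
  moreover have "(LINT x|lebesgue_on \<Omega>. \<phi> x * (gradient \<psi> x \<bullet> i)) = (LINT x|lborel. \<phi> x * (gradient \<psi> x \<bullet> i))"
    using K(2,3) borel_measurable_integrable[OF i1] by (intro integral_lebesgue_on_eq_lborel \<Omega>) auto
  moreover have "(LINT x|lebesgue_on \<Omega>. (gradient \<phi> x \<bullet> i) * \<psi> x) = (LINT x|lborel. (gradient \<phi> x \<bullet> i) * \<psi> x)"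
    using K(2,4) borel_measurable_integrable[OF i2] by (intro integral_lebesgue_on_eq_lborel \<Omega>) force+
  ultimately show ?thesis
    using i by (simp add: gradient_inner_Basis)
qed

section \<open>The fundamental lemma of the calculus of variations\<close>

lemma loc_integrable_mult_test:
  fixes v :: "'a::euclidean_space \<Rightarrow> real"
  assumes \<Omega>: "\<Omega> \<in> sets lebesgue" and v: "loc_integrable \<Omega> v"
    and \<psi>: "continuous_on UNIV \<psi>" and K: "compact K" "K \<subseteq> \<Omega>" "\<And>x. x \<notin> K \<Longrightarrow> \<psi> x = 0"
  shows "integrable (lebesgue_on \<Omega>) (\<lambda>x. v x * \<psi> x)"
proof -
  have Kl: "K \<in> sets lebesgue"
    using K(1) by (simp add: borel_compact)
  obtain B where B: "0 \<le> B" "\<And>x. norm (\<psi> x) \<le> B"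
    using bounded_compact_support[OF \<psi> K(1,3)] by metis
  have vK: "integrable (lebesgue_on K) v"
    using v K by (simp add: loc_integrable_def)
  have "integrable (lebesgue_on K) (\<lambda>x. v x * \<psi> x)"
  proof (rule Bochner_Integration.integrable_bound)
    show "integrable (lebesgue_on K) (\<lambda>x. B * v x)" using vK by simp
    show "(\<lambda>x. v x * \<psi> x) \<in> borel_measurable (lebesgue_on K)"
      by (rule borel_measurable_times[OF borel_measurable_integrable[OF vK]
          borel_measurable_lebesgue_onI[OF borel_measurable_continuous_onI[OF \<psi>]]])
    show "AE x in lebesgue_on K. norm (v x * \<psi> x) \<le> norm (B * v x)"
      using B by (intro AE_I2) (auto simp: abs_mult mult.commute[of "\<bar>v _\<bar>"] intro!: mult_right_mono)
  qed
  then have "integrable lebesgue (\<lambda>x. indicator K x *\<^sub>R (v x * \<psi> x))"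
    using Kl by (subst (asm) integrable_restrict_space) auto
  moreover have "(\<lambda>x. indicator K x *\<^sub>R (v x * \<psi> x)) = (\<lambda>x. indicator \<Omega> x *\<^sub>R (v x * \<psi> x))"
    using K(2,3) by (auto simp: indicator_def fun_eq_iff)
  ultimately show ?thesis
    using \<Omega> by (subst integrable_restrict_space) auto
qed

text \<open>Testing with bumps that increase to the indicator of the open box; the faces form a null
  set.\<close>

lemma integral_cbox_eq_0:
  fixes g :: "'a::euclidean_space \<Rightarrow> real"
  assumes \<Omega>: "\<Omega> \<in> sets lebesgue" and g: "loc_integrable \<Omega> g"
    and orth: "\<And>\<phi>. \<phi> \<in> test_functions \<Omega> \<Longrightarrow> (LINT x|lebesgue_on \<Omega>. g x * \<phi> x) = 0"
    and sub: "cbox a b \<subseteq> \<Omega>"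
  shows "integral (cbox a b) g = 0"
proof -
  have gi: "integrable (lebesgue_on (cbox a b)) g"
    using g sub by (simp add: loc_integrable_def)
  have cb: "cbox a b \<in> sets lebesgue" by simp
  have zero: "(LINT x|lebesgue_on (cbox a b). g x * box_bump a b n x) = 0" for n
  proof -
    have "(LINT x|lebesgue_on (cbox a b). g x * box_bump a b n x)
        = (LINT x|lebesgue_on \<Omega>. (if x \<in> cbox a b then g x * box_bump a b n x else 0))"
      by (rule Lebesgue_Measure.integral_restrict[symmetric, OF sub cb \<Omega>])
    also have "\<dots> = (LINT x|lebesgue_on \<Omega>. g x * box_bump a b n x)"
      using box_bump_eq_0[of _ a b n] box_subset_cbox[of a b]
      by (intro Bochner_Integration.integral_cong) auto
    also have "\<dots> = 0"
      by (rule orth[OF test_functions_box_bump[OF sub]])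
    finally show ?thesis .
  qed
  have "(\<lambda>n. LINT x|lebesgue_on (cbox a b). g x * box_bump a b n x)
      \<longlonglongrightarrow> (LINT x|lebesgue_on (cbox a b). g x)"
  proof (rule integral_dominated_convergence)
    show "integrable (lebesgue_on (cbox a b)) (\<lambda>x. \<bar>g x\<bar>)" using gi by simp
    have "negligible (cbox a b - box a b)" by (rule negligible_frontier_interval)
    then have "AE x in lebesgue. x \<notin> cbox a b - box a b"
      by (intro AE_not_in) (simp add: negligible_iff_null_sets)
    then show "AE x in lebesgue_on (cbox a b). (\<lambda>n. g x * box_bump a b n x) \<longlonglongrightarrow> g x"
    proof (subst AE_restrict_space_iff, simp, eventually_elim)
      case (elim x)
      have "(\<lambda>n. g x * box_bump a b n x) \<longlonglongrightarrow> g x * indicator (box a b) x"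
        by (intro tendsto_intros box_bump_tendsto)
      then show ?case using elim by auto
    qed
    show "AE x in lebesgue_on (cbox a b). norm (g x * box_bump a b n x) \<le> \<bar>g x\<bar>" for n
      using box_bump_bounds[of a b n] by (intro AE_I2) (auto simp: abs_mult intro!: mult_left_le)
    show "(\<lambda>x. g x * box_bump a b n x) \<in> borel_measurable (lebesgue_on (cbox a b))" for n
      using Ck_fun_box_bump[of 0 a b n]
      by (intro borel_measurable_times[OF borel_measurable_integrable[OF gi]]
          borel_measurable_lebesgue_onI borel_measurable_continuous_onI) auto
  qed (use gi in auto)
  then have "(LINT x|lebesgue_on (cbox a b). g x) = 0"
    by (simp add: zero LIMSEQ_const_iff)
  then show ?thesis
    using lebesgue_integral_eq_integral[OF gi cb] by simp
qed

text \<open>All integrals over boxes in \<Omega> vanish, so Lebesgue differentiation makes the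
  function zero almost everywhere on each closed box; countably many such boxes exhaust
  \<Omega>.\<close>

lemma AE_0_if_orthogonal_to_test_functions:
  fixes g :: "'a::euclidean_space \<Rightarrow> real"
  assumes \<Omega>: "open \<Omega>" and g: "loc_integrable \<Omega> g"
    and orth: "\<And>\<phi>. \<phi> \<in> test_functions \<Omega> \<Longrightarrow> (LINT x|lebesgue_on \<Omega>. g x * \<phi> x) = 0"
  shows "AE x in lebesgue_on \<Omega>. g x = 0"
proof -
  have \<Omega>': "\<Omega> \<in> sets lebesgue" using \<Omega> by auto
  have box: "AE x in lebesgue. x \<in> cbox c d \<longrightarrow> g x = 0" if sub: "cbox c d \<subseteq> \<Omega>" for c d
  proof -
    \<comment> \<open>The differentiation theorem wants integrability on every box of the space.
      Cutting off outside one box achieves this, because the intersection of two boxes is again a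
      box, possibly empty, inside \<Omega>.\<close>
    let ?f = "\<lambda>x. if x \<in> cbox c d then g x else 0"
    have sub': "\<exists>a' b'. cbox c d \<inter> cbox a b = cbox a' b' \<and> cbox a' b' \<subseteq> \<Omega>" for a b
    proof -
      have "cbox c d \<inter> cbox a b \<subseteq> \<Omega>" using sub by blast
      then show ?thesis using Int_interval[of c d a b] by metis
    qed
    have fi: "?f integrable_on cbox a b" for a b
    proof -
      obtain a' b' where *: "cbox c d \<inter> cbox a b = cbox a' b'" "cbox a' b' \<subseteq> \<Omega>" using sub' by blast
      have "g integrable_on cbox a' b'"
        using g *(2) by (intro integrable_on_lebesgue_on) (auto simp: loc_integrable_def)
      then show ?thesis by (simp add: integrable_restrict_Int *(1))
    qed
    have f0: "integral (cbox a b) ?f = 0" for a b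
    proof -
      obtain a' b' where *: "cbox c d \<inter> cbox a b = cbox a' b'" "cbox a' b' \<subseteq> \<Omega>" using sub' by blast
      show ?thesis
        using integral_cbox_eq_0[OF \<Omega>' g orth *(2)]
        by (simp add: Henstock_Kurzweil_Integration.integral_restrict_Int *(1))
    qed
    \<comment> \<open>Off a null set the averages over shrinking boxes converge to the value of
      \<open>?f\<close>; here all averages are zero.\<close>
    obtain N where N: "negligible N"
      "\<And>x e. \<lbrakk>x \<notin> N; 0 < e\<rbrakk> \<Longrightarrow> \<exists>d>0. \<forall>h. 0 < h \<and> h < d \<longrightarrow>
         norm (integral (cbox x (x + h *\<^sub>R One)) ?f /\<^sub>R h ^ DIM('a) - ?f x) < e"
      using integrable_ccontinuous_explicit[of ?f, OF fi] by blast
    have "?f x = 0" if x: "x \<notin> N" for x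
    proof (rule ccontr)
      assume "?f x \<noteq> 0"
      then obtain d :: real where "d > 0" "\<forall>h>0. \<not> h < d"
        using N(2)[OF x, of "\<bar>?f x\<bar>"] unfolding f0 by auto
      from this(2)[rule_format, of "d/2"] this(1) show False by auto
    qed
    then have "x \<in> N" if "x \<in> cbox c d" "g x \<noteq> 0" for x
      using that by metis
    then have "{x. \<not> (x \<in> cbox c d \<longrightarrow> g x = 0)} \<subseteq> N" by auto
    with N(1) show ?thesis
      unfolding eventually_ae_filter_negligible by blast
  qed
  obtain \<D> where \<D>: "countable \<D>" "\<D> \<subseteq> Pow \<Omega>" "\<And>X. X \<in> \<D> \<Longrightarrow> \<exists>a b. X = cbox a b" "\<Union>\<D> = \<Omega>"
    using open_countable_Union_open_cbox[OF \<Omega>] by blast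
  have "AE x in lebesgue. \<forall>X\<in>\<D>. x \<in> X \<longrightarrow> g x = 0"
  proof (subst AE_ball_countable[OF \<D>(1)], intro ballI)
    fix X assume "X \<in> \<D>"
    with \<D>(2,3) obtain a b where "X = cbox a b" "cbox a b \<subseteq> \<Omega>" by blast
    then show "AE x in lebesgue. x \<in> X \<longrightarrow> g x = 0" using box by simp
  qed
  then have "AE x in lebesgue. x \<in> \<Omega> \<longrightarrow> g x = 0"
    using \<D>(4) by (auto elim!: eventually_mono)
  then show ?thesis
    using \<Omega>' by (subst AE_restrict_space_iff) auto
qed

section \<open>Linearity, uniqueness and closedness of the weak gradient\<close>

lemma has_weak_gradientD:
  assumes "has_weak_gradient \<Omega> u g" "\<phi> \<in> test_functions \<Omega>" "i \<in> Basis"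
  shows "(LINT x|lebesgue_on \<Omega>. u x * (gradient \<phi> x \<bullet> i)) = - (LINT x|lebesgue_on \<Omega>. (g x \<bullet> i) * \<phi> x)"
  using assms by (simp add: has_weak_gradient_def gradient_inner_Basis)

lemma has_weak_gradientI:
  assumes "loc_integrable \<Omega> u" "loc_integrable \<Omega> g"
    and "\<And>\<phi> i. \<phi> \<in> test_functions \<Omega> \<Longrightarrow> i \<in> Basis \<Longrightarrow>
      (LINT x|lebesgue_on \<Omega>. u x * (gradient \<phi> x \<bullet> i)) = - (LINT x|lebesgue_on \<Omega>. (g x \<bullet> i) * \<phi> x)"
  shows "has_weak_gradient \<Omega> u g"
  using assms by (simp add: has_weak_gradient_def gradient_inner_Basis)

lemma loc_integrable_inner: "loc_integrable \<Omega> g \<Longrightarrow> loc_integrable \<Omega> (\<lambda>x. g x \<bullet> i)"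
  by (simp add: loc_integrable_def)

lemma loc_integrable_lincomb:
  "loc_integrable \<Omega> f \<Longrightarrow> loc_integrable \<Omega> g \<Longrightarrow> loc_integrable \<Omega> (\<lambda>x. s *\<^sub>R f x + t *\<^sub>R g x)"
  by (auto simp: loc_integrable_def)

lemma integrable_weak_gradient_test:
  assumes \<Omega>: "\<Omega> \<in> sets lebesgue" and u: "has_weak_gradient \<Omega> u g" and \<phi>: "\<phi> \<in> test_functions \<Omega>"
  shows "integrable (lebesgue_on \<Omega>) (\<lambda>x. u x * (gradient \<phi> x \<bullet> i))"
    and "integrable (lebesgue_on \<Omega>) (\<lambda>x. (g x \<bullet> i) * \<phi> x)"
proof -
  obtain K where K: "compact K" "K \<subseteq> \<Omega>" "\<And>x. x \<notin> K \<Longrightarrow> \<phi> x = 0" "\<And>x. x \<notin> K \<Longrightarrow> gradient \<phi> x = 0"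
    using test_functionsD(2)[OF \<phi>] by blast
  show "integrable (lebesgue_on \<Omega>) (\<lambda>x. u x * (gradient \<phi> x \<bullet> i))"
    using u K by (intro loc_integrable_mult_test[OF \<Omega> _ _ K(1,2)] continuous_intros
        test_functions_continuous[OF \<phi>]) (auto simp: has_weak_gradient_def)
  show "integrable (lebesgue_on \<Omega>) (\<lambda>x. (g x \<bullet> i) * \<phi> x)"
    using u K by (intro loc_integrable_mult_test[OF \<Omega> _ _ K(1,2)] loc_integrable_inner
        test_functions_continuous[OF \<phi>]) (auto simp: has_weak_gradient_def)
qed

lemma has_weak_gradient_lincomb:
  assumes \<Omega>: "\<Omega> \<in> sets lebesgue" and u: "has_weak_gradient \<Omega> u g" and v: "has_weak_gradient \<Omega> v h"
  shows "has_weak_gradient \<Omega> (\<lambda>x. s * u x + t * v x) (\<lambda>x. s *\<^sub>R g x + t *\<^sub>R h x)"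
proof (rule has_weak_gradientI)
  show "loc_integrable \<Omega> (\<lambda>x. s * u x + t * v x)" "loc_integrable \<Omega> (\<lambda>x. s *\<^sub>R g x + t *\<^sub>R h x)"
    using u v loc_integrable_lincomb[of \<Omega> u v s t] loc_integrable_lincomb[of \<Omega> g h s t]
    by (auto simp: has_weak_gradient_def)
  fix \<phi> and i :: 'a assume \<phi>: "\<phi> \<in> test_functions \<Omega>" and i: "i \<in> Basis"
  note int = integrable_weak_gradient_test[OF \<Omega> u \<phi>, of i] integrable_weak_gradient_test[OF \<Omega> v \<phi>, of i]
  have "(LINT x|lebesgue_on \<Omega>. (s * u x + t * v x) * (gradient \<phi> x \<bullet> i))
      = (LINT x|lebesgue_on \<Omega>. s * (u x * (gradient \<phi> x \<bullet> i)) + t * (v x * (gradient \<phi> x \<bullet> i)))"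
    by (simp add: algebra_simps)
  also have "\<dots> = - (s * (LINT x|lebesgue_on \<Omega>. (g x \<bullet> i) * \<phi> x) + t * (LINT x|lebesgue_on \<Omega>. (h x \<bullet> i) * \<phi> x))"
    using int by (simp add: has_weak_gradientD[OF u \<phi> i] has_weak_gradientD[OF v \<phi> i])
  also have "\<dots> = - (LINT x|lebesgue_on \<Omega>. s * ((g x \<bullet> i) * \<phi> x) + t * ((h x \<bullet> i) * \<phi> x))"
    using int by simp
  also have "\<dots> = - (LINT x|lebesgue_on \<Omega>. ((s *\<^sub>R g x + t *\<^sub>R h x) \<bullet> i) * \<phi> x)"
    by (simp add: algebra_simps)
  finally show "(LINT x|lebesgue_on \<Omega>. (s * u x + t * v x) * (gradient \<phi> x \<bullet> i))
      = - (LINT x|lebesgue_on \<Omega>. ((s *\<^sub>R g x + t *\<^sub>R h x) \<bullet> i) * \<phi> x)" .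
qed

lemma has_weak_gradient_unique:
  fixes u :: "'a::euclidean_space \<Rightarrow> real"
  assumes \<Omega>: "open \<Omega>" and g: "has_weak_gradient \<Omega> u g" and h: "has_weak_gradient \<Omega> u h"
  shows "AE x in lebesgue_on \<Omega>. g x = h x"
proof -
  have \<Omega>': "\<Omega> \<in> sets lebesgue" using \<Omega> by auto
  have d: "has_weak_gradient \<Omega> (\<lambda>x. 0) (\<lambda>x. g x - h x)"
    using has_weak_gradient_lincomb[OF \<Omega>' g h, of 1 "-1"] by simp
  have "AE x in lebesgue_on \<Omega>. (g x - h x) \<bullet> i = 0" if i: "i \<in> Basis" for i
  proof (rule AE_0_if_orthogonal_to_test_functions[OF \<Omega>])
    show "loc_integrable \<Omega> (\<lambda>x. (g x - h x) \<bullet> i)"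
      using d by (intro loc_integrable_inner) (simp add: has_weak_gradient_def)
    show "(LINT x|lebesgue_on \<Omega>. ((g x - h x) \<bullet> i) * \<phi> x) = 0" if "\<phi> \<in> test_functions \<Omega>" for \<phi>
      using has_weak_gradientD[OF d that i] by simp
  qed
  then have "AE x in lebesgue_on \<Omega>. \<forall>i\<in>Basis. (g x - h x) \<bullet> i = 0"
    by (subst AE_ball_countable) (auto intro: countable_finite)
  then show ?thesis
    by eventually_elim (metis (no_types) euclidean_all_zero_iff right_minus_eq)
qed

lemma finite_measure_lebesgue_on_bounded_open:
  fixes \<Omega> :: "'a::euclidean_space set"
  assumes "bounded \<Omega>" "open \<Omega>"
  shows "finite_measure (lebesgue_on \<Omega>)"
  by (intro finite_measure_lebesgue_on lmeasurable_open assms)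

lemma L2_imp_loc_integrable:
  fixes f :: "'a::euclidean_space \<Rightarrow> 'b::euclidean_space"
  assumes \<Omega>: "bounded \<Omega>" "open \<Omega>" and f: "f \<in> L2 (lebesgue_on \<Omega>)"
  shows "loc_integrable \<Omega> f"
  unfolding loc_integrable_def
proof (intro allI impI, elim conjE)
  fix K assume K: "compact K" "K \<subseteq> \<Omega>"
  interpret finite_measure "lebesgue_on \<Omega>"
    by (rule finite_measure_lebesgue_on_bounded_open[OF \<Omega>])
  have "integrable lebesgue (\<lambda>x. indicator \<Omega> x *\<^sub>R f x)"
    using L2_imp_integrable[OF f] \<Omega>(2) by (subst (asm) integrable_restrict_space) auto
  then have "integrable lebesgue (\<lambda>x. indicator K x *\<^sub>R (indicator \<Omega> x *\<^sub>R f x))"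
    using K(1) by (intro integrable_mult_indicator[OF _ \<open>integrable lebesgue (\<lambda>x. indicator \<Omega> x *\<^sub>R f x)\<close>])
      (auto simp: borel_compact)
  moreover have "(\<lambda>x. indicator K x *\<^sub>R (indicator \<Omega> x *\<^sub>R f x)) = (\<lambda>x. indicator K x *\<^sub>R f x)"
    using K(2) by (auto simp: indicator_def fun_eq_iff)
  ultimately show "integrable (lebesgue_on K) f"
    using K(1) by (subst integrable_restrict_space) (auto simp: borel_compact)
qed

lemma test_functions_L2:
  assumes \<Omega>: "bounded \<Omega>" "open \<Omega>" and \<phi>: "\<phi> \<in> test_functions \<Omega>"
  shows "\<phi> \<in> L2 (lebesgue_on \<Omega>)" "gradient \<phi> \<in> L2 (lebesgue_on \<Omega>)"
proof -
  interpret finite_measure "lebesgue_on \<Omega>"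
    by (rule finite_measure_lebesgue_on_bounded_open[OF \<Omega>])
  obtain B where B: "0 \<le> B" "\<And>x. \<bar>\<phi> x\<bar> \<le> B" "\<And>x. norm (gradient \<phi> x) \<le> B"
    using test_functions_bounded[OF \<phi>] by metis
  show "\<phi> \<in> L2 (lebesgue_on \<Omega>)" "gradient \<phi> \<in> L2 (lebesgue_on \<Omega>)"
    using B by (auto intro!: L2_dominated[OF L2_const[of B]] test_functions_measurable[OF \<phi>])
qed

lemma has_weak_gradient_test_function:
  assumes \<Omega>: "bounded \<Omega>" "open \<Omega>" and \<phi>: "\<phi> \<in> test_functions \<Omega>"
  shows "has_weak_gradient \<Omega> \<phi> (gradient \<phi>)"
  using test_functions_L2[OF \<Omega> \<phi>] integral_by_parts_test_functions[OF _ \<phi>] \<Omega>(2)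
  by (auto simp: has_weak_gradient_def intro!: L2_imp_loc_integrable[OF \<Omega>])

text \<open>For a fixed test function both sides of the defining identity are continuous in
  L2.\<close>

lemma has_weak_gradient_limit:
  assumes \<Omega>: "bounded \<Omega>" "open \<Omega>"
    and u: "\<And>n. has_weak_gradient \<Omega> (u n) (g n)" "\<And>n. u n \<in> L2 (lebesgue_on \<Omega>)" "\<And>n. g n \<in> L2 (lebesgue_on \<Omega>)"
    and v: "v \<in> L2 (lebesgue_on \<Omega>)" "h \<in> L2 (lebesgue_on \<Omega>)"
    and lim: "(\<lambda>n. norm2 (lebesgue_on \<Omega>) (\<lambda>x. u n x - v x)) \<longlonglongrightarrow> 0"
      "(\<lambda>n. norm2 (lebesgue_on \<Omega>) (\<lambda>x. g n x - h x)) \<longlonglongrightarrow> 0"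
  shows "has_weak_gradient \<Omega> v h"
proof (rule has_weak_gradientI)
  fix \<phi> and i :: 'a assume \<phi>: "\<phi> \<in> test_functions \<Omega>" and i: "i \<in> Basis"
  let ?M = "lebesgue_on \<Omega>"
  have gi: "(\<lambda>x. gradient \<phi> x \<bullet> i) \<in> L2 ?M"
    using i by (intro L2_dominated[OF test_functions_L2(2)[OF \<Omega> \<phi>]])
      (auto intro!: borel_measurable_inner test_functions_measurable[OF \<phi>] Basis_le_norm)
  have \<phi>i: "(\<lambda>x. \<phi> x *\<^sub>R i) \<in> L2 ?M"
    using i by (intro L2_dominated[OF test_functions_L2(1)[OF \<Omega> \<phi>]])
      (auto intro!: borel_measurable_scaleR test_functions_measurable[OF \<phi>])
  have "(\<lambda>n. LINT x|?M. u n x \<bullet> (gradient \<phi> x \<bullet> i)) \<longlonglongrightarrow> (LINT x|?M. v x \<bullet> (gradient \<phi> x \<bullet> i))"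
    by (rule integral_inner_tendsto[OF u(2) v(1) gi lim(1)])
  moreover have "(\<lambda>n. - (LINT x|?M. g n x \<bullet> (\<phi> x *\<^sub>R i))) \<longlonglongrightarrow> - (LINT x|?M. h x \<bullet> (\<phi> x *\<^sub>R i))"
    by (intro tendsto_minus integral_inner_tendsto[OF u(3) v(2) \<phi>i lim(2)])
  moreover have "(LINT x|?M. u n x \<bullet> (gradient \<phi> x \<bullet> i)) = - (LINT x|?M. g n x \<bullet> (\<phi> x *\<^sub>R i))" for n
    using has_weak_gradientD[OF u(1)[of n] \<phi> i] by (simp add: mult.commute[of "\<phi> _"])
  ultimately have "(LINT x|?M. v x \<bullet> (gradient \<phi> x \<bullet> i)) = - (LINT x|?M. h x \<bullet> (\<phi> x *\<^sub>R i))"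
    by (simp add: LIMSEQ_unique)
  then show "(LINT x|?M. v x * (gradient \<phi> x \<bullet> i)) = - (LINT x|?M. (h x \<bullet> i) * \<phi> x)"
    by (simp add: mult.commute[of "\<phi> _"])
qed (intro L2_imp_loc_integrable[OF \<Omega>] v)+

section \<open>The space of functions vanishing on the boundary\<close>

text \<open>Completeness of Lebesgue measure. It is what makes the representative chosen by
  \<open>wgrad\<close> measurable, as that is known only up to a null set.\<close>

lemma borel_measurable_lebesgue_on_AE:
  fixes g h :: "'a::euclidean_space \<Rightarrow> 'b::euclidean_space"
  assumes \<Omega>: "\<Omega> \<in> sets lebesgue" and g: "g \<in> borel_measurable (lebesgue_on \<Omega>)"
    and ae: "AE x in lebesgue_on \<Omega>. g x = h x"
  shows "h \<in> borel_measurable (lebesgue_on \<Omega>)"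
proof -
  have "(\<lambda>x. if x \<in> \<Omega> then g x else 0) \<in> borel_measurable lebesgue"
    by (rule borel_measurable_if_I[OF g \<Omega>])
  moreover have "AE x in lebesgue. (if x \<in> \<Omega> then g x else 0) = (if x \<in> \<Omega> then h x else 0)"
    using ae \<Omega> by (subst (asm) AE_restrict_space_iff) (auto elim!: eventually_mono)
  ultimately have "(\<lambda>x. if x \<in> \<Omega> then h x else 0) \<in> borel_measurable lebesgue"
    by (rule borel_measurable_AE)
  then show ?thesis by (rule borel_measurable_if_D)
qed

text \<open>\<open>H0grad \<Omega> v g\<close> is the graph of the gradient on \<open>H10 \<Omega>\<close>; it avoids the arbitrary representative
  chosen by \<open>wgrad\<close>.\<close>

definition H0grad :: "'a::euclidean_space set \<Rightarrow> ('a \<Rightarrow> real) \<Rightarrow> ('a \<Rightarrow> 'a) \<Rightarrow> bool" where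
  "H0grad \<Omega> v g \<longleftrightarrow> v \<in> L2 (lebesgue_on \<Omega>) \<and> g \<in> L2 (lebesgue_on \<Omega>) \<and>
     (\<forall>\<epsilon>>0. \<exists>\<phi>\<in>test_functions \<Omega>. norm2 (lebesgue_on \<Omega>) (\<lambda>x. v x - \<phi> x) < \<epsilon> \<and>
        norm2 (lebesgue_on \<Omega>) (\<lambda>x. g x - gradient \<phi> x) < \<epsilon>)"

lemma H0grad_L2:
  assumes "H0grad \<Omega> v g"
  shows "v \<in> L2 (lebesgue_on \<Omega>)" "g \<in> L2 (lebesgue_on \<Omega>)"
  using assms by (auto simp: H0grad_def)

lemma tendsto_0_if_less_inverse:
  fixes f :: "nat \<Rightarrow> real"
  assumes "\<And>n. 0 \<le> f n" "\<And>n. f n < inverse (real (Suc n))"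
  shows "f \<longlonglongrightarrow> 0"
  by (rule tendsto_sandwich[OF _ _ tendsto_const LIMSEQ_inverse_real_of_nat])
     (use assms in \<open>auto intro!: always_eventually less_imp_le\<close>)

lemma H0grad_sequence:
  assumes "H0grad \<Omega> v g"
  obtains \<phi> where "\<And>n. \<phi> n \<in> test_functions \<Omega>"
    "(\<lambda>n. norm2 (lebesgue_on \<Omega>) (\<lambda>x. \<phi> n x - v x)) \<longlonglongrightarrow> 0"
    "(\<lambda>n. norm2 (lebesgue_on \<Omega>) (\<lambda>x. gradient (\<phi> n) x - g x)) \<longlonglongrightarrow> 0"
proof -
  have "\<exists>\<phi>\<in>test_functions \<Omega>. norm2 (lebesgue_on \<Omega>) (\<lambda>x. v x - \<phi> x) < inverse (real (Suc n)) \<and>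
      norm2 (lebesgue_on \<Omega>) (\<lambda>x. g x - gradient \<phi> x) < inverse (real (Suc n))" for n
    using assms unfolding H0grad_def by simp
  then obtain \<phi> where \<phi>: "\<And>n. \<phi> n \<in> test_functions \<Omega>"
      "\<And>n. norm2 (lebesgue_on \<Omega>) (\<lambda>x. v x - \<phi> n x) < inverse (real (Suc n))"
      "\<And>n. norm2 (lebesgue_on \<Omega>) (\<lambda>x. g x - gradient (\<phi> n) x) < inverse (real (Suc n))"
    by metis
  show ?thesis
  proof (rule that[OF \<phi>(1)])
    show "(\<lambda>n. norm2 (lebesgue_on \<Omega>) (\<lambda>x. \<phi> n x - v x)) \<longlonglongrightarrow> 0"
      using \<phi>(2) by (intro tendsto_0_if_less_inverse) (auto simp: norm2_minus_commute[of _ "\<phi> _"])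
    show "(\<lambda>n. norm2 (lebesgue_on \<Omega>) (\<lambda>x. gradient (\<phi> n) x - g x)) \<longlonglongrightarrow> 0"
      using \<phi>(3) by (intro tendsto_0_if_less_inverse) (auto simp: norm2_minus_commute[of _ "gradient (\<phi> _)"])
  qed
qed

text \<open>The graph is closed: the approximants may themselves be limits of test functions, by a
  diagonal choice with error halves.\<close>

lemma H0grad_sequenceI:
  assumes v: "v \<in> L2 (lebesgue_on \<Omega>)" "g \<in> L2 (lebesgue_on \<Omega>)"
    and w: "\<And>n. H0grad \<Omega> (w n) (h n)"
    and lim: "(\<lambda>n. norm2 (lebesgue_on \<Omega>) (\<lambda>x. w n x - v x)) \<longlonglongrightarrow> 0"
      "(\<lambda>n. norm2 (lebesgue_on \<Omega>) (\<lambda>x. h n x - g x)) \<longlonglongrightarrow> 0"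
    and \<Omega>: "bounded \<Omega>" "open \<Omega>"
  shows "H0grad \<Omega> v g"
  unfolding H0grad_def
proof (intro conjI v allI impI)
  fix \<epsilon> :: real assume "0 < \<epsilon>"
  then have "\<forall>\<^sub>F n in sequentially. norm2 (lebesgue_on \<Omega>) (\<lambda>x. w n x - v x) < \<epsilon> / 2
      \<and> norm2 (lebesgue_on \<Omega>) (\<lambda>x. h n x - g x) < \<epsilon> / 2"
    by (intro eventually_conj order_tendstoD(2)[OF lim(1)] order_tendstoD(2)[OF lim(2)]) auto
  then obtain n where n: "norm2 (lebesgue_on \<Omega>) (\<lambda>x. w n x - v x) < \<epsilon> / 2"
      "norm2 (lebesgue_on \<Omega>) (\<lambda>x. h n x - g x) < \<epsilon> / 2"
    using eventually_happens'[OF sequentially_bot] by blast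
  obtain \<phi> where \<phi>: "\<phi> \<in> test_functions \<Omega>" "norm2 (lebesgue_on \<Omega>) (\<lambda>x. w n x - \<phi> x) < \<epsilon> / 2"
      "norm2 (lebesgue_on \<Omega>) (\<lambda>x. h n x - gradient \<phi> x) < \<epsilon> / 2"
    using w[of n] \<open>0 < \<epsilon>\<close> unfolding H0grad_def by (meson half_gt_zero)
  note L = test_functions_L2[OF \<Omega> \<phi>(1)] H0grad_L2[OF w[of n]]
  show "\<exists>\<phi>\<in>test_functions \<Omega>. norm2 (lebesgue_on \<Omega>) (\<lambda>x. v x - \<phi> x) < \<epsilon> \<and>
      norm2 (lebesgue_on \<Omega>) (\<lambda>x. g x - gradient \<phi> x) < \<epsilon>"
    using norm2_triangle3[OF v(1) L(3,1)] norm2_triangle3[OF v(2) L(4,2)] n \<phi>(2,3)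
    by (intro bexI[OF _ \<phi>(1)]) (auto simp: norm2_minus_commute[of _ v] norm2_minus_commute[of _ g])
qed

lemma H0grad_test_function:
  assumes "bounded \<Omega>" "open \<Omega>" "\<phi> \<in> test_functions \<Omega>"
  shows "H0grad \<Omega> \<phi> (gradient \<phi>)"
  using test_functions_L2[OF assms] assms(3) unfolding H0grad_def
  by (intro conjI allI impI bexI[of _ \<phi>]) (auto simp: norm2_def)

lemma H0grad_has_weak_gradient:
  assumes \<Omega>: "bounded \<Omega>" "open \<Omega>" and v: "H0grad \<Omega> v g"
  shows "has_weak_gradient \<Omega> v g"
proof -
  obtain \<phi> where \<phi>: "\<And>n. \<phi> n \<in> test_functions \<Omega>"
    "(\<lambda>n. norm2 (lebesgue_on \<Omega>) (\<lambda>x. \<phi> n x - v x)) \<longlonglongrightarrow> 0"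
    "(\<lambda>n. norm2 (lebesgue_on \<Omega>) (\<lambda>x. gradient (\<phi> n) x - g x)) \<longlonglongrightarrow> 0"
    using H0grad_sequence[OF v] by blast
  show ?thesis
    by (rule has_weak_gradient_limit[OF \<Omega> has_weak_gradient_test_function[OF \<Omega> \<phi>(1)]
        test_functions_L2[OF \<Omega> \<phi>(1)] H0grad_L2[OF v] \<phi>(2,3)])
qed

lemma H0grad_cong_AE:
  assumes \<Omega>: "\<Omega> \<in> sets lebesgue" and v: "H0grad \<Omega> v g"
    and ae: "AE x in lebesgue_on \<Omega>. v x = w x" "AE x in lebesgue_on \<Omega>. g x = h x"
  shows "H0grad \<Omega> w h"
proof -
  have meas: "w \<in> borel_measurable (lebesgue_on \<Omega>)" "h \<in> borel_measurable (lebesgue_on \<Omega>)"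
    using borel_measurable_lebesgue_on_AE[OF \<Omega> _ ae(1)] borel_measurable_lebesgue_on_AE[OF \<Omega> _ ae(2)]
      H0grad_L2[OF v] by auto
  have "norm2 (lebesgue_on \<Omega>) (\<lambda>x. w x - \<phi> x) = norm2 (lebesgue_on \<Omega>) (\<lambda>x. v x - \<phi> x)"
    "norm2 (lebesgue_on \<Omega>) (\<lambda>x. h x - gradient \<phi> x) = norm2 (lebesgue_on \<Omega>) (\<lambda>x. g x - gradient \<phi> x)"
    if "\<phi> \<in> test_functions \<Omega>" for \<phi>
    using ae meas H0grad_L2[OF v] test_functions_measurable[OF that]
    by (auto intro!: norm2_cong_AE intro: eventually_mono[OF ae(1)] eventually_mono[OF ae(2)])
  then show ?thesis
    using v L2_cong_AE[OF _ meas(1) ae(1)] L2_cong_AE[OF _ meas(2) ae(2)] unfolding H0grad_def by auto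
qed

lemma H0grad_lincomb:
  assumes \<Omega>: "bounded \<Omega>" "open \<Omega>" and v: "H0grad \<Omega> v g" and w: "H0grad \<Omega> w h"
  shows "H0grad \<Omega> (\<lambda>x. s * v x + t * w x) (\<lambda>x. s *\<^sub>R g x + t *\<^sub>R h x)"
proof -
  let ?M = "lebesgue_on \<Omega>"
  obtain \<phi> where \<phi>: "\<And>n. \<phi> n \<in> test_functions \<Omega>"
    "(\<lambda>n. norm2 ?M (\<lambda>x. \<phi> n x - v x)) \<longlonglongrightarrow> 0" "(\<lambda>n. norm2 ?M (\<lambda>x. gradient (\<phi> n) x - g x)) \<longlonglongrightarrow> 0"
    using H0grad_sequence[OF v] by blast
  obtain \<psi> where \<psi>: "\<And>n. \<psi> n \<in> test_functions \<Omega>"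
    "(\<lambda>n. norm2 ?M (\<lambda>x. \<psi> n x - w x)) \<longlonglongrightarrow> 0" "(\<lambda>n. norm2 ?M (\<lambda>x. gradient (\<psi> n) x - h x)) \<longlonglongrightarrow> 0"
    using H0grad_sequence[OF w] by blast
  define \<theta> where "\<theta> n x = s * \<phi> n x + t * \<psi> n x" for n x
  have grad: "gradient (\<theta> n) x = s *\<^sub>R gradient (\<phi> n) x + t *\<^sub>R gradient (\<psi> n) x" for n x
  proof (rule gradient_eqI)
    show "(\<theta> n has_derivative (\<lambda>h. (s *\<^sub>R gradient (\<phi> n) x + t *\<^sub>R gradient (\<psi> n) x) \<bullet> h)) (at x)"
      unfolding \<theta>_def
      by (rule has_derivative_eq_rhs[OF has_derivative_add[OF
            has_derivative_mult_right[OF gradient_has_derivative[OF test_functionsD(1)[OF \<phi>(1)]]]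
            has_derivative_mult_right[OF gradient_has_derivative[OF test_functionsD(1)[OF \<psi>(1)]]]]])
         (simp add: inner_add_left)
  qed
  have \<theta>: "\<theta> n \<in> test_functions \<Omega>" for n
  proof -
    obtain K where K: "compact K" "K \<subseteq> \<Omega>" "\<And>x. x \<notin> K \<Longrightarrow> \<phi> n x = 0"
      using test_functionsD(2)[OF \<phi>(1)[of n]] by blast
    obtain J where J: "compact J" "J \<subseteq> \<Omega>" "\<And>x. x \<notin> J \<Longrightarrow> \<psi> n x = 0"
      using test_functionsD(2)[OF \<psi>(1)[of n]] by blast
    have "Ck_fun k (\<theta> n)" for k
      unfolding \<theta>_def by (intro Ck_fun_add Ck_fun_cmult test_functionsD(1)[OF \<phi>(1)] test_functionsD(1)[OF \<psi>(1)])
    moreover have "compact (K \<union> J)" "K \<union> J \<subseteq> \<Omega>"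
      using K(1,2) J(1,2) by (auto intro: compact_Un)
    moreover have "\<theta> n x = 0" if "x \<notin> K \<union> J" for x
      using K(3)[of x] J(3)[of x] that by (simp add: \<theta>_def)
    ultimately show ?thesis
      unfolding test_functions_def by blast
  qed
  \<comment> \<open>Stated for a general codomain because it is applied both to the real-valued
    functions and to their gradients.\<close>
  have comb: "(\<lambda>n. norm2 ?M (\<lambda>x. (s *\<^sub>R a n x + t *\<^sub>R b n x) - (s *\<^sub>R c x + t *\<^sub>R d x))) \<longlonglongrightarrow> 0"
    if "\<And>n. a n \<in> L2 ?M" "\<And>n. b n \<in> L2 ?M" "c \<in> L2 ?M" "d \<in> L2 ?M"
      and lim: "(\<lambda>n. norm2 ?M (\<lambda>x. a n x - c x)) \<longlonglongrightarrow> 0" "(\<lambda>n. norm2 ?M (\<lambda>x. b n x - d x)) \<longlonglongrightarrow> 0"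
    for a b :: "nat \<Rightarrow> 'a \<Rightarrow> 'b::euclidean_space" and c d
  proof (rule Lim_null_comparison)
    have "norm2 ?M (\<lambda>x. (s *\<^sub>R a n x + t *\<^sub>R b n x) - (s *\<^sub>R c x + t *\<^sub>R d x))
        \<le> \<bar>s\<bar> * norm2 ?M (\<lambda>x. a n x - c x) + \<bar>t\<bar> * norm2 ?M (\<lambda>x. b n x - d x)" for n
    proof -
      have eq: "(\<lambda>x. (s *\<^sub>R a n x + t *\<^sub>R b n x) - (s *\<^sub>R c x + t *\<^sub>R d x))
          = (\<lambda>x. s *\<^sub>R (a n x - c x) + t *\<^sub>R (b n x - d x))"
        by (simp add: algebra_simps fun_eq_iff)
      show ?thesis
        using norm2_triangle[OF L2_scaleR[OF L2_diff[OF that(1,3)], of s] L2_scaleR[OF L2_diff[OF that(2,4)], of t], of n n]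
        unfolding eq norm2_scaleR .
    qed
    then show "\<forall>\<^sub>F n in sequentially. norm (norm2 ?M (\<lambda>x. (s *\<^sub>R a n x + t *\<^sub>R b n x) - (s *\<^sub>R c x + t *\<^sub>R d x)))
        \<le> \<bar>s\<bar> * norm2 ?M (\<lambda>x. a n x - c x) + \<bar>t\<bar> * norm2 ?M (\<lambda>x. b n x - d x)"
      by simp
    show "(\<lambda>n. \<bar>s\<bar> * norm2 ?M (\<lambda>x. a n x - c x) + \<bar>t\<bar> * norm2 ?M (\<lambda>x. b n x - d x)) \<longlonglongrightarrow> 0"
      using tendsto_add[OF tendsto_mult_left[OF lim(1), of "\<bar>s\<bar>"] tendsto_mult_left[OF lim(2), of "\<bar>t\<bar>"]] by simp
  qed
  show ?thesis
  proof (rule H0grad_sequenceI[OF _ _ H0grad_test_function[OF \<Omega> \<theta>] _ _ \<Omega>])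
    show "(\<lambda>x. s * v x + t * w x) \<in> L2 ?M" "(\<lambda>x. s *\<^sub>R g x + t *\<^sub>R h x) \<in> L2 ?M"
      using L2_add[OF L2_scaleR[OF H0grad_L2(1)[OF v], of s] L2_scaleR[OF H0grad_L2(1)[OF w], of t]]
        L2_add[OF L2_scaleR[OF H0grad_L2(2)[OF v], of s] L2_scaleR[OF H0grad_L2(2)[OF w], of t]]
      by simp_all
    show "(\<lambda>n. norm2 ?M (\<lambda>x. \<theta> n x - (s * v x + t * w x))) \<longlonglongrightarrow> 0"
      using comb[OF test_functions_L2(1)[OF \<Omega> \<phi>(1)] test_functions_L2(1)[OF \<Omega> \<psi>(1)]
          H0grad_L2(1)[OF v] H0grad_L2(1)[OF w] \<phi>(2) \<psi>(2)] by (simp add: \<theta>_def)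
    show "(\<lambda>n. norm2 ?M (\<lambda>x. gradient (\<theta> n) x - (s *\<^sub>R g x + t *\<^sub>R h x))) \<longlonglongrightarrow> 0"
      using comb[OF test_functions_L2(2)[OF \<Omega> \<phi>(1)] test_functions_L2(2)[OF \<Omega> \<psi>(1)]
          H0grad_L2(2)[OF v] H0grad_L2(2)[OF w] \<phi>(3) \<psi>(3)] by (simp add: grad)
  qed
qed

section \<open>Agreement of \<open>H0grad\<close> with \<open>H10\<close>, \<open>H1_norm\<close>
  and \<open>wgrad\<close>\<close>

lemma wgrad_AE_eq:
  assumes "open \<Omega>" "has_weak_gradient \<Omega> u g"
  shows "AE x in lebesgue_on \<Omega>. wgrad \<Omega> u x = g x"
proof -
  have "has_weak_gradient \<Omega> u (wgrad \<Omega> u)"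
    unfolding wgrad_def by (rule someI[of "has_weak_gradient \<Omega> u"]) (fact assms(2))
  from has_weak_gradient_unique[OF assms(1) this assms(2)] show ?thesis .
qed

lemma H1_norm_eq:
  assumes \<Omega>: "open \<Omega>" and u: "has_weak_gradient \<Omega> u g" "g \<in> L2 (lebesgue_on \<Omega>)"
  shows "H1_norm \<Omega> u = sqrt ((norm2 (lebesgue_on \<Omega>) u)\<^sup>2 + (norm2 (lebesgue_on \<Omega>) g)\<^sup>2)"
proof -
  have \<Omega>': "\<Omega> \<in> sets lebesgue" using \<Omega> by auto
  have ae: "AE x in lebesgue_on \<Omega>. g x = wgrad \<Omega> u x"
    using wgrad_AE_eq[OF \<Omega> u(1)] by (auto elim!: eventually_mono)
  have "norm2 (lebesgue_on \<Omega>) (wgrad \<Omega> u) = norm2 (lebesgue_on \<Omega>) g"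
    using borel_measurable_lebesgue_on_AE[OF \<Omega>' _ ae] u(2) ae
    by (intro norm2_cong_AE) (auto elim!: eventually_mono)
  then show ?thesis
    unfolding H1_norm_def by (simp add: norm2_power2[symmetric]) (simp add: norm2_power2)
qed

lemma norm2_le_H1_norm:
  assumes \<Omega>: "open \<Omega>" and u: "has_weak_gradient \<Omega> u g" "g \<in> L2 (lebesgue_on \<Omega>)"
  shows "norm2 (lebesgue_on \<Omega>) u \<le> H1_norm \<Omega> u" "norm2 (lebesgue_on \<Omega>) g \<le> H1_norm \<Omega> u"
  unfolding H1_norm_eq[OF assms] by (auto intro: real_le_rsqrt)

lemma H10_imp_H0grad:
  fixes \<Omega> :: "'a::euclidean_space set"
  assumes \<Omega>: "bounded \<Omega>" "open \<Omega>" and u: "u \<in> H10 \<Omega>"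
  shows "H0grad \<Omega> u (wgrad \<Omega> u)"
proof -
  have \<Omega>': "\<Omega> \<in> sets lebesgue" using \<Omega> by auto
  obtain g where g: "u \<in> L2 (lebesgue_on \<Omega>)" "g \<in> L2 (lebesgue_on \<Omega>)" "has_weak_gradient \<Omega> u g"
    using u by (auto simp: H10_def H1_def L2_set_on_eq)
  obtain \<phi> :: "nat \<Rightarrow> 'a \<Rightarrow> real" where \<phi>: "\<And>n. \<phi> n \<in> test_functions \<Omega>" "(\<lambda>n. H1_norm \<Omega> (\<lambda>x. u x - \<phi> n x)) \<longlonglongrightarrow> 0"
    using u by (auto simp: H10_def)
  have d: "has_weak_gradient \<Omega> (\<lambda>x. u x - \<phi> n x) (\<lambda>x. g x - gradient (\<phi> n) x)" for n
    using has_weak_gradient_lincomb[OF \<Omega>' g(3) has_weak_gradient_test_function[OF \<Omega> \<phi>(1)[of n]], of 1 "-1"]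
    by simp
  note le = norm2_le_H1_norm[OF \<Omega>(2) d L2_diff[OF g(2) test_functions_L2(2)[OF \<Omega> \<phi>(1)]]]
  have "H0grad \<Omega> u g"
  proof (rule H0grad_sequenceI[OF g(1,2) H0grad_test_function[OF \<Omega> \<phi>(1)] _ _ \<Omega>])
    show "(\<lambda>n. norm2 (lebesgue_on \<Omega>) (\<lambda>x. \<phi> n x - u x)) \<longlonglongrightarrow> 0"
      using le(1) by (intro Lim_null_comparison[OF _ \<phi>(2)]) (simp add: norm2_minus_commute[of _ "\<phi> _"])
    show "(\<lambda>n. norm2 (lebesgue_on \<Omega>) (\<lambda>x. gradient (\<phi> n) x - g x)) \<longlonglongrightarrow> 0"
      using le(2) by (intro Lim_null_comparison[OF _ \<phi>(2)]) (simp add: norm2_minus_commute[of _ "gradient (\<phi> _)"])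
  qed
  then show ?thesis
    by (rule H0grad_cong_AE[OF \<Omega>'])
       (use wgrad_AE_eq[OF \<Omega>(2) g(3)] in \<open>auto elim!: eventually_mono\<close>)
qed

lemma H0grad_imp_H10:
  assumes \<Omega>: "bounded \<Omega>" "open \<Omega>" and v: "H0grad \<Omega> v g"
  shows "v \<in> H10 \<Omega>" "AE x in lebesgue_on \<Omega>. wgrad \<Omega> v x = g x"
proof -
  have \<Omega>': "\<Omega> \<in> sets lebesgue" using \<Omega> by auto
  note wg = H0grad_has_weak_gradient[OF \<Omega> v]
  show "AE x in lebesgue_on \<Omega>. wgrad \<Omega> v x = g x"
    by (rule wgrad_AE_eq[OF \<Omega>(2) wg])
  obtain \<phi> where \<phi>: "\<And>n. \<phi> n \<in> test_functions \<Omega>"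
    "(\<lambda>n. norm2 (lebesgue_on \<Omega>) (\<lambda>x. \<phi> n x - v x)) \<longlonglongrightarrow> 0"
    "(\<lambda>n. norm2 (lebesgue_on \<Omega>) (\<lambda>x. gradient (\<phi> n) x - g x)) \<longlonglongrightarrow> 0"
    using H0grad_sequence[OF v] by blast
  have d: "has_weak_gradient \<Omega> (\<lambda>x. v x - \<phi> n x) (\<lambda>x. g x - gradient (\<phi> n) x)" for n
    using has_weak_gradient_lincomb[OF \<Omega>' wg has_weak_gradient_test_function[OF \<Omega> \<phi>(1)[of n]], of 1 "-1"]
    by simp
  have "(\<lambda>n. sqrt ((norm2 (lebesgue_on \<Omega>) (\<lambda>x. \<phi> n x - v x))\<^sup>2
      + (norm2 (lebesgue_on \<Omega>) (\<lambda>x. gradient (\<phi> n) x - g x))\<^sup>2)) \<longlonglongrightarrow> sqrt (0\<^sup>2 + 0\<^sup>2)"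
    by (intro tendsto_intros \<phi>)
  then have "(\<lambda>n. H1_norm \<Omega> (\<lambda>x. v x - \<phi> n x)) \<longlonglongrightarrow> 0"
    using H1_norm_eq[OF \<Omega>(2) d L2_diff[OF H0grad_L2(2)[OF v] test_functions_L2(2)[OF \<Omega> \<phi>(1)]]]
    by (simp add: norm2_minus_commute[of _ v] norm2_minus_commute[of _ g])
  then show "v \<in> H10 \<Omega>"
    using H0grad_L2[OF v] wg \<phi>(1) unfolding H10_def H1_def L2_set_on_eq by blast
qed

section \<open>Poincare inequality and uniform integrability\<close>

lemma integrable_lborel_translate:
  fixes f :: "'a::euclidean_space \<Rightarrow> 'b::euclidean_space"
  assumes "integrable lborel f"
  shows "integrable lborel (\<lambda>x. f (x + c))"
proof -
  have "integrable (distr lborel borel (\<lambda>x. x + c)) f"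
    using assms by (simp add: distr_lborel_translate)
  then show ?thesis
    by (subst (asm) integrable_distr_eq) (use assms in auto)
qed

lemma L2_lborel_translate:
  fixes f :: "'a::euclidean_space \<Rightarrow> 'b::euclidean_space"
  assumes "f \<in> L2 lborel"
  shows "(\<lambda>x. f (x + c)) \<in> L2 lborel" "norm2 lborel (\<lambda>x. f (x + c)) = norm2 lborel f"
proof -
  have [measurable]: "f \<in> borel_measurable borel"
    using assms by (simp add: L2_def)
  show "(\<lambda>x. f (x + c)) \<in> L2 lborel"
    using integrable_lborel_translate[OF L2_integrable_power2[OF assms], of c] by (simp add: L2_def)
  show "norm2 lborel (\<lambda>x. f (x + c)) = norm2 lborel f"
    using integral_lborel_translate[of "\<lambda>x. (norm (f x))\<^sup>2" c] by (simp add: norm2_def)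
qed

lemma L2_lborel_compact_support:
  fixes f :: "'a::euclidean_space \<Rightarrow> 'b::euclidean_space"
  assumes "continuous_on UNIV f" "compact K" "\<And>x. x \<notin> K \<Longrightarrow> f x = 0"
  shows "f \<in> L2 lborel"
proof -
  have "continuous_on UNIV (\<lambda>x. (norm (f x))\<^sup>2)"
    by (intro continuous_intros assms)
  then show ?thesis
    using assms integrable_compact_support[of "\<lambda>x. (norm (f x))\<^sup>2" K]
    by (auto simp: L2_def borel_measurable_continuous_onI)
qed

text \<open>A telescoping sum: each of the \<open>n\<close> increments is a translate of the first,
  and translations preserve the norm.\<close>

lemma norm2_translate_multiple:
  fixes f :: "'a::euclidean_space \<Rightarrow> real"
  assumes f: "f \<in> L2 lborel"
  shows "norm2 lborel (\<lambda>x. f (x + real n *\<^sub>R t) - f x) \<le> real n * norm2 lborel (\<lambda>x. f (x + t) - f x)"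
proof (induction n)
  case 0
  then show ?case by (simp add: norm2_def)
next
  case (Suc n)
  have d: "(\<lambda>x. f (x + t) - f x) \<in> L2 lborel"
    by (intro L2_diff L2_lborel_translate f)
  have "norm2 lborel (\<lambda>x. f (x + real (Suc n) *\<^sub>R t) - f x)
      \<le> norm2 lborel (\<lambda>x. f (x + real (Suc n) *\<^sub>R t) - f (x + real n *\<^sub>R t))
        + norm2 lborel (\<lambda>x. f (x + real n *\<^sub>R t) - f x)"
    by (intro norm2_triangle3 L2_lborel_translate f)
  also have "norm2 lborel (\<lambda>x. f (x + real (Suc n) *\<^sub>R t) - f (x + real n *\<^sub>R t)) = norm2 lborel (\<lambda>x. f (x + t) - f x)"
    using L2_lborel_translate(2)[OF d, of "real n *\<^sub>R t"] by (simp add: algebra_simps)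
  finally show ?case using Suc by (simp add: algebra_simps)
qed

text \<open>Instead of integrating along the segment, the shift by \<open>h\<close> is divided into
  \<open>Suc n\<close> equal shifts. The rescaled small differences \<open>D n\<close> dominate the
  full difference in norm and converge in L2 to the directional derivative.\<close>

lemma norm2_translate_diff_le:
  fixes f :: "'a::euclidean_space \<Rightarrow> real"
  assumes f: "Ck_fun (Suc 0) f" and K: "compact K" "\<And>x. x \<notin> K \<Longrightarrow> f x = 0"
  shows "norm2 lborel (\<lambda>x. f (x + h) - f x) \<le> norm h * norm2 lborel (gradient f)"
proof -
  have cont: "continuous_on UNIV f" using Ck_fun_pred[OF f] by simp
  have fL: "f \<in> L2 lborel" by (rule L2_lborel_compact_support[OF cont K])
  have gL: "gradient f \<in> L2 lborel"
    by (rule L2_lborel_compact_support[OF continuous_gradient[OF f] K(1)])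
       (rule gradient_eq_0_off_support[OF compact_imp_closed[OF K(1)] K(2)])
  define D where "D n x = real (Suc n) * (f (x + inverse (real (Suc n)) *\<^sub>R h) - f x)" for n x
  obtain c \<rho> where c: "0 \<le> c" and dom: "\<And>n x. \<bar>D n x\<bar> \<le> c * indicator (cball 0 \<rho>) x"
    using difference_quotient_dominated[OF f K, of h] unfolding D_def by metis
  let ?w = "\<lambda>x::'a. c * indicator (cball 0 \<rho>) x :: real"
  have "(\<lambda>x. (norm (?w x))\<^sup>2) = (\<lambda>x. c\<^sup>2 * indicator (cball 0 \<rho>) x)"
    by (auto simp: indicator_def fun_eq_iff)
  then have w: "?w \<in> L2 lborel"
    using integrable_indicator_cball[of "c\<^sup>2" \<rho>] by (auto simp: L2_def)
  have DL: "D n \<in> L2 lborel" for n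
    unfolding D_def using L2_scaleR[OF L2_diff[OF L2_lborel_translate(1)[OF fL] fL]] by simp
  have lim: "AE x in lborel. (\<lambda>n. D n x) \<longlonglongrightarrow> gradient f x \<bullet> h"
    unfolding D_def using directional_difference_tendsto[OF f] by simp
  have bound: "AE x in lborel. norm (D n x) \<le> norm (?w x)" for n
    using dom c by (auto simp: abs_mult)
  have meas: "D n \<in> borel_measurable lborel" "(\<lambda>x. gradient f x \<bullet> h) \<in> borel_measurable lborel" for n
    using DL[of n] gL by (auto simp: L2_def)
  note dc = norm2_dominated_convergence[OF w meas lim bound]
  have "norm2 lborel (\<lambda>x. f (x + h) - f x) \<le> norm2 lborel (D n)" for n
  proof -
    have "norm2 lborel (\<lambda>x. f (x + real (Suc n) *\<^sub>R (inverse (real (Suc n)) *\<^sub>R h)) - f x)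
        \<le> real (Suc n) * norm2 lborel (\<lambda>x. f (x + inverse (real (Suc n)) *\<^sub>R h) - f x)"
      by (rule norm2_translate_multiple[OF fL])
    also have "\<dots> = norm2 lborel (D n)"
      using norm2_scaleR[of lborel "real (Suc n)" "\<lambda>x. f (x + inverse (real (Suc n)) *\<^sub>R h) - f x"]
      by (simp add: D_def[abs_def] del: of_nat_Suc)
    finally show ?thesis by (simp del: of_nat_Suc)
  qed
  then have "norm2 lborel (\<lambda>x. f (x + h) - f x) \<le> norm2 lborel (\<lambda>x. gradient f x \<bullet> h)"
    by (intro LIMSEQ_le_const[OF norm2_tendsto[OF DL dc(2,1)]]) auto
  also have "\<dots> \<le> norm2 lborel (\<lambda>x. norm h *\<^sub>R gradient f x)"
    using dc(2) by (intro norm2_mono L2_scaleR gL)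
      (auto simp: L2_def mult.commute[of "norm h"] Cauchy_Schwarz_ineq2)
  also have "\<dots> = norm h * norm2 lborel (gradient f)"
    by (simp add: norm2_scaleR)
  finally show ?thesis .
qed

lemma norm2_test_function_lborel:
  assumes \<Omega>: "\<Omega> \<in> sets lebesgue" and \<phi>: "\<phi> \<in> test_functions \<Omega>"
  shows "norm2 (lebesgue_on \<Omega>) \<phi> = norm2 lborel \<phi>"
    and "norm2 (lebesgue_on \<Omega>) (gradient \<phi>) = norm2 lborel (gradient \<phi>)"
proof -
  obtain K where K: "compact K" "K \<subseteq> \<Omega>" "\<And>x. x \<notin> K \<Longrightarrow> \<phi> x = 0" "\<And>x. x \<notin> K \<Longrightarrow> gradient \<phi> x = 0"
    using test_functionsD(2)[OF \<phi>] by blast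
  show "norm2 (lebesgue_on \<Omega>) \<phi> = norm2 lborel \<phi>"
    unfolding norm2_def using K(2,3)
    by (subst integral_lebesgue_on_eq_lborel[OF \<Omega>])
       (auto intro!: borel_measurable_continuous_onI continuous_intros test_functions_continuous[OF \<phi>])
  show "norm2 (lebesgue_on \<Omega>) (gradient \<phi>) = norm2 lborel (gradient \<phi>)"
    unfolding norm2_def using K(2,4)
    by (subst integral_lebesgue_on_eq_lborel[OF \<Omega>])
       (auto intro!: borel_measurable_continuous_onI continuous_intros test_functions_continuous[OF \<phi>])
qed

lemma nn_integral_norm_power2:
  assumes "f \<in> L2 M"
  shows "(\<integral>\<^sup>+x. ennreal ((norm (f x))\<^sup>2) \<partial>M) = ennreal ((norm2 M f)\<^sup>2)"
  unfolding norm2_power2 by (rule nn_integral_eq_integral[OF L2_integrable_power2[OF assms]]) simp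

text \<open>Averaging \<open>f(x)\<^sup>2 \<le> 2 (f(x + h) - f(x))\<^sup>2 + 2 f(x + h)\<^sup>2\<close> over \<open>h\<close> in a ball trades the integral over
  \<open>E\<close> for a gradient term and a multiple of the measure of \<open>E\<close>.\<close>

lemma norm2_restrict_test_function:
  fixes \<Omega> :: "'a::euclidean_space set"
  assumes \<Omega>: "bounded \<Omega>" "open \<Omega>" and \<phi>: "\<phi> \<in> test_functions \<Omega>"
    and E: "E \<in> sets (lebesgue_on \<Omega>)" and \<epsilon>: "0 < \<epsilon>"
  shows "measure lborel (ball (0::'a) \<epsilon>) * (norm2 (lebesgue_on \<Omega>) (\<lambda>x. indicator E x *\<^sub>R \<phi> x))\<^sup>2
    \<le> 2 * measure lborel (ball (0::'a) \<epsilon>) * \<epsilon>\<^sup>2 * (norm2 (lebesgue_on \<Omega>) (gradient \<phi>))\<^sup>2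
      + 2 * measure (lebesgue_on \<Omega>) E * (norm2 (lebesgue_on \<Omega>) \<phi>)\<^sup>2"
proof -
  let ?M = "lebesgue_on \<Omega>" and ?B = "ball (0::'a) \<epsilon>"
  interpret finite_measure ?M by (rule finite_measure_lebesgue_on_bounded_open[OF \<Omega>])
  have \<Omega>': "\<Omega> \<in> sets lebesgue" using \<Omega> by auto
  have EL: "E \<in> sets lebesgue" "E \<subseteq> \<Omega>"
    using E \<Omega>' by (auto simp: sets_restrict_space_iff)
  define b where "b = measure lborel ?B"
  have b: "emeasure lborel ?B = ennreal b" "0 \<le> b"
    unfolding b_def using emeasure_lborel_ball_finite[of "0::'a" \<epsilon>]
    by (auto simp: emeasure_eq_ennreal_measure less_top)
  have [measurable]: "\<phi> \<in> borel_measurable borel"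
    by (intro borel_measurable_continuous_onI test_functions_continuous[OF \<phi>])
  have [measurable]: "?B \<in> sets borel" by simp
  obtain K where K: "compact K" "\<And>x. x \<notin> K \<Longrightarrow> \<phi> x = 0"
    using test_functionsD(2)[OF \<phi>] by blast
  have \<phi>L: "\<phi> \<in> L2 lborel"
    by (rule L2_lborel_compact_support[OF test_functions_continuous(1)[OF \<phi>] K])
  define P where "P = (norm2 lborel \<phi>)\<^sup>2"
  define Q where "Q = (norm2 lborel (gradient \<phi>))\<^sup>2"
  \<comment> \<open>With nonnegative extended integrals the order of integration over
    \<open>x\<close> and \<open>h\<close> can be exchanged on measurability alone. The average is
    not normalized, which is why \<open>b\<close> multiplies the left-hand side.\<close>
  define J where "J x = (\<integral>\<^sup>+h. ennreal ((\<phi> (x + h) - \<phi> x)\<^sup>2) * indicator ?B h \<partial>lborel)" for x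
  have J_meas [measurable]: "J \<in> borel_measurable borel"
    unfolding J_def by (rule lborel.borel_measurable_nn_integral) measurable
  have pointwise: "ennreal b * ennreal ((\<phi> x)\<^sup>2) \<le> 2 * J x + 2 * ennreal P" for x
  proof -
    have "ennreal b * ennreal ((\<phi> x)\<^sup>2) = (\<integral>\<^sup>+h. ennreal ((\<phi> x)\<^sup>2) * indicator ?B h \<partial>lborel)"
      by (subst nn_integral_cmult_indicator) (auto simp: b mult.commute)
    also have "\<dots> \<le> (\<integral>\<^sup>+h. 2 * (ennreal ((\<phi> (x + h) - \<phi> x)\<^sup>2) * indicator ?B h) + 2 * ennreal ((\<phi> (h + x))\<^sup>2) \<partial>lborel)"
    proof (rule nn_integral_mono)
      fix h
      have "(\<phi> x)\<^sup>2 \<le> 2 * (\<phi> (x + h) - \<phi> x)\<^sup>2 + 2 * (\<phi> (h + x))\<^sup>2"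
        using sum_squares_bound[of "\<phi> (x + h) - \<phi> x" "- \<phi> (x + h)"]
          zero_le_power2[of "\<phi> x - 2 * \<phi> (x + h)"]
        by (simp add: power2_eq_square algebra_simps)
      then have "ennreal ((\<phi> x)\<^sup>2) \<le> ennreal (2 * (\<phi> (x + h) - \<phi> x)\<^sup>2 + 2 * (\<phi> (h + x))\<^sup>2)"
        by (rule ennreal_leI)
      also have "\<dots> = 2 * ennreal ((\<phi> (x + h) - \<phi> x)\<^sup>2) + 2 * ennreal ((\<phi> (h + x))\<^sup>2)"
        by (simp add: ennreal_plus ennreal_mult)
      finally show "ennreal ((\<phi> x)\<^sup>2) * indicator ?B h
          \<le> 2 * (ennreal ((\<phi> (x + h) - \<phi> x)\<^sup>2) * indicator ?B h) + 2 * ennreal ((\<phi> (h + x))\<^sup>2)"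
        by (auto simp: indicator_def)
    qed
    also have "\<dots> = 2 * J x + 2 * (\<integral>\<^sup>+h. ennreal ((\<phi> (h + x))\<^sup>2) \<partial>lborel)"
      unfolding J_def by (subst nn_integral_add) (auto simp: nn_integral_cmult)
    \<comment> \<open>The indicator of the ball has been dropped in this term. The integral over all
      \<open>h\<close> is then independent of \<open>x\<close>, and integrating it over
      \<open>E\<close> later produces the factor \<open>measure ?M E\<close>.\<close>
    also have "(\<integral>\<^sup>+h. ennreal ((\<phi> (h + x))\<^sup>2) \<partial>lborel) = ennreal P"
      using nn_integral_norm_power2[OF L2_lborel_translate(1)[OF \<phi>L, of x]]
      by (simp add: L2_lborel_translate(2)[OF \<phi>L] P_def)
    finally show ?thesis .
  qed
  \<comment> \<open>For fixed \<open>h\<close> in the ball the integral over \<open>x\<close> is the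
    squared norm of a translated difference, at most \<open>\<epsilon>\<^sup>2 * Q\<close>;
    integration over the ball contributes its volume \<open>b\<close>.\<close>
  have J_int: "(\<integral>\<^sup>+x. J x \<partial>lborel) \<le> ennreal (b * (\<epsilon>\<^sup>2 * Q))"
  proof -
    have "(\<integral>\<^sup>+x. J x \<partial>lborel) = (\<integral>\<^sup>+h. \<integral>\<^sup>+x. ennreal ((\<phi> (x + h) - \<phi> x)\<^sup>2) * indicator ?B h \<partial>lborel \<partial>lborel)"
      unfolding J_def by (rule lborel_pair.Fubini') measurable
    also have "\<dots> \<le> (\<integral>\<^sup>+h. ennreal (\<epsilon>\<^sup>2 * Q) * indicator ?B h \<partial>lborel)"
    proof (rule nn_integral_mono)
      fix h :: 'a
      show "(\<integral>\<^sup>+x. ennreal ((\<phi> (x + h) - \<phi> x)\<^sup>2) * indicator ?B h \<partial>lborel) \<le> ennreal (\<epsilon>\<^sup>2 * Q) * indicator ?B h"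
      proof (cases "h \<in> ?B")
        case True
        have "(norm2 lborel (\<lambda>x. \<phi> (x + h) - \<phi> x))\<^sup>2 \<le> (\<epsilon> * norm2 lborel (gradient \<phi>))\<^sup>2"
          using norm2_translate_diff_le[OF test_functionsD(1)[OF \<phi>] K, of h] True
          by (intro power_mono order_trans[OF norm2_translate_diff_le[OF test_functionsD(1)[OF \<phi>] K, of h]] mult_right_mono) auto
        then show ?thesis
          using True nn_integral_norm_power2[OF L2_diff[OF L2_lborel_translate(1)[OF \<phi>L, of h] \<phi>L]]
          by (simp add: Q_def power_mult_distrib ennreal_leI)
      qed simp
    qed
    also have "\<dots> = ennreal (\<epsilon>\<^sup>2 * Q) * ennreal b"
      by (simp add: nn_integral_cmult_indicator b)
    also have "\<dots> = ennreal (b * (\<epsilon>\<^sup>2 * Q))"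
      using b(2) by (simp add: Q_def mult.commute flip: ennreal_mult)
    finally show ?thesis .
  qed
  have J_le: "(\<integral>\<^sup>+x. J x \<partial>?M) \<le> (\<integral>\<^sup>+x. J x \<partial>lborel)"
  proof -
    have "(\<integral>\<^sup>+x. J x \<partial>?M) = (\<integral>\<^sup>+x. J x * indicator \<Omega> x \<partial>lebesgue)"
      using \<Omega>' by (simp add: nn_integral_restrict_space)
    also have "\<dots> \<le> (\<integral>\<^sup>+x. J x \<partial>lebesgue)"
      by (intro nn_integral_mono) (auto simp: indicator_def)
    also have "\<dots> = (\<integral>\<^sup>+x. J x \<partial>lborel)"
      by (simp add: nn_integral_completion)
    finally show ?thesis .
  qed
  note J_M = order_trans[OF J_le J_int]
  have \<phi>E: "(\<lambda>x. indicator E x *\<^sub>R \<phi> x) \<in> L2 ?M"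
    by (rule L2_restrict[OF test_functions_L2(1)[OF \<Omega> \<phi>] E])
  have "ennreal (b * (norm2 ?M (\<lambda>x. indicator E x *\<^sub>R \<phi> x))\<^sup>2)
      = ennreal b * (\<integral>\<^sup>+x. ennreal ((norm (indicator E x *\<^sub>R \<phi> x))\<^sup>2) \<partial>?M)"
    by (simp only: nn_integral_norm_power2[OF \<phi>E] ennreal_mult[OF b(2) zero_le_power2])
  also have "\<dots> = (\<integral>\<^sup>+x. ennreal b * ennreal ((norm (indicator E x *\<^sub>R \<phi> x))\<^sup>2) \<partial>?M)"
    using \<phi>E by (intro nn_integral_cmult[symmetric]) (auto simp: L2_def)
  also have "\<dots> \<le> (\<integral>\<^sup>+x. 2 * J x + 2 * ennreal P * indicator E x \<partial>?M)"
  proof (rule nn_integral_mono)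
    fix x
    show "ennreal b * ennreal ((norm (indicator E x *\<^sub>R \<phi> x))\<^sup>2) \<le> 2 * J x + 2 * ennreal P * indicator E x"
      using pointwise[of x] by (cases "x \<in> E") auto
  qed
  also have "\<dots> = 2 * (\<integral>\<^sup>+x. J x \<partial>?M) + 2 * ennreal P * emeasure ?M E"
  proof -
    have "J \<in> borel_measurable ?M" by (intro borel_measurable_lebesgue_onI J_meas)
    then show ?thesis
      using E by (subst nn_integral_add) (auto simp: nn_integral_cmult nn_integral_cmult_indicator intro!: borel_measurable_times)
  qed
  also have "\<dots> \<le> 2 * ennreal (b * (\<epsilon>\<^sup>2 * Q)) + 2 * ennreal P * emeasure ?M E"
    by (intro add_right_mono mult_left_mono J_M) simp
  also have "2 * ennreal (b * (\<epsilon>\<^sup>2 * Q)) + 2 * ennreal P * emeasure ?M E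
      = ennreal (2 * (b * (\<epsilon>\<^sup>2 * Q)) + 2 * P * measure ?M E)"
    using b(2) by (simp add: emeasure_eq_measure P_def Q_def ennreal_plus ennreal_mult mult.assoc)
  finally have "b * (norm2 ?M (\<lambda>x. indicator E x *\<^sub>R \<phi> x))\<^sup>2 \<le> 2 * (b * (\<epsilon>\<^sup>2 * Q)) + 2 * P * measure ?M E"
    using b(2) by (subst (asm) ennreal_le_iff) (auto simp: P_def Q_def)
  then show ?thesis
    by (simp add: b_def P_def Q_def norm2_test_function_lborel[OF \<Omega>' \<phi>] algebra_simps)
qed

lemma norm2_restrict_H0grad:
  fixes \<Omega> :: "'a::euclidean_space set"
  assumes \<Omega>: "bounded \<Omega>" "open \<Omega>" and v: "H0grad \<Omega> v g"
    and E: "E \<in> sets (lebesgue_on \<Omega>)" and \<epsilon>: "0 < \<epsilon>"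
  shows "measure lborel (ball (0::'a) \<epsilon>) * (norm2 (lebesgue_on \<Omega>) (\<lambda>x. indicator E x *\<^sub>R v x))\<^sup>2
    \<le> 2 * measure lborel (ball (0::'a) \<epsilon>) * \<epsilon>\<^sup>2 * (norm2 (lebesgue_on \<Omega>) g)\<^sup>2
      + 2 * measure (lebesgue_on \<Omega>) E * (norm2 (lebesgue_on \<Omega>) v)\<^sup>2"
proof -
  let ?M = "lebesgue_on \<Omega>"
  obtain \<phi> where \<phi>: "\<And>n. \<phi> n \<in> test_functions \<Omega>"
    "(\<lambda>n. norm2 ?M (\<lambda>x. \<phi> n x - v x)) \<longlonglongrightarrow> 0" "(\<lambda>n. norm2 ?M (\<lambda>x. gradient (\<phi> n) x - g x)) \<longlonglongrightarrow> 0"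
    using H0grad_sequence[OF v] by blast
  note L = test_functions_L2[OF \<Omega> \<phi>(1)] H0grad_L2[OF v]
  have "norm2 ?M (\<lambda>x. indicator E x *\<^sub>R \<phi> n x - indicator E x *\<^sub>R v x) \<le> norm2 ?M (\<lambda>x. \<phi> n x - v x)" for n
    using norm2_restrict_le[OF L2_diff[OF L(1)[of n] L(3)] E] by (simp only: scaleR_diff_right)
  then have "(\<lambda>n. norm2 ?M (\<lambda>x. indicator E x *\<^sub>R \<phi> n x - indicator E x *\<^sub>R v x)) \<longlonglongrightarrow> 0"
    by (intro Lim_null_comparison[OF _ \<phi>(2)]) auto
  then have 1: "(\<lambda>n. norm2 ?M (\<lambda>x. indicator E x *\<^sub>R \<phi> n x)) \<longlonglongrightarrow> norm2 ?M (\<lambda>x. indicator E x *\<^sub>R v x)"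
    by (intro norm2_tendsto L2_restrict L E)
  note 2 = norm2_tendsto[OF L(1) L(3) \<phi>(2)] and 3 = norm2_tendsto[OF L(2) L(4) \<phi>(3)]
  show ?thesis
    by (rule LIMSEQ_le[OF tendsto_mult[OF tendsto_const tendsto_power[OF 1]]
          tendsto_add[OF tendsto_mult[OF tendsto_const tendsto_power[OF 3]] tendsto_mult[OF tendsto_const tendsto_power[OF 2]]]])
       (use norm2_restrict_test_function[OF \<Omega> \<phi>(1) E \<epsilon>] in auto)
qed

section \<open>Absorption: the Poincare inequality and the estimate on small sets\<close>

lemma measure_ball_pos: "0 < \<epsilon> \<Longrightarrow> 0 < measure lborel (ball (0::'a::euclidean_space) \<epsilon>)"
  using content_ball_pos[of \<epsilon> "0::'a"] by simp

lemma measure_ball_unbounded: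
  obtains \<epsilon> where "0 < \<epsilon>" "c \<le> measure lborel (ball (0::'a::euclidean_space) \<epsilon>)"
proof -
  define a where "a = unit_ball_vol (real DIM('a))"
  have a: "0 < a" unfolding a_def by (intro unit_ball_vol_pos) simp
  \<comment> \<open>A radius of at least 1 makes the volume grow at least linearly in it, whatever
    the dimension.\<close>
  define \<epsilon> where "\<epsilon> = max 1 (c / a)"
  have "c \<le> a * \<epsilon>" using a by (simp add: \<epsilon>_def field_simps max_def)
  also have "\<dots> \<le> a * \<epsilon> ^ DIM('a)"
    using a self_le_power[of \<epsilon> "DIM('a)"] by (intro mult_left_mono) (auto simp: \<epsilon>_def)
  also have "\<dots> = measure lborel (ball (0::'a) \<epsilon>)"
    using content_ball[of \<epsilon> "0::'a"] by (simp add: \<epsilon>_def a_def)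
  finally show ?thesis by (intro that[of \<epsilon>]) (auto simp: \<epsilon>_def)
qed

text \<open>The averaging inequality with \<open>E = \<Omega>\<close>. A ball of volume at least
  four times that of \<Omega> lets the last term be absorbed into half of the left-hand side, and
  what remains gives the constant \<open>2 * \<epsilon>\<close>.\<close>

lemma poincare:
  fixes \<Omega> :: "'a::euclidean_space set"
  assumes \<Omega>: "bounded \<Omega>" "open \<Omega>"
  obtains C where "0 < C" "\<And>v g. H0grad \<Omega> v g \<Longrightarrow> norm2 (lebesgue_on \<Omega>) v \<le> C * norm2 (lebesgue_on \<Omega>) g"
proof -
  let ?M = "lebesgue_on \<Omega>"
  obtain \<epsilon> where \<epsilon>: "0 < \<epsilon>" "4 * measure ?M \<Omega> \<le> measure lborel (ball (0::'a) \<epsilon>)"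
    by (rule measure_ball_unbounded)
  define b where "b = measure lborel (ball (0::'a) \<epsilon>)"
  have b: "0 < b" unfolding b_def by (rule measure_ball_pos[OF \<epsilon>(1)])
  show ?thesis
  proof (rule that[of "2 * \<epsilon>"])
    fix v g assume v: "H0grad \<Omega> v g"
    have "norm2 ?M (\<lambda>x. indicator \<Omega> x *\<^sub>R v x) = norm2 ?M v"
      unfolding norm2_def by (intro arg_cong[where f=sqrt] Bochner_Integration.integral_cong) auto
    then have "b * (norm2 ?M v)\<^sup>2 \<le> 2 * b * \<epsilon>\<^sup>2 * (norm2 ?M g)\<^sup>2 + 2 * measure ?M \<Omega> * (norm2 ?M v)\<^sup>2"
      using norm2_restrict_H0grad[OF \<Omega> v _ \<epsilon>(1), of \<Omega>] by (simp add: b_def)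
    also have "2 * measure ?M \<Omega> * (norm2 ?M v)\<^sup>2 \<le> b / 2 * (norm2 ?M v)\<^sup>2"
      using \<epsilon>(2) by (intro mult_right_mono) (auto simp: b_def)
    finally have "b * (norm2 ?M v)\<^sup>2 \<le> b * (2 * \<epsilon> * norm2 ?M g)\<^sup>2"
      by (simp add: power_mult_distrib algebra_simps)
    then have "(norm2 ?M v)\<^sup>2 \<le> (2 * \<epsilon> * norm2 ?M g)\<^sup>2"
      using b by simp
    then show "norm2 ?M v \<le> 2 * \<epsilon> * norm2 ?M g"
      by (rule power2_le_imp_le) (use \<epsilon>(1) in auto)
  qed (use \<epsilon>(1) in auto)
qed

lemma small_set_estimate:
  fixes \<Omega> :: "'a::euclidean_space set"
  assumes \<Omega>: "bounded \<Omega>" "open \<Omega>" and \<eta>: "0 < \<eta>"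
  obtains \<delta> where "0 < \<delta>"
    "\<And>v g E. H0grad \<Omega> v g \<Longrightarrow> E \<in> sets (lebesgue_on \<Omega>) \<Longrightarrow> measure (lebesgue_on \<Omega>) E \<le> \<delta> \<Longrightarrow>
       norm2 (lebesgue_on \<Omega>) (\<lambda>x. indicator E x *\<^sub>R v x) \<le> \<eta> * norm2 (lebesgue_on \<Omega>) g"
proof -
  let ?M = "lebesgue_on \<Omega>"
  obtain C where C: "0 < C" "\<And>v g. H0grad \<Omega> v g \<Longrightarrow> norm2 ?M v \<le> C * norm2 ?M g"
    using poincare[OF \<Omega>] by blast
  define b where "b = measure lborel (ball (0::'a) (\<eta> / 2))"
  have b: "0 < b" unfolding b_def using \<eta> by (intro measure_ball_pos) simp
  \<comment> \<open>The radius \<open>\<eta> / 2\<close> turns the gradient term into half of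
    \<open>b * \<eta>\<^sup>2\<close> times the squared gradient norm; by Poincare, this \<delta>
    makes the other term the second half.\<close>
  define \<delta> where "\<delta> = \<eta>\<^sup>2 * b / (4 * C\<^sup>2)"
  show ?thesis
  proof (rule that)
    show "0 < \<delta>" using \<eta> b C(1) by (simp add: \<delta>_def)
    fix v g E assume v: "H0grad \<Omega> v g" and E: "E \<in> sets ?M" and mE: "measure ?M E \<le> \<delta>"
    have "b * (norm2 ?M (\<lambda>x. indicator E x *\<^sub>R v x))\<^sup>2
        \<le> 2 * b * (\<eta> / 2)\<^sup>2 * (norm2 ?M g)\<^sup>2 + 2 * measure ?M E * (norm2 ?M v)\<^sup>2"
      unfolding b_def using \<eta> by (intro norm2_restrict_H0grad[OF \<Omega> v E]) simp
    also have "2 * measure ?M E * (norm2 ?M v)\<^sup>2 \<le> 2 * \<delta> * (C * norm2 ?M g)\<^sup>2"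
      using mE C(2)[OF v] order_trans[OF measure_nonneg mE] by (intro mult_mono power_mono) auto
    also have "2 * b * (\<eta> / 2)\<^sup>2 * (norm2 ?M g)\<^sup>2 + 2 * \<delta> * (C * norm2 ?M g)\<^sup>2 = b * (\<eta> * norm2 ?M g)\<^sup>2"
      using C(1) by (simp add: \<delta>_def power_mult_distrib power_divide field_simps)
    finally have "(norm2 ?M (\<lambda>x. indicator E x *\<^sub>R v x))\<^sup>2 \<le> (\<eta> * norm2 ?M g)\<^sup>2"
      using b by simp
    then show "norm2 ?M (\<lambda>x. indicator E x *\<^sub>R v x) \<le> \<eta> * norm2 ?M g"
      by (rule power2_le_imp_le) (use \<eta> in auto)
  qed
qed

section \<open>Chain rule and truncation\<close>

lemma real_lipschitz_from_deriv:
  fixes f :: "real \<Rightarrow> real"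
  assumes "\<And>y. (f has_real_derivative f' y) (at y)" "\<And>y. \<bar>f' y\<bar> \<le> B"
  shows "\<bar>f a - f b\<bar> \<le> B * \<bar>a - b\<bar>"
  using field_differentiable_bound[of UNIV f f' B a b] assms by simp

lemma test_functions_compose:
  assumes f: "\<And>k. Ck_fun k f" "f 0 = 0" "\<And>y. (f has_real_derivative f' y) (at y)"
    and \<phi>: "\<phi> \<in> test_functions \<Omega>"
  shows "(\<lambda>x. f (\<phi> x)) \<in> test_functions \<Omega>" "gradient (\<lambda>x. f (\<phi> x)) x = f' (\<phi> x) *\<^sub>R gradient \<phi> x"
proof -
  obtain K where K: "compact K" "K \<subseteq> \<Omega>" "\<And>x. x \<notin> K \<Longrightarrow> \<phi> x = 0"
    using test_functionsD(2)[OF \<phi>] by blast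
  have "Ck_fun k (\<lambda>x. f (\<phi> x))" for k
    by (rule Ck_fun_compose[OF f(1) test_functionsD(1)[OF \<phi>]])
  moreover have "f (\<phi> x) = 0" if "x \<notin> K" for x
    using K(3)[OF that] f(2) by simp
  ultimately show "(\<lambda>x. f (\<phi> x)) \<in> test_functions \<Omega>"
    using K(1,2) unfolding test_functions_def by blast
  show "gradient (\<lambda>x. f (\<phi> x)) x = f' (\<phi> x) *\<^sub>R gradient \<phi> x"
  proof (rule gradient_eqI)
    show "((\<lambda>x. f (\<phi> x)) has_derivative (\<lambda>h. (f' (\<phi> x) *\<^sub>R gradient \<phi> x) \<bullet> h)) (at x)"
      using diff_chain_at[OF gradient_has_derivative[OF test_functionsD(1)[OF \<phi>]]
          f(3)[unfolded has_field_derivative_def]] by (simp add: o_def)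
  qed
qed

text \<open>Split \<open>c n x *\<^sub>R \<gamma> n x - d x *\<^sub>R g x\<close> at
  \<open>c n x *\<^sub>R g x\<close>: the first part is small because the coefficients are bounded,
  the second by dominated convergence.\<close>

lemma norm2_scaled_diff_tendsto:
  fixes \<gamma> :: "nat \<Rightarrow> 'a \<Rightarrow> 'b::euclidean_space"
  assumes L: "\<And>n. \<gamma> n \<in> L2 M" "g \<in> L2 M" and lim: "(\<lambda>n. norm2 M (\<lambda>x. \<gamma> n x - g x)) \<longlonglongrightarrow> 0"
    and c: "\<And>n. c n \<in> borel_measurable M" "d \<in> borel_measurable M" "AE x in M. (\<lambda>n. c n x) \<longlonglongrightarrow> d x"
    and B: "0 \<le> B" "\<And>n x. \<bar>c n x\<bar> \<le> B"
  shows "(\<lambda>n. norm2 M (\<lambda>x. c n x *\<^sub>R \<gamma> n x - d x *\<^sub>R g x)) \<longlonglongrightarrow> 0" "(\<lambda>x. d x *\<^sub>R g x) \<in> L2 M"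
proof -
  have m: "(\<lambda>x. c n x *\<^sub>R g x) \<in> borel_measurable M" "(\<lambda>x. d x *\<^sub>R g x) \<in> borel_measurable M" for n
    using c L by (auto simp: L2_def)
  have l: "AE x in M. (\<lambda>n. c n x *\<^sub>R g x) \<longlonglongrightarrow> d x *\<^sub>R g x"
    using c(3) by eventually_elim (intro tendsto_intros)
  have bd: "AE x in M. norm (c n x *\<^sub>R g x) \<le> norm (B *\<^sub>R g x)" for n
    using B by (auto intro!: mult_right_mono)
  note dc = norm2_dominated_convergence[OF L2_scaleR[OF L(2), of B] m l bd]
  show "(\<lambda>x. d x *\<^sub>R g x) \<in> L2 M" by (rule dc(2))
  have cL: "(\<lambda>x. c n x *\<^sub>R g x) \<in> L2 M" for n
    by (rule L2_dominated[OF L2_scaleR[OF L(2), of B] m(1) bd])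
  have c\<gamma>L: "(\<lambda>x. c n x *\<^sub>R \<gamma> n x) \<in> L2 M" for n
    using B c(1) L(1)[of n]
    by (intro L2_dominated[OF L2_scaleR[OF L(1)[of n], of B]]) (auto simp: L2_def intro!: mult_right_mono)
  have "norm2 M (\<lambda>x. c n x *\<^sub>R \<gamma> n x - c n x *\<^sub>R g x) \<le> B * norm2 M (\<lambda>x. \<gamma> n x - g x)" for n
  proof -
    have "norm2 M (\<lambda>x. c n x *\<^sub>R \<gamma> n x - c n x *\<^sub>R g x) \<le> norm2 M (\<lambda>x. B *\<^sub>R (\<gamma> n x - g x))"
      using B L2_diff[OF c\<gamma>L[of n] cL[of n]]
      by (intro norm2_mono L2_scaleR L2_diff L) (auto simp: L2_def intro!: mult_right_mono simp flip: scaleR_diff_right)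
    then show ?thesis using B by (simp add: norm2_scaleR)
  qed
  then have "norm2 M (\<lambda>x. c n x *\<^sub>R \<gamma> n x - d x *\<^sub>R g x)
      \<le> B * norm2 M (\<lambda>x. \<gamma> n x - g x) + norm2 M (\<lambda>x. c n x *\<^sub>R g x - d x *\<^sub>R g x)" for n
    using norm2_triangle3[OF c\<gamma>L[of n] cL[of n] dc(2)] by (meson add_right_mono order_trans)
  then have "\<forall>\<^sub>F n in sequentially. norm (norm2 M (\<lambda>x. c n x *\<^sub>R \<gamma> n x - d x *\<^sub>R g x))
      \<le> B * norm2 M (\<lambda>x. \<gamma> n x - g x) + norm2 M (\<lambda>x. c n x *\<^sub>R g x - d x *\<^sub>R g x)"
    by simp
  moreover have "(\<lambda>n. B * norm2 M (\<lambda>x. \<gamma> n x - g x) + norm2 M (\<lambda>x. c n x *\<^sub>R g x - d x *\<^sub>R g x)) \<longlonglongrightarrow> 0"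
    using tendsto_add[OF tendsto_mult_left[OF lim, of B] dc(1)] by simp
  ultimately show "(\<lambda>n. norm2 M (\<lambda>x. c n x *\<^sub>R \<gamma> n x - d x *\<^sub>R g x)) \<longlonglongrightarrow> 0"
    by (rule Lim_null_comparison)
qed

lemma H0grad_compose_smooth:
  assumes \<Omega>: "bounded \<Omega>" "open \<Omega>" and v: "H0grad \<Omega> v g"
    and f: "\<And>k. Ck_fun k f" "f 0 = 0" "\<And>y. (f has_real_derivative f' y) (at y)"
    and f': "continuous_on UNIV f'" "\<And>y. \<bar>f' y\<bar> \<le> B"
  shows "H0grad \<Omega> (\<lambda>x. f (v x)) (\<lambda>x. f' (v x) *\<^sub>R g x)"
proof -
  let ?M = "lebesgue_on \<Omega>"
  have B: "0 \<le> B" using f'(2)[of 0] by linarith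
  note lip = real_lipschitz_from_deriv[OF f(3) f'(2)]
  have meas: "f \<in> borel_measurable borel" "f' \<in> borel_measurable borel"
    using f(1)[of 0] f'(1) by (auto intro: borel_measurable_continuous_onI)
  obtain \<phi>0 where \<phi>0: "\<And>n. \<phi>0 n \<in> test_functions \<Omega>"
    "(\<lambda>n. norm2 ?M (\<lambda>x. \<phi>0 n x - v x)) \<longlonglongrightarrow> 0" "(\<lambda>n. norm2 ?M (\<lambda>x. gradient (\<phi>0 n) x - g x)) \<longlonglongrightarrow> 0"
    using H0grad_sequence[OF v] by blast
  \<comment> \<open>Convergence in norm gives no pointwise convergence of
    \<open>f' (\<phi> n x)\<close>; an almost everywhere convergent subsequence does.\<close>
  obtain r where r: "strict_mono r" "AE x in ?M. (\<lambda>n. \<phi>0 (r n) x) \<longlonglongrightarrow> v x"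
    using norm2_AE_subseq[OF test_functions_L2(1)[OF \<Omega> \<phi>0(1)] H0grad_L2(1)[OF v] \<phi>0(2)] by blast
  define \<phi> where "\<phi> n = \<phi>0 (r n)" for n
  have \<phi>: "\<And>n. \<phi> n \<in> test_functions \<Omega>"
    "(\<lambda>n. norm2 ?M (\<lambda>x. \<phi> n x - v x)) \<longlonglongrightarrow> 0" "(\<lambda>n. norm2 ?M (\<lambda>x. gradient (\<phi> n) x - g x)) \<longlonglongrightarrow> 0"
    unfolding \<phi>_def
    using \<phi>0(1) LIMSEQ_subseq_LIMSEQ[OF \<phi>0(2) r(1)] LIMSEQ_subseq_LIMSEQ[OF \<phi>0(3) r(1)]
    by (simp_all add: o_def)
  note vL = H0grad_L2[OF v] and \<phi>L = test_functions_L2[OF \<Omega> \<phi>(1)]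
  have fv: "(\<lambda>x. f (v x)) \<in> L2 ?M"
    using vL(1) lip[of _ 0] B meas f(2)
    by (intro L2_dominated[OF L2_scaleR[OF vL(1), of B]]) (auto simp: L2_def abs_mult)
  have lim': "AE x in ?M. (\<lambda>n. f' (\<phi> n x)) \<longlonglongrightarrow> f' (v x)"
    using r(2) unfolding \<phi>_def[symmetric]
  proof eventually_elim
    case (elim x)
    have "isCont f' (v x)" using f'(1) by (simp add: continuous_on_eq_continuous_at)
    then show ?case using elim by (rule isCont_tendsto_compose)
  qed
  note sd = norm2_scaled_diff_tendsto[OF \<phi>L(2) vL(2) \<phi>(3) _ _ lim' B f'(2)]
  have sdm: "(\<lambda>x. f' (\<phi> n x)) \<in> borel_measurable ?M" "(\<lambda>x. f' (v x)) \<in> borel_measurable ?M" for n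
    using meas vL(1) \<phi>L(1)[of n] by (auto simp: L2_def)
  show ?thesis
  proof (rule H0grad_sequenceI[OF fv sd(2)[OF sdm] H0grad_test_function[OF \<Omega> test_functions_compose(1)[OF f \<phi>(1)]] _ _ \<Omega>])
    show "(\<lambda>n. norm2 ?M (\<lambda>x. f (\<phi> n x) - f (v x))) \<longlonglongrightarrow> 0"
    proof (rule Lim_null_comparison)
      have "norm2 ?M (\<lambda>x. f (\<phi> n x) - f (v x)) \<le> norm2 ?M (\<lambda>x. B *\<^sub>R (\<phi> n x - v x))" for n
        using meas vL(1) \<phi>L(1)[of n] lip B
        by (intro norm2_mono L2_scaleR L2_diff \<phi>L vL) (auto simp: L2_def abs_mult)
      then show "\<forall>\<^sub>F n in sequentially. norm (norm2 ?M (\<lambda>x. f (\<phi> n x) - f (v x))) \<le> B * norm2 ?M (\<lambda>x. \<phi> n x - v x)"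
        using B by (simp add: norm2_scaleR[of ?M B] del: real_scaleR_def)
      show "(\<lambda>n. B * norm2 ?M (\<lambda>x. \<phi> n x - v x)) \<longlonglongrightarrow> 0"
        using tendsto_mult_left[OF \<phi>(2), of B] by simp
    qed
    show "(\<lambda>n. norm2 ?M (\<lambda>x. gradient (\<lambda>x. f (\<phi> n x)) x - f' (v x) *\<^sub>R g x)) \<longlonglongrightarrow> 0"
      using sd(1)[OF sdm] by (simp add: test_functions_compose(2)[OF f \<phi>(1)])
  qed
qed

text \<open>Only pointwise limits of \<open>f n\<close> and \<open>f' n\<close> are required, so
  \<open>T\<close> may have corners. The value of \<open>S\<close> at a corner is dictated by the
  approximating sequence, and two sequences with different \<open>S\<close> are later
  compared.\<close>

lemma H0grad_compose_limit:
  assumes \<Omega>: "bounded \<Omega>" "open \<Omega>" and v: "H0grad \<Omega> v g"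
    and step: "\<And>n. H0grad \<Omega> (\<lambda>x. f n (v x)) (\<lambda>x. f' n (v x) *\<^sub>R g x)"
    and meas: "\<And>n. f n \<in> borel_measurable borel" "\<And>n. f' n \<in> borel_measurable borel"
    and bd: "0 \<le> B" "\<And>n y. \<bar>f n y\<bar> \<le> B * \<bar>y\<bar>" "\<And>n y. \<bar>f' n y\<bar> \<le> B"
    and lim: "\<And>y. (\<lambda>n. f n y) \<longlonglongrightarrow> T y" "\<And>y. (\<lambda>n. f' n y) \<longlonglongrightarrow> S y"
  shows "H0grad \<Omega> (\<lambda>x. T (v x)) (\<lambda>x. S (v x) *\<^sub>R g x)"
proof -
  let ?M = "lebesgue_on \<Omega>"
  have TS [measurable]: "T \<in> borel_measurable borel" "S \<in> borel_measurable borel"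
    by (rule borel_measurable_LIMSEQ_real[OF lim(1) meas(1)], rule borel_measurable_LIMSEQ_real[OF lim(2) meas(2)])
  note [measurable] = meas
  note vL = H0grad_L2[OF v]
  have vm [measurable]: "v \<in> borel_measurable ?M" "g \<in> borel_measurable ?M"
    using vL by (auto simp: L2_def)
  have z: "(\<lambda>n. norm2 ?M (\<lambda>x. g x - g x)) \<longlonglongrightarrow> 0" by (simp add: norm2_def)
  note sd = norm2_scaled_diff_tendsto[OF vL(2) vL(2) z, of "\<lambda>n x. f' n (v x)" "\<lambda>x. S (v x)" B]
  have m: "(\<lambda>x. f' n (v x)) \<in> borel_measurable ?M" "(\<lambda>x. S (v x)) \<in> borel_measurable ?M"
    "(\<lambda>x. f n (v x)) \<in> borel_measurable ?M" "(\<lambda>x. T (v x)) \<in> borel_measurable ?M" for n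
    by measurable
  have l: "AE x in ?M. (\<lambda>n. f' n (v x)) \<longlonglongrightarrow> S (v x)" "AE x in ?M. (\<lambda>n. f n (v x)) \<longlonglongrightarrow> T (v x)"
    using lim by auto
  have b: "AE x in ?M. norm (f n (v x)) \<le> norm (B *\<^sub>R v x)" for n
    using bd by (auto simp: abs_mult)
  note dc = norm2_dominated_convergence[OF L2_scaleR[OF vL(1), of B] m(3,4) l(2) b]
  show ?thesis
    by (rule H0grad_sequenceI[OF dc(2) sd(2)[OF m(1,2) l(1) bd(1,3)] step dc(1) sd(1)[OF m(1,2) l(1) bd(1,3)] \<Omega>])
qed

text \<open>The rescalings \<open>soft_ramp (n (y - k)) / n\<close> are smooth and converge to \<open>max (y - k) 0\<close>, with
  derivatives tending to the indicator of the open half line \<open>y > k\<close> at every point.\<close>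

definition soft_ramp :: "real \<Rightarrow> real" where
  "soft_ramp x = x * flat 0 x"

lemma Ck_fun_soft_ramp: "Ck_fun k soft_ramp"
  unfolding soft_ramp_def[abs_def]
  using Ck_fun_inner[of k "1::real"] by (intro Ck_fun_mult Ck_fun_flat) simp

lemma soft_ramp_has_derivative: "(soft_ramp has_real_derivative flat 0 x + flat 1 x) (at x)"
proof -
  have eq: "x * flat 2 x = flat 1 x"
    by (simp add: flat_def power2_eq_square)
  have "((\<lambda>x. x * flat 0 x) has_real_derivative 1 * flat 0 x + (flat (0 + 2) x - real 0 * flat (0 + 1) x) * x) (at x)"
    by (intro DERIV_mult DERIV_ident flat_has_derivative)
  then show ?thesis
    unfolding soft_ramp_def[abs_def] using eq by (simp add: numeral_2_eq_2 mult.commute)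
qed

text \<open>For positive \<open>x\<close> this is \<open>(1 + t) * exp (- t) \<le> 1\<close> at
  \<open>t = 1 / x\<close>.\<close>

lemma soft_ramp_deriv_bound: "\<bar>flat 0 x + flat 1 x\<bar> \<le> 1"
proof (cases "0 < x")
  case True
  have "(1 + 1 / x) * exp (- (1 / x)) \<le> exp (1 / x) * exp (- (1 / x))"
    by (intro mult_right_mono exp_ge_add_one_self) auto
  then show ?thesis
    using True by (simp add: flat_def exp_minus_inverse algebra_simps divide_inverse)
qed (simp add: flat_def)

lemma flat_1_scaled_tendsto:
  assumes "0 < x"
  shows "(\<lambda>n. flat 1 (real n * x)) \<longlonglongrightarrow> 0"
proof -
  have "(\<lambda>n. flat 0 (real n * x) * (inverse (real n) * (1 / x))) \<longlonglongrightarrow> 1 * (0 * (1 / x))"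
    by (intro tendsto_intros flat_0_scaled_tendsto assms lim_inverse_n)
  moreover have "flat 1 y = flat 0 y * inverse y" for y
    by (simp add: flat_def divide_inverse)
  ultimately show ?thesis
    by (simp add: divide_inverse mult.assoc)
qed

section \<open>Truncation at nonnegative levels\<close>

lemma H0grad_ramp:
  assumes \<Omega>: "bounded \<Omega>" "open \<Omega>" and v: "H0grad \<Omega> v g" and k: "0 \<le> k"
  shows "H0grad \<Omega> (\<lambda>x. max (v x - k) 0) (\<lambda>x. (if k < v x then 1 else 0) *\<^sub>R g x)"
proof -
  define f where "f n y = inverse (real (Suc n)) * soft_ramp (real (Suc n) * (y - k))" for n y
  define f' where "f' n y = flat 0 (real (Suc n) * (y - k)) + flat 1 (real (Suc n) * (y - k))" for n y
  have f_eq: "f n y = (y - k) * flat 0 (real (Suc n) * (y - k))" for n y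
    by (simp add: f_def soft_ramp_def del: of_nat_Suc)
  have Ck: "Ck_fun j (f n)" for j n
    using Ck_fun_inner[of j "1::real"] unfolding f_def
    by (intro Ck_fun_cmult Ck_fun_compose[OF Ck_fun_soft_ramp] Ck_fun_diff Ck_fun_const) simp
  have Ck': "Ck_fun j (f' n)" for j n
    using Ck_fun_inner[of j "1::real"] unfolding f'_def
    by (intro Ck_fun_add Ck_fun_cmult Ck_fun_compose[OF Ck_fun_flat] Ck_fun_diff Ck_fun_const) simp_all
  \<comment> \<open>Truncation must keep zero boundary values, which forces the level to be
    nonnegative.\<close>
  have f0: "f n 0 = 0" for n
  proof -
    have "\<not> 0 < real (Suc n) * (0 - k)" using k by (simp add: mult_less_0_iff)
    then show ?thesis unfolding f_eq flat_def by simp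
  qed
  have der: "(f n has_real_derivative f' n y) (at y)" for n y
  proof -
    have lin: "((\<lambda>y. real (Suc n) * (y - k)) has_real_derivative real (Suc n)) (at y)"
      by (auto intro!: derivative_eq_intros)
    show ?thesis
      unfolding f_def
      by (rule DERIV_cong[OF DERIV_cmult[OF DERIV_chain2[OF soft_ramp_has_derivative lin]]])
         (simp add: f'_def del: of_nat_Suc)
  qed
  have bound: "\<bar>f' n y\<bar> \<le> 1" for n y
    unfolding f'_def by (rule soft_ramp_deriv_bound)
  have step: "H0grad \<Omega> (\<lambda>x. f n (v x)) (\<lambda>x. f' n (v x) *\<^sub>R g x)" for n
    by (rule H0grad_compose_smooth[OF \<Omega> v Ck f0 der _ bound]) (use Ck'[of 0 n] in simp)
  show ?thesis
  proof (rule H0grad_compose_limit[OF \<Omega> v step, where B=1 and T="\<lambda>y. max (y - k) 0" and S="\<lambda>y. if k < y then 1 else 0"])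
    show "f n \<in> borel_measurable borel" "f' n \<in> borel_measurable borel" for n
      using Ck[of 0 n] Ck'[of 0 n] by (auto intro: borel_measurable_continuous_onI)
    show "\<bar>f n y\<bar> \<le> 1 * \<bar>y\<bar>" for n y
      using real_lipschitz_from_deriv[OF der bound, of n y 0] f0[of n] by simp
    fix y
    show "(\<lambda>n. f n y) \<longlonglongrightarrow> max (y - k) 0"
    proof (cases "k < y")
      case True
      have "(\<lambda>n. (y - k) * flat 0 (real (Suc n) * (y - k))) \<longlonglongrightarrow> (y - k) * 1"
        using True by (intro tendsto_intros LIMSEQ_Suc[OF flat_0_scaled_tendsto]) simp
      then show ?thesis using True by (simp add: f_eq)
    next
      case False
      then have "f n y = 0" for n
        by (simp add: f_eq flat_def zero_less_mult_iff)
      then show ?thesis using False by (simp add: max_def)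
    qed
    show "(\<lambda>n. f' n y) \<longlonglongrightarrow> (if k < y then 1 else 0)"
    proof (cases "k < y")
      case True
      have "(\<lambda>n. flat 0 (real (Suc n) * (y - k)) + flat 1 (real (Suc n) * (y - k))) \<longlonglongrightarrow> 1 + 0"
        using True
        by (intro tendsto_intros LIMSEQ_Suc[OF flat_0_scaled_tendsto] LIMSEQ_Suc[OF flat_1_scaled_tendsto]) simp_all
      then show ?thesis using True by (simp add: f'_def)
    next
      case False
      then have "f' n y = 0" for n
        by (simp add: f'_def flat_def zero_less_mult_iff)
      then show ?thesis using False by simp
    qed
  qed (use bound in auto)
qed

lemma H0grad_gradient_unique:
  assumes "bounded \<Omega>" "open \<Omega>" "H0grad \<Omega> v g" "H0grad \<Omega> v h"
  shows "AE x in lebesgue_on \<Omega>. g x = h x"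
  using assms by (intro has_weak_gradient_unique[OF _ H0grad_has_weak_gradient H0grad_has_weak_gradient]) auto

text \<open>The ramps at levels increasing to \<open>k\<close> converge to the ramp at \<open>k\<close>, but their gradients converge to
  the restriction to \<open>{v \<ge> k}\<close> instead of \<open>{v > k}\<close>.\<close>

lemma gradient_zero_on_level_set:
  assumes \<Omega>: "bounded \<Omega>" "open \<Omega>" and v: "H0grad \<Omega> v g" and k: "0 < k"
  shows "AE x in lebesgue_on \<Omega>. v x = k \<longrightarrow> g x = 0"
proof -
  \<comment> \<open>Levels rising strictly to \<open>k\<close>, beginning with 0. Positivity of
    \<open>k\<close> leaves room for nonnegative levels below it.\<close>
  define l where "l n = k - k * inverse (real (Suc n))" for n
  have inv1: "inverse (real (Suc n)) \<le> 1" "0 < inverse (real (Suc n))" for n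
    by (auto simp: divide_simps)
  have l: "0 \<le> l n" "l n < k" for n
    using k inv1[of n] mult_left_mono[OF inv1(1)[of n], of k] mult_pos_pos[OF k inv1(2)[of n]]
    by (auto simp: l_def simp del: of_nat_Suc)
  have "(\<lambda>n. k - k * inverse (real (Suc n))) \<longlonglongrightarrow> k - k * 0"
    by (intro tendsto_intros LIMSEQ_inverse_real_of_nat)
  then have llim: "l \<longlonglongrightarrow> k" by (simp add: l_def[abs_def])
  have "H0grad \<Omega> (\<lambda>x. max (v x - k) 0) (\<lambda>x. (if k \<le> v x then 1 else 0) *\<^sub>R g x)"
  proof (rule H0grad_compose_limit[OF \<Omega> v H0grad_ramp[OF \<Omega> v l(1)], where B=1
        and T="\<lambda>y. max (y - k) 0" and S="\<lambda>y. if k \<le> y then 1 else 0"])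
    show "\<bar>max (y - l n) 0\<bar> \<le> 1 * \<bar>y\<bar>" for n y
      using l(1)[of n] by auto
    fix y
    show "(\<lambda>n. max (y - l n) 0) \<longlonglongrightarrow> max (y - k) 0"
      by (intro tendsto_intros llim)
    show "(\<lambda>n. if l n < y then 1 else 0 :: real) \<longlonglongrightarrow> (if k \<le> y then 1 else 0)"
    proof (cases "k \<le> y")
      case True
      then have "l n < y" for n using l(2)[of n] by linarith
      then show ?thesis using True by simp
    next
      case False
      then have "\<forall>\<^sub>F n in sequentially. y < l n"
        using order_tendstoD(1)[OF llim] by simp
      then have "\<forall>\<^sub>F n in sequentially. (if l n < y then 1 else 0 :: real) = 0"
        by eventually_elim simp
      then show ?thesis using False by (simp add: tendsto_eventually)
    qed
  qed auto
  \<comment> \<open>Two gradients of the same ramp agree almost everywhere, and on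
    \<open>v x = k\<close> one of them is \<open>g x\<close> while the other is zero.\<close>
  from H0grad_gradient_unique[OF \<Omega> this H0grad_ramp[OF \<Omega> v less_imp_le[OF k]]] show ?thesis
    by eventually_elim auto
qed

lemma H0grad_ramp_indicator:
  assumes \<Omega>: "bounded \<Omega>" "open \<Omega>" and v: "H0grad \<Omega> v g" and k: "0 \<le> k"
  shows "H0grad \<Omega> (\<lambda>x. max (v x - k) 0) (\<lambda>x. indicator {x\<in>\<Omega>. k < v x} x *\<^sub>R g x)"
  by (rule H0grad_cong_AE[OF _ H0grad_ramp[OF \<Omega> v k]]) (use \<Omega> in \<open>auto intro!: AE_I2\<close>)

text \<open>The difference of the two ramps is \<open>v x - a\<close> clipped to the interval from 0
  to \<open>c - a\<close>. Both superlevel sets are strict, so the slice excludes \<open>a\<close>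
  and includes \<open>c\<close>.\<close>

lemma H0grad_slice:
  assumes \<Omega>: "bounded \<Omega>" "open \<Omega>" and v: "H0grad \<Omega> v g" and k: "0 \<le> a" "a \<le> c"
  shows "H0grad \<Omega> (\<lambda>x. max (v x - a) 0 - max (v x - c) 0)
    (\<lambda>x. indicator {x\<in>\<Omega>. a < v x \<and> v x \<le> c} x *\<^sub>R g x)"
proof -
  have "H0grad \<Omega> (\<lambda>x. 1 * max (v x - a) 0 + (-1) * max (v x - c) 0)
      (\<lambda>x. 1 *\<^sub>R (indicator {x\<in>\<Omega>. a < v x} x *\<^sub>R g x) + (-1) *\<^sub>R (indicator {x\<in>\<Omega>. c < v x} x *\<^sub>R g x))"
    using k by (intro H0grad_lincomb[OF \<Omega>] H0grad_ramp_indicator[OF \<Omega> v]) auto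
  moreover have "(\<lambda>x. 1 *\<^sub>R (indicator {x\<in>\<Omega>. a < v x} x *\<^sub>R g x) + (-1) *\<^sub>R (indicator {x\<in>\<Omega>. c < v x} x *\<^sub>R g x))
      = (\<lambda>x. indicator {x\<in>\<Omega>. a < v x \<and> v x \<le> c} x *\<^sub>R g x)"
    using k by (auto simp: fun_eq_iff indicator_def)
  ultimately show ?thesis by simp
qed

lemma H0grad_minus:
  assumes "bounded \<Omega>" "open \<Omega>" "H0grad \<Omega> v g"
  shows "H0grad \<Omega> (\<lambda>x. - v x) (\<lambda>x. - g x)"
  using H0grad_lincomb[OF assms assms(3), of "-1" 0] by simp

section \<open>The Kolmogorov--Fokker--Planck equation\<close>

lemma sets_superlevel:
  fixes v :: "'a::euclidean_space \<Rightarrow> real"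
  assumes "v \<in> L2 (lebesgue_on \<Omega>)"
  shows "{x\<in>\<Omega>. a < v x} \<in> sets (lebesgue_on \<Omega>)" "{x\<in>\<Omega>. a \<le> v x} \<in> sets (lebesgue_on \<Omega>)"
    "{x\<in>\<Omega>. a < v x \<and> v x \<le> c} \<in> sets (lebesgue_on \<Omega>)" "{x\<in>\<Omega>. a < v x \<and> v x < c} \<in> sets (lebesgue_on \<Omega>)"
proof -
  let ?M = "lebesgue_on \<Omega>"
  have v: "v \<in> borel_measurable ?M" using assms by (simp add: L2_def)
  note 1 = borel_measurable_iff_greater[THEN iffD1, OF v, rule_format, of a]
    and 2 = borel_measurable_iff_ge[THEN iffD1, OF v, rule_format, of a]
    and le = borel_measurable_iff_le[THEN iffD1, OF v, rule_format, of c]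
    and less = borel_measurable_iff_less[THEN iffD1, OF v, rule_format, of c]
  note 3 = sets.sets_Collect_conj[OF 1 le] and 4 = sets.sets_Collect_conj[OF 1 less]
  show "{x\<in>\<Omega>. a < v x} \<in> sets ?M" "{x\<in>\<Omega>. a \<le> v x} \<in> sets ?M"
    "{x\<in>\<Omega>. a < v x \<and> v x \<le> c} \<in> sets ?M" "{x\<in>\<Omega>. a < v x \<and> v x < c} \<in> sets ?M"
    using 1 2 3 4 by (simp_all add: conj_commute)
qed

lemma L2_bounded_drift:
  fixes h \<beta> :: "'a \<Rightarrow> 'b::euclidean_space"
  assumes h: "h \<in> L2 M" and \<beta>: "\<beta> \<in> borel_measurable M" "AE x in M. norm (\<beta> x) \<le> L"
  shows "(\<lambda>x. \<beta> x \<bullet> h x) \<in> L2 M" "norm2 M (\<lambda>x. \<beta> x \<bullet> h x) \<le> L * norm2 M h"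
proof -
  have m: "(\<lambda>x. \<beta> x \<bullet> h x) \<in> borel_measurable M" using h \<beta>(1) by (auto simp: L2_def)
  have ae: "AE x in M. norm (\<beta> x \<bullet> h x) \<le> norm (\<bar>L\<bar> *\<^sub>R h x)"
    using \<beta>(2)
  proof eventually_elim
    case (elim x)
    have "\<bar>\<beta> x \<bullet> h x\<bar> \<le> norm (\<beta> x) * norm (h x)" by (rule Cauchy_Schwarz_ineq2)
    also have "\<dots> \<le> \<bar>L\<bar> * norm (h x)" using elim by (intro mult_right_mono) auto
    finally show ?case by simp
  qed
  show "(\<lambda>x. \<beta> x \<bullet> h x) \<in> L2 M" by (rule L2_dominated[OF L2_scaleR[OF h] m ae])
  show "norm2 M (\<lambda>x. \<beta> x \<bullet> h x) \<le> L * norm2 M h"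
  proof (cases "0 \<le> L")
    case True
    then show ?thesis using norm2_mono[OF L2_scaleR[OF h] m ae] by (simp add: norm2_scaleR)
  next
    \<comment> \<open>A negative bound on a norm is satisfied almost everywhere only if the whole
      space is null; then both norms are zero.\<close>
    case False
    then have "AE x in M. False"
      using \<beta>(2) by (auto elim!: eventually_mono dest: order_trans[OF norm_ge_zero])
    then have "AE x in M. norm (\<beta> x \<bullet> h x) = norm (0::real)" "AE x in M. norm (h x) = norm (0::real)"
      by (auto elim!: eventually_mono)
    then have "norm2 M (\<lambda>x. \<beta> x \<bullet> h x) = 0" "norm2 M h = 0"
      using norm2_cong_AE[OF m, of "\<lambda>x. 0::real"] norm2_mono[OF L2_zero[where 'b=real], of h] h
      by (auto simp: norm2_def L2_def intro!: integral_eq_zero_AE)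
    then show ?thesis by simp
  qed
qed

text \<open>For the restricted gradient \<open>h\<close> as test gradient,
  \<open>g x \<bullet> h x\<close> is the squared norm of \<open>h x\<close>, and \<open>m\<close>
  may be replaced by its restriction to \<open>E\<close> because \<open>h\<close> vanishes
  elsewhere. The drift is then estimated by Cauchy-Schwarz.\<close>

lemma kfp_energy:
  fixes g \<beta> :: "'a::euclidean_space \<Rightarrow> 'a"
  assumes m: "m \<in> L2 M" and g: "g \<in> L2 M" and E: "E \<in> sets M"
    and \<beta>: "\<beta> \<in> borel_measurable M" "AE x in M. norm (\<beta> x) \<le> L"
  shows "\<nu> * (norm2 M (\<lambda>x. indicator E x *\<^sub>R g x))\<^sup>2
    \<le> (LINT x|M. \<nu> * (g x \<bullet> (indicator E x *\<^sub>R g x)) + m x * (\<beta> x \<bullet> (indicator E x *\<^sub>R g x)))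
      + L * norm2 M (\<lambda>x. indicator E x *\<^sub>R m x) * norm2 M (\<lambda>x. indicator E x *\<^sub>R g x)"
proof -
  define h where "h x = indicator E x *\<^sub>R g x" for x
  define n where "n x = indicator E x *\<^sub>R m x" for x
  have h: "h \<in> L2 M" unfolding h_def by (rule L2_restrict[OF g E])
  have n: "n \<in> L2 M" unfolding n_def by (rule L2_restrict[OF m E])
  note b = L2_bounded_drift[OF h \<beta>]
  have 1: "g x \<bullet> h x = (norm (h x))\<^sup>2" and 2: "m x * (\<beta> x \<bullet> h x) = n x * (\<beta> x \<bullet> h x)" for x
    by (auto simp: h_def n_def indicator_def power2_norm_eq_inner)
  have "(LINT x|M. \<nu> * (g x \<bullet> h x) + m x * (\<beta> x \<bullet> h x)) = (LINT x|M. \<nu> * (norm (h x))\<^sup>2 + n x * (\<beta> x \<bullet> h x))"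
    unfolding 1 2 ..
  also have "\<dots> = \<nu> * (norm2 M h)\<^sup>2 + (LINT x|M. n x * (\<beta> x \<bullet> h x))"
    using L2_integrable_power2[OF h] integrable_mult_L2[OF n b(1)] by (simp add: norm2_power2)
  finally have eq: "(LINT x|M. \<nu> * (g x \<bullet> h x) + m x * (\<beta> x \<bullet> h x)) = \<dots>" .
  have "\<bar>LINT x|M. n x * (\<beta> x \<bullet> h x)\<bar> \<le> norm2 M n * norm2 M (\<lambda>x. \<beta> x \<bullet> h x)"
    using abs_integral_inner_le[OF n b(1)] by simp
  also have "\<dots> \<le> norm2 M n * (L * norm2 M h)"
    by (intro mult_left_mono b) simp
  finally show ?thesis
    using eq unfolding h_def[symmetric] n_def[symmetric] by (simp add: algebra_simps)
qed

text \<open>On the slice \<open>m\<close> is at most \<open>c\<close>, so the drift costs no more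
  than \<open>c\<close> times the root of the measure of the slice. The clipped function equals
  \<open>c - a\<close> on \<open>c < m x\<close>, so Poincare converts the gradient bound into a
  bound on that set. The hypothesis on the right-hand side concerns this one \<open>h\<close>,
  because the nonnegativity proof can use only test functions of one sign.\<close>

lemma kfp_slice:
  fixes \<Omega> :: "'a::euclidean_space set"
  assumes \<Omega>: "bounded \<Omega>" "open \<Omega>"
    and C: "0 \<le> C" "\<And>v g. H0grad \<Omega> v g \<Longrightarrow> norm2 (lebesgue_on \<Omega>) v \<le> C * norm2 (lebesgue_on \<Omega>) g"
    and \<nu>: "0 < \<nu>" and L: "0 \<le> L" and \<gamma>: "0 \<le> \<gamma>" and m: "H0grad \<Omega> m g"
    and \<beta>: "\<beta> \<in> borel_measurable (lebesgue_on \<Omega>)" "AE x in lebesgue_on \<Omega>. norm (\<beta> x) \<le> L"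
    and ac: "0 \<le> a" "a < c"
    and R: "\<And>h. h = (\<lambda>x. indicator {x\<in>\<Omega>. a < m x \<and> m x \<le> c} x *\<^sub>R g x) \<Longrightarrow>
      (LINT x|lebesgue_on \<Omega>. \<nu> * (g x \<bullet> h x) + m x * (\<beta> x \<bullet> h x)) \<le> \<gamma> * norm2 (lebesgue_on \<Omega>) h"
  shows "\<nu> * (c - a) * sqrt (measure (lebesgue_on \<Omega>) {x\<in>\<Omega>. c < m x})
    \<le> C * (\<gamma> + L * c * sqrt (measure (lebesgue_on \<Omega>) {x\<in>\<Omega>. a < m x \<and> m x \<le> c}))"
proof -
  let ?M = "lebesgue_on \<Omega>"
  interpret finite_measure ?M by (rule finite_measure_lebesgue_on_bounded_open[OF \<Omega>])
  note mL = H0grad_L2[OF m]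
  define E where "E = {x\<in>\<Omega>. a < m x \<and> m x \<le> c}"
  define h where "h x = indicator E x *\<^sub>R g x" for x
  define s where "s x = max (m x - a) 0 - max (m x - c) 0" for x
  have E: "E \<in> sets ?M" unfolding E_def by (rule sets_superlevel(3)[OF mL(1)])
  have U: "{x\<in>\<Omega>. c < m x} \<in> sets ?M" by (rule sets_superlevel(1)[OF mL(1)])
  have sh: "H0grad \<Omega> s h"
    unfolding s_def h_def E_def using H0grad_slice[OF \<Omega> m] ac by simp
  have "h = (\<lambda>x. indicator {x\<in>\<Omega>. a < m x \<and> m x \<le> c} x *\<^sub>R g x)"
    by (simp add: h_def E_def fun_eq_iff)
  then have "\<nu> * (norm2 ?M h)\<^sup>2 \<le> \<gamma> * norm2 ?M h + L * norm2 ?M (\<lambda>x. indicator E x *\<^sub>R m x) * norm2 ?M h"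
    using kfp_energy[OF mL E \<beta>, of \<nu>] R[of h] unfolding h_def by linarith
  also have "\<dots> = (\<gamma> + L * norm2 ?M (\<lambda>x. indicator E x *\<^sub>R m x)) * norm2 ?M h"
    by (simp add: algebra_simps)
  finally have "(\<nu> * norm2 ?M h) * norm2 ?M h \<le> (\<gamma> + L * norm2 ?M (\<lambda>x. indicator E x *\<^sub>R m x)) * norm2 ?M h"
    by (simp add: power2_eq_square)
  then have 1: "\<nu> * norm2 ?M h \<le> \<gamma> + L * norm2 ?M (\<lambda>x. indicator E x *\<^sub>R m x)"
    using norm2_nonneg[of ?M h] \<gamma> L by (cases "norm2 ?M h = 0") auto
  have "norm2 ?M (\<lambda>x. indicator E x *\<^sub>R m x) \<le> norm2 ?M (\<lambda>x. c *\<^sub>R indicator E x :: real)"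
    using L2_measurable[OF L2_restrict[OF mL(1) E]] ac
    by (intro norm2_mono L2_scaleR L2_indicator E AE_I2) (auto simp: E_def indicator_def)
  then have 2: "norm2 ?M (\<lambda>x. indicator E x *\<^sub>R m x) \<le> c * sqrt (measure ?M E)"
    using ac by (simp add: norm2_scaleR norm2_indicator[OF E] del: real_scaleR_def)
  have "norm2 ?M (\<lambda>x. (c - a) *\<^sub>R indicator {x\<in>\<Omega>. c < m x} x :: real) \<le> norm2 ?M s"
    using L2_measurable[OF L2_scaleR[OF L2_indicator[OF U]], of "c - a"] ac
    by (intro norm2_mono[OF H0grad_L2(1)[OF sh]] AE_I2) (auto simp: s_def indicator_def)
  then have 3: "(c - a) * sqrt (measure ?M {x\<in>\<Omega>. c < m x}) \<le> C * norm2 ?M h"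
    using ac C(2)[OF sh] by (simp add: norm2_scaleR norm2_indicator[OF U] del: real_scaleR_def)
  have "\<nu> * (c - a) * sqrt (measure ?M {x\<in>\<Omega>. c < m x}) \<le> C * (\<nu> * norm2 ?M h)"
    using mult_left_mono[OF 3, of \<nu>] \<nu> by (simp add: algebra_simps)
  also have "\<dots> \<le> C * (\<gamma> + L * (c * sqrt (measure ?M E)))"
    using 1 2 C(1) L by (intro mult_left_mono) (auto intro: order_trans add_left_mono mult_left_mono)
  finally show ?thesis by (simp add: E_def mult.assoc)
qed

text \<open>Testing with \<open>min m\<^sup>- d\<close> bounds the measure of \<open>{m\<^sup>- > d}\<close> by a fixed multiple of the measure of
  \<open>{0 < m\<^sup>- \<le> d}\<close>, which vanishes as \<open>d\<close> tends to zero.\<close>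

lemma kfp_nonneg:
  fixes \<Omega> :: "'a::euclidean_space set"
  assumes \<Omega>: "bounded \<Omega>" "open \<Omega>" and \<nu>: "0 < \<nu>" and L: "0 \<le> L" and m: "H0grad \<Omega> m g"
    and \<beta>: "\<beta> \<in> borel_measurable (lebesgue_on \<Omega>)" "AE x in lebesgue_on \<Omega>. norm (\<beta> x) \<le> L"
    and R: "\<And>\<phi> h. H0grad \<Omega> \<phi> h \<Longrightarrow> AE x in lebesgue_on \<Omega>. 0 \<le> \<phi> x \<Longrightarrow>
      0 \<le> (LINT x|lebesgue_on \<Omega>. \<nu> * (g x \<bullet> h x) + m x * (\<beta> x \<bullet> h x))"
  shows "AE x in lebesgue_on \<Omega>. 0 \<le> m x"
proof -
  let ?M = "lebesgue_on \<Omega>"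
  interpret finite_measure ?M by (rule finite_measure_lebesgue_on_bounded_open[OF \<Omega>])
  obtain C where C: "0 < C" "\<And>v g. H0grad \<Omega> v g \<Longrightarrow> norm2 ?M v \<le> C * norm2 ?M g"
    using poincare[OF \<Omega>] by blast
  note m' = H0grad_minus[OF \<Omega> m]
  note mL = H0grad_L2[OF m']
  define d where "d n = inverse (real (Suc n))" for n
  have d: "0 < d n" for n by (simp add: d_def)
  define E where "E n = {x\<in>\<Omega>. 0 < - m x \<and> - m x \<le> d n}" for n
  define U where "U n = {x\<in>\<Omega>. d n < - m x}" for n
  have E: "E n \<in> sets ?M" for n unfolding E_def by (rule sets_superlevel(3)[OF mL(1)])
  have U: "U n \<in> sets ?M" for n unfolding U_def by (rule sets_superlevel(1)[OF mL(1)])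
  \<comment> \<open>The slice estimate for \<open>- m\<close> with lower level 0 and right-hand side
    constant 0. Both sides are then proportional to \<open>d n\<close>; after cancellation the
    factor no longer depends on \<open>n\<close>.\<close>
  have bound: "\<nu> * sqrt (measure ?M (U n)) \<le> C * L * sqrt (measure ?M (E n))" for n
  proof -
    have "\<nu> * (d n - 0) * sqrt (measure ?M {x\<in>\<Omega>. d n < - m x})
        \<le> C * (0 + L * d n * sqrt (measure ?M {x\<in>\<Omega>. 0 < - m x \<and> - m x \<le> d n}))"
    proof (rule kfp_slice[OF \<Omega> less_imp_le[OF C(1)] C(2) \<nu> L _ m' \<beta>])
      fix h assume h: "h = (\<lambda>x. indicator {x\<in>\<Omega>. 0 < - m x \<and> - m x \<le> d n} x *\<^sub>R - g x)"
      have "H0grad \<Omega> (\<lambda>x. max (- m x - 0) 0 - max (- m x - d n) 0) h"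
        unfolding h using d[of n] by (intro H0grad_slice[OF \<Omega> m']) auto
      then have "0 \<le> (LINT x|?M. \<nu> * (g x \<bullet> h x) + m x * (\<beta> x \<bullet> h x))"
        using d[of n] by (intro R) auto
      also have "\<dots> = - (LINT x|?M. \<nu> * (- g x \<bullet> h x) + (- m x) * (\<beta> x \<bullet> h x))"
        by (subst Bochner_Integration.integral_minus[symmetric]) (simp add: algebra_simps)
      finally show "(LINT x|?M. \<nu> * (- g x \<bullet> h x) + (- m x) * (\<beta> x \<bullet> h x)) \<le> 0 * norm2 ?M h"
        by simp
    qed (use d in auto)
    then have "d n * (\<nu> * sqrt (measure ?M (U n))) \<le> d n * (C * L * sqrt (measure ?M (E n)))"
      by (simp add: U_def E_def algebra_simps)
    then show ?thesis using d[of n] by simp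
  qed
  have mono: "d j \<le> d i" if "i \<le> j" for i j
    using that by (simp add: d_def divide_simps)
  have "decseq E"
    unfolding decseq_def E_def using mono by (auto intro: order_trans)
  moreover have "(\<Inter>n. E n) = {}"
  proof -
    have False if "\<And>n. x \<in> E n" for x
    proof -
      have "0 < - m x" using that[of 0] by (simp add: E_def)
      then obtain n where "d n < - m x" using reals_Archimedean unfolding d_def by blast
      then show False using that[of n] by (simp add: E_def)
    qed
    then show ?thesis by blast
  qed
  ultimately have "(\<lambda>n. measure ?M (E n)) \<longlonglongrightarrow> 0"
    using finite_Lim_measure_decseq[of E] E by auto
  then have "(\<lambda>n. C * L * sqrt (measure ?M (E n))) \<longlonglongrightarrow> C * L * sqrt 0"
    by (intro tendsto_intros)
  then have lim: "(\<lambda>n. C * L * sqrt (measure ?M (E n))) \<longlonglongrightarrow> 0" by simp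
  have "measure ?M (U j) = 0" for j
  proof -
    have "\<nu> * sqrt (measure ?M (U j)) \<le> C * L * sqrt (measure ?M (E n))" if "j \<le> n" for n
    proof -
      have "U j \<subseteq> U n" using mono[OF that] by (auto simp: U_def)
      then have "\<nu> * sqrt (measure ?M (U j)) \<le> \<nu> * sqrt (measure ?M (U n))"
        using \<nu> U by (intro mult_left_mono real_sqrt_le_mono finite_measure_mono) auto
      with bound[of n] show ?thesis by linarith
    qed
    then have "\<nu> * sqrt (measure ?M (U j)) \<le> 0"
      by (intro LIMSEQ_le_const[OF lim]) auto
    then show ?thesis
      using \<nu> measure_nonneg[of ?M "U j"] by (simp add: mult_le_0_iff)
  qed
  then have "AE x in ?M. \<forall>j. x \<notin> U j"
    unfolding AE_all_countable using U by (auto intro!: AE_not_in simp: null_sets_def emeasure_eq_measure)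
  then have "AE x in ?M. x \<in> space ?M \<longrightarrow> 0 \<le> m x"
  proof eventually_elim
    case (elim x)
    show ?case
    proof (intro impI leI notI)
      assume x: "x \<in> space ?M" "m x < 0"
      then obtain j where "d j < - m x" using reals_Archimedean[of "- m x"] unfolding d_def by auto
      then show False using elim x by (auto simp: U_def)
    qed
  qed
  then show ?thesis by (rule AE_mp) (auto intro!: AE_I2)
qed

text \<open>The functional survives only through \<gamma>, so a constant obtained from this
  predicate is uniform over functionals and drifts. A one-sided bound suffices, since the negative
  of a test function is again one.\<close>

definition kfp_problem ::
    "'a::euclidean_space set \<Rightarrow> real \<Rightarrow> real \<Rightarrow> real \<Rightarrow> ('a \<Rightarrow> real) \<Rightarrow> ('a \<Rightarrow> 'a) \<Rightarrow> ('a \<Rightarrow> 'a) \<Rightarrow> bool"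
  where
  "kfp_problem \<Omega> \<nu> L \<gamma> m g \<beta> \<longleftrightarrow> H0grad \<Omega> m g \<and> \<beta> \<in> borel_measurable (lebesgue_on \<Omega>) \<and>
     (AE x in lebesgue_on \<Omega>. norm (\<beta> x) \<le> L) \<and>
     (\<forall>\<phi> h. H0grad \<Omega> \<phi> h \<longrightarrow>
       (LINT x|lebesgue_on \<Omega>. \<nu> * (g x \<bullet> h x) + m x * (\<beta> x \<bullet> h x)) \<le> \<gamma> * norm2 (lebesgue_on \<Omega>) h)"

text \<open>Testing with the slice of \<open>m\<close> between \<open>2\<^sup>j\<close> and \<open>2\<^sup>j\<^sup>+\<^sup>1\<close> and summing over \<open>j\<close> makes \<open>{m > 2\<^sup>J}\<close>
  small for some \<open>J\<close> that depends only on the data; above that level the drift can be absorbed.\<close>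

lemma kfp_integral_bound:
  fixes \<Omega> :: "'a::euclidean_space set"
  assumes \<Omega>: "bounded \<Omega>" "open \<Omega>" and \<nu>: "0 < \<nu>" and L: "0 \<le> L" and \<gamma>: "0 \<le> \<gamma>"
  obtains K where "\<And>m g \<beta>. kfp_problem \<Omega> \<nu> L \<gamma> m g \<beta> \<Longrightarrow> (LINT x|lebesgue_on \<Omega>. m x) \<le> K"
proof -
  let ?M = "lebesgue_on \<Omega>"
  interpret finite_measure ?M by (rule finite_measure_lebesgue_on_bounded_open[OF \<Omega>])
  define V where "V = measure ?M \<Omega>"
  have V: "0 \<le> V" "\<And>E. measure ?M E \<le> V"
    unfolding V_def using bounded_measure by auto
  obtain C where C: "0 < C" "\<And>v g. H0grad \<Omega> v g \<Longrightarrow> norm2 ?M v \<le> C * norm2 ?M g"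
    using poincare[OF \<Omega>] by blast
  \<comment> \<open>Chosen so that on small sets the drift consumes at most half of the
    diffusion.\<close>
  define \<eta> where "\<eta> = \<nu> / (2 * (L + 1))"
  have \<eta>: "0 < \<eta>" "L * \<eta> \<le> \<nu> / 2" using \<nu> L by (auto simp: \<eta>_def field_simps)
  obtain \<delta> where \<delta>: "0 < \<delta>"
    "\<And>v g E. H0grad \<Omega> v g \<Longrightarrow> E \<in> sets ?M \<Longrightarrow> measure ?M E \<le> \<delta> \<Longrightarrow>
       norm2 ?M (\<lambda>x. indicator E x *\<^sub>R v x) \<le> \<eta> * norm2 ?M g"
    using small_set_estimate[OF \<Omega> \<eta>(1)] by blast
  define p where "p = C * \<gamma> / \<nu>"
  define q where "q = 2 * C * L / \<nu>"
  \<comment> \<open>An upper bound for the sum of the first \<open>J\<close> superlevel measures,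
    independent of \<open>J\<close>; the geometric series of ratio 1/4 is estimated by 2. Taking
    \<open>J\<close> with \<open>D \<le> real J * \<delta>\<close> brings the last measure below
    \<delta>.\<close>
  define D where "D = 4 * p\<^sup>2 + 2 * q\<^sup>2 * V"
  obtain J0 where J0: "D / \<delta> \<le> real J0" using real_arch_simple by blast
  define J where "J = Suc J0"
  have J: "D \<le> real J * \<delta>" "0 < J"
    using J0 \<delta>(1) by (auto simp: J_def field_simps)
  define k where "k = (2::real) ^ J"
  have k: "0 \<le> k" by (simp add: k_def)
  define h0 where "h0 = 2 / \<nu> * (\<gamma> + L * (k * sqrt V))"
  show ?thesis
  proof (rule that)
    fix m g \<beta>
    assume problem: "kfp_problem \<Omega> \<nu> L \<gamma> m g \<beta>"
    then have m: "H0grad \<Omega> m g"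
      and \<beta>: "\<beta> \<in> borel_measurable ?M" "AE x in ?M. norm (\<beta> x) \<le> L"
      by (auto simp: kfp_problem_def)
    have R: "(LINT x|?M. \<nu> * (g x \<bullet> h x) + m x * (\<beta> x \<bullet> h x)) \<le> \<gamma> * norm2 ?M h" if "H0grad \<Omega> \<phi> h" for \<phi> h
      using problem that unfolding kfp_problem_def by blast
    note mL = H0grad_L2[OF m]
    define a where "a j = measure ?M {x\<in>\<Omega>. 2 ^ j < m x}" for j :: nat
    have a_dec: "a (j + 1) \<le> a j" for j
    proof -
      have "2 ^ j < m x" if "2 ^ (j + 1) < m x" for x
        by (rule le_less_trans[OF _ that]) simp
      then have "{x\<in>\<Omega>. 2 ^ (j + 1) < m x} \<subseteq> {x\<in>\<Omega>. 2 ^ j < m x}"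
        by blast
      then show ?thesis
        unfolding a_def by (intro finite_measure_mono sets_superlevel(1)[OF mL(1)])
    qed
    have a_mono: "a j \<le> a i" if "i \<le> j" for i j
      by (rule lift_Suc_antimono_le[of a, OF _ that]) (use a_dec in simp)
    \<comment> \<open>For dyadic levels the quotient of upper level and width is always 2, so the
      drift coefficient \<open>q\<close> is the same on every slice, while the contribution of
      \<gamma> decays geometrically.\<close>
    have step: "a (j + 1) \<le> 2 * p\<^sup>2 * (1/4) ^ j + 2 * q\<^sup>2 * (a j - a (j + 1))" for j
    proof -
      let ?E = "{x\<in>\<Omega>. 2 ^ j < m x \<and> m x \<le> 2 ^ (j + 1)}"
      have Em: "measure ?M ?E = a j - a (j + 1)"
      proof -
        have eq: "?E = {x\<in>\<Omega>. 2 ^ j < m x} - {x\<in>\<Omega>. 2 ^ (j + 1) < m x}" by auto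
        have "2 ^ j < m x" if "2 ^ (j + 1) < m x" for x
          by (rule le_less_trans[OF _ that]) simp
        then have sub: "{x\<in>\<Omega>. 2 ^ (j + 1) < m x} \<subseteq> {x\<in>\<Omega>. 2 ^ j < m x}"
          by blast
        show ?thesis
          unfolding eq a_def by (rule finite_measure_Diff[OF sets_superlevel(1)[OF mL(1)] sets_superlevel(1)[OF mL(1)] sub])
      qed
      have "\<nu> * (2 ^ (j + 1) - 2 ^ j) * sqrt (measure ?M {x\<in>\<Omega>. 2 ^ (j + 1) < m x})
          \<le> C * (\<gamma> + L * 2 ^ (j + 1) * sqrt (measure ?M ?E))"
      proof (rule kfp_slice[OF \<Omega> less_imp_le[OF C(1)] C(2) \<nu> L \<gamma> m \<beta>])
        fix h assume h: "h = (\<lambda>x. indicator ?E x *\<^sub>R g x)"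
        have "H0grad \<Omega> (\<lambda>x. max (m x - 2 ^ j) 0 - max (m x - 2 ^ (j + 1)) 0) h"
          unfolding h by (rule H0grad_slice[OF \<Omega> m]) auto
        then show "(LINT x|?M. \<nu> * (g x \<bullet> h x) + m x * (\<beta> x \<bullet> h x)) \<le> \<gamma> * norm2 ?M h"
          by (rule R)
      qed auto
      then have "\<nu> * 2 ^ j * sqrt (a (j + 1)) \<le> C * (\<gamma> + L * (2 * 2 ^ j) * sqrt (a j - a (j + 1)))"
        unfolding Em by (simp add: a_def algebra_simps)
      then have "sqrt (a (j + 1)) \<le> p / 2 ^ j + q * sqrt (a j - a (j + 1))"
        using \<nu> by (simp add: p_def q_def field_simps)
      then have "(sqrt (a (j + 1)))\<^sup>2 \<le> (p / 2 ^ j + q * sqrt (a j - a (j + 1)))\<^sup>2"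
        by (intro power_mono) (auto simp: a_def)
      also have "\<dots> \<le> 2 * (p / 2 ^ j)\<^sup>2 + 2 * (q * sqrt (a j - a (j + 1)))\<^sup>2"
        using sum_squares_bound[of "p / 2 ^ j" "q * sqrt (a j - a (j + 1))"] by (simp add: power2_sum)
      also have "(p / 2 ^ j)\<^sup>2 = p\<^sup>2 * (1/4) ^ j"
        by (simp add: power_divide power_mult_distrib power_mult[symmetric] mult.commute[of j] power_mult[of 2 2])
      also have "(q * sqrt (a j - a (j + 1)))\<^sup>2 = q\<^sup>2 * (a j - a (j + 1))"
        using a_dec[of j] by (simp add: power_mult_distrib)
      finally show ?thesis
        by (simp add: a_def)
    qed
    \<comment> \<open>The superlevel measures decrease, so \<open>J\<close> copies of the last are
      at most their sum; the slice measures in the bound telescope to no more than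
      \<open>V\<close>.\<close>
    have "real J * a J = (\<Sum>j<J. a J)" by simp
    also have "\<dots> \<le> (\<Sum>j<J. a (j + 1))"
      by (intro sum_mono a_mono) auto
    also have "\<dots> \<le> (\<Sum>j<J. 2 * p\<^sup>2 * (1/4) ^ j + 2 * q\<^sup>2 * (a j - a (j + 1)))"
      by (intro sum_mono step)
    also have "\<dots> = 2 * p\<^sup>2 * (\<Sum>j<J. (1/4) ^ j) + 2 * q\<^sup>2 * (\<Sum>j<J. a j - a (j + 1))"
      by (simp add: sum.distrib sum_distrib_left)
    also have "(\<Sum>j<J. a j - a (j + 1)) = a 0 - a J"
      using sum_lessThan_telescope'[of a J] by simp
    also have "2 * p\<^sup>2 * (\<Sum>j<J. (1/4) ^ j) + 2 * q\<^sup>2 * (a 0 - a J) \<le> 2 * p\<^sup>2 * 2 + 2 * q\<^sup>2 * V"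
    proof (intro add_mono mult_left_mono)
      have "(\<Sum>j<J. (1/4::real) ^ j) = (1 - (1/4) ^ J) / (1 - 1/4)"
        by (simp add: sum_gp_strict)
      also have "\<dots> \<le> 2"
      proof -
        have "(1 - t) / (1 - 1/4) \<le> 2" if "0 \<le> t" for t :: real
          using that by simp
        from this[of "(1/4) ^ J"] show ?thesis by (metis zero_le_power divide_nonneg_nonneg zero_le_numeral zero_le_one)
      qed
      finally show "(\<Sum>j<J. (1/4::real) ^ j) \<le> 2" .
      show "a 0 - a J \<le> V"
        using V(2)[of "{x\<in>\<Omega>. 2 ^ 0 < m x}"] measure_nonneg[of ?M "{x\<in>\<Omega>. 2 ^ J < m x}"] unfolding a_def by linarith
    qed auto
    also have "\<dots> \<le> real J * \<delta>" using J(1) by (simp add: D_def)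
    finally have aJ: "a J \<le> \<delta>" using J(2) by simp
    define E where "E = {x\<in>\<Omega>. k < m x}"
    define h where "h x = indicator E x *\<^sub>R g x" for x
    define s where "s x = max (m x - k) 0" for x
    have E: "E \<in> sets ?M" unfolding E_def by (rule sets_superlevel(1)[OF mL(1)])
    have sh: "H0grad \<Omega> s h"
      unfolding s_def h_def E_def by (rule H0grad_ramp_indicator[OF \<Omega> m k])
    note sL = H0grad_L2[OF sh]
    \<comment> \<open>On \<open>E\<close> the density is \<open>s x + k\<close>: the small set
      estimate handles the ramp, and the constant part is bounded by the data.\<close>
    have "norm2 ?M (\<lambda>x. indicator E x *\<^sub>R m x) = norm2 ?M (\<lambda>x. indicator E x *\<^sub>R s x + k *\<^sub>R indicator E x)"
      by (intro arg_cong[where f="norm2 ?M"]) (auto simp: E_def s_def indicator_def fun_eq_iff)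
    also have "\<dots> \<le> norm2 ?M (\<lambda>x. indicator E x *\<^sub>R s x) + norm2 ?M (\<lambda>x. k *\<^sub>R indicator E x :: real)"
      by (intro norm2_triangle L2_restrict sL L2_scaleR L2_indicator E)
    also have "norm2 ?M (\<lambda>x. k *\<^sub>R indicator E x :: real) \<le> k * sqrt V"
      using k V(2)[of E] by (simp only: norm2_scaleR norm2_indicator[OF E]) (auto intro!: mult_left_mono)
    also have "norm2 ?M (\<lambda>x. indicator E x *\<^sub>R s x) \<le> \<eta> * norm2 ?M h"
      using aJ by (intro \<delta>(2)[OF sh E]) (simp add: a_def E_def k_def)
    finally have mE: "norm2 ?M (\<lambda>x. indicator E x *\<^sub>R m x) \<le> \<eta> * norm2 ?M h + k * sqrt V" by simp
    have "\<nu> * (norm2 ?M h)\<^sup>2 \<le> \<gamma> * norm2 ?M h + L * norm2 ?M (\<lambda>x. indicator E x *\<^sub>R m x) * norm2 ?M h"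
      using kfp_energy[OF mL E \<beta>, of \<nu>] R[OF sh] unfolding h_def by linarith
    also have "\<dots> \<le> \<gamma> * norm2 ?M h + L * (\<eta> * norm2 ?M h + k * sqrt V) * norm2 ?M h"
      using mE L by (intro add_left_mono mult_right_mono mult_left_mono) auto
    also have "\<dots> = (\<gamma> + (L * \<eta>) * norm2 ?M h + L * (k * sqrt V)) * norm2 ?M h"
      by (simp add: algebra_simps)
    also have "\<dots> \<le> (\<gamma> + \<nu> / 2 * norm2 ?M h + L * (k * sqrt V)) * norm2 ?M h"
      using \<eta>(2) k V(1) by (intro mult_right_mono add_mono) auto
    finally have "(\<nu> * norm2 ?M h) * norm2 ?M h \<le> (\<gamma> + \<nu> / 2 * norm2 ?M h + L * (k * sqrt V)) * norm2 ?M h"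
      by (simp add: power2_eq_square)
    then have "\<nu> * norm2 ?M h \<le> \<gamma> + \<nu> / 2 * norm2 ?M h + L * (k * sqrt V)"
      using norm2_nonneg[of ?M h] \<gamma> L k V by (cases "norm2 ?M h = 0") auto
    then have hb: "norm2 ?M h \<le> h0"
      using \<nu> by (simp add: h0_def field_simps)
    have "(LINT x|?M. m x) \<le> (LINT x|?M. norm (s x) + k)"
      using L2_imp_integrable[OF mL(1)] L2_imp_integrable[OF sL(1)]
      by (intro integral_mono) (auto simp: s_def)
    also have "\<dots> = (LINT x|?M. norm (s x)) + k * V"
      using L2_imp_integrable[OF sL(1)] by (simp add: V_def)
    also have "\<dots> \<le> C * h0 * sqrt V + k * V"
    proof (rule add_right_mono)
      have "(LINT x|?M. norm (s x)) \<le> norm2 ?M s * sqrt V"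
        using integral_norm_le_norm2[OF sL(1)] by (simp add: V_def)
      also have "\<dots> \<le> (C * h0) * sqrt V"
        using C(2)[OF sh] mult_left_mono[OF hb less_imp_le[OF C(1)]] V(1)
        by (intro mult_right_mono) auto
      finally show "(LINT x|?M. norm (s x)) \<le> C * h0 * sqrt V" .
    qed
    finally show "(LINT x|?M. m x) \<le> C * h0 * sqrt V + k * V" .
  qed
qed

section \<open>The linearized Hamilton--Jacobi--Bellman equation\<close>

text \<open>Here \<open>q\<close> stands for the difference of the Hamiltonians at the two gradients, of which only the
  Lipschitz bound matters.\<close>

definition hjb_problem ::
    "'a::euclidean_space set \<Rightarrow> real \<Rightarrow> real \<Rightarrow> ('a \<Rightarrow> real) \<Rightarrow> ('a \<Rightarrow> 'a) \<Rightarrow> ('a \<Rightarrow> real) \<Rightarrow> real \<Rightarrow> bool"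
  where
  "hjb_problem \<Omega> \<nu> L w g q r \<longleftrightarrow> H0grad \<Omega> w g \<and> q \<in> borel_measurable (lebesgue_on \<Omega>) \<and>
     (AE x in lebesgue_on \<Omega>. \<bar>q x\<bar> \<le> L * norm (g x)) \<and> 0 \<le> r \<and>
     (\<forall>\<psi> h. H0grad \<Omega> \<psi> h \<longrightarrow>
       \<bar>LINT x|lebesgue_on \<Omega>. \<nu> * (g x \<bullet> h x) + q x * \<psi> x\<bar> \<le> r * norm2 (lebesgue_on \<Omega>) h)"

text \<open>The zero-order factor is \<open>s\<close>, which does not vanish above a slice. The
  drift integral therefore keeps the full gradient \<open>g\<close> and not just its restriction
  \<open>h\<close>; this coupling to higher levels is what the later induction has to
  resolve.\<close>

lemma hjb_energy:
  assumes w: "hjb_problem \<Omega> \<nu> L w g q r" and L: "0 \<le> L" and s: "H0grad \<Omega> s h"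
    and gh: "AE x in lebesgue_on \<Omega>. g x \<bullet> h x = (norm (h x))\<^sup>2"
  shows "\<nu> * (norm2 (lebesgue_on \<Omega>) h)\<^sup>2
    \<le> r * norm2 (lebesgue_on \<Omega>) h + L * (LINT x|lebesgue_on \<Omega>. norm (g x) * norm (s x))"
proof -
  let ?M = "lebesgue_on \<Omega>"
  note wD = w[unfolded hjb_problem_def]
  have gL: "g \<in> L2 ?M" using wD by (blast dest: H0grad_L2)
  note sL = H0grad_L2[OF s]
  have q: "q \<in> L2 ?M"
    using wD L by (intro L2_dominated[OF L2_scaleR[OF gL, of L]]) auto
  have "(LINT x|?M. g x \<bullet> h x) = (LINT x|?M. (norm (h x))\<^sup>2)"
    using gh gL sL(2) by (intro integral_cong_AE) (auto simp: L2_def)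
  then have "\<nu> * (norm2 ?M h)\<^sup>2 + (LINT x|?M. q x * s x) = (LINT x|?M. \<nu> * (g x \<bullet> h x) + q x * s x)"
    using integrable_inner_L2[OF gL sL(2)] integrable_mult_L2[OF q sL(1)] by (simp add: norm2_power2)
  also have "\<dots> \<le> r * norm2 ?M h"
    using wD s by (meson abs_le_D1)
  finally have "\<nu> * (norm2 ?M h)\<^sup>2 \<le> r * norm2 ?M h - (LINT x|?M. q x * s x)" by simp
  moreover have "- (LINT x|?M. q x * s x) \<le> L * (LINT x|?M. norm (g x) * norm (s x))"
  proof -
    have "- (LINT x|?M. q x * s x) \<le> \<bar>LINT x|?M. q x * s x\<bar>" by simp
    also have "\<dots> \<le> (LINT x|?M. \<bar>q x * s x\<bar>)"
      using integral_norm_bound[of ?M "\<lambda>x. q x * s x"] by simp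
    also have "\<dots> \<le> (LINT x|?M. L * (norm (g x) * norm (s x)))"
    proof (rule integral_mono_AE)
      show "AE x in ?M. \<bar>q x * s x\<bar> \<le> L * (norm (g x) * norm (s x))"
        using wD by (auto simp: abs_mult mult.assoc[symmetric] elim!: eventually_mono intro!: mult_right_mono)
    qed (use integrable_mult_L2[OF q sL(1)] integrable_norm_mult[OF gL sL(1)] in auto)
    finally show ?thesis by simp
  qed
  ultimately show ?thesis by linarith
qed

lemma cancel_energy:
  fixes n :: real
  assumes "\<nu> * n\<^sup>2 \<le> B * n + \<nu> / 2 * n\<^sup>2" "0 \<le> n" "0 < \<nu>" "0 \<le> B"
  shows "n \<le> 2 / \<nu> * B"
proof (cases "n = 0")
  case False
  have "(\<nu> / 2 * n) * n \<le> B * n" using assms(1) by (simp add: power2_eq_square algebra_simps)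
  then have "\<nu> / 2 * n \<le> B" using False assms(2) by simp
  then show ?thesis using assms(3) by (simp add: field_simps)
qed (use assms in auto)

section \<open>Cutting superlevel sets into pieces of prescribed measure\<close>

context finite_measure
begin

lemma superlevel_measure_tendsto_0:
  fixes w :: "'a \<Rightarrow> real"
  assumes w: "w \<in> borel_measurable M" and \<epsilon>: "0 < \<epsilon>"
  shows "\<exists>t\<ge>k. measure M {x\<in>space M. t < w x} \<le> \<epsilon>"
proof -
  define A where "A n = {x\<in>space M. k + real n < w x}" for n
  have A: "range A \<subseteq> sets M" using w unfolding A_def by auto
  have "decseq A" by (auto simp: decseq_def A_def)
  moreover have "(\<Inter>n. A n) = {}"
  proof -
    have False if "\<And>n. x \<in> A n" for x
    proof -
      obtain n where "w x - k \<le> real n" using real_arch_simple by blast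
      then show False using that[of n] by (simp add: A_def)
    qed
    then show ?thesis by blast
  qed
  ultimately have "(\<lambda>n. measure M (A n)) \<longlonglongrightarrow> 0"
    using finite_Lim_measure_decseq[OF A] by simp
  then have "\<forall>\<^sub>F n in sequentially. measure M (A n) < \<epsilon>"
    using \<epsilon> by (rule order_tendstoD)
  then obtain n where "measure M (A n) < \<epsilon>"
    using eventually_happens'[OF sequentially_bot] by blast
  then show ?thesis by (intro exI[of _ "k + real n"]) (auto simp: A_def)
qed

text \<open>\<open>k'\<close> is the least level above \<open>k\<close> whose strict superlevel set
  has measure at most \<open>a\<close>; right-continuity of the distribution function makes the
  infimum attained. A level set at \<open>k'\<close> of large measure belongs to neither part, so
  the slice has to be open at the top.\<close>

lemma superlevel_split:
  fixes w :: "'a \<Rightarrow> real"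
  assumes w: "w \<in> borel_measurable M" and a: "0 < a" "0 \<le> b"
    and k: "measure M {x\<in>space M. k < w x} \<le> a + b"
  obtains k' where "k \<le> k'" "measure M {x\<in>space M. k' < w x} \<le> a"
    "measure M {x\<in>space M. k < w x \<and> w x < k'} \<le> b"
proof -
  define \<mu> where "\<mu> t = measure M {x\<in>space M. t < w x}" for t
  have meas [measurable]: "{x\<in>space M. t < w x} \<in> sets M" for t using w by measurable
  have anti: "\<mu> t \<le> \<mu> s" if "s \<le> t" for s t
    unfolding \<mu>_def using that by (intro finite_measure_mono meas) auto
  define S where "S = {t. k \<le> t \<and> \<mu> t \<le> a}"
  have ne: "S \<noteq> {}"
    using superlevel_measure_tendsto_0[OF w a(1), of k] by (auto simp: S_def \<mu>_def)
  have bdd: "bdd_below S" by (auto simp: S_def intro: bdd_belowI[of _ k])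
  define k' where "k' = Inf S"
  have kk': "k \<le> k'" unfolding k'_def using ne by (intro cInf_greatest) (auto simp: S_def)
  have right: "\<mu> t \<le> a" if t: "k' < t" for t
  proof -
    obtain s where "s \<in> S" "s < t"
      using cInf_lessD[OF ne, of t] t by (auto simp: k'_def)
    then show ?thesis using anti[of s t] by (simp add: S_def)
  qed
  \<comment> \<open>Below the infimum more than \<open>a\<close> of the available
    \<open>a + b\<close> lies above \<open>t\<close>, which leaves at most \<open>b\<close> for the
    slice from \<open>k\<close> to \<open>t\<close>.\<close>
  have left: "a < \<mu> t" if "k \<le> t" "t < k'" for t
    using that cInf_lower[OF _ bdd, of t] by (force simp: S_def k'_def)
  have 1: "\<mu> k' \<le> a"
  proof -
    define A where "A n = {x\<in>space M. k' + inverse (real (Suc n)) < w x}" for n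
    have "incseq A"
    proof (rule monoI, rule subsetI)
      fix i j :: nat and x assume ij: "i \<le> j" "x \<in> A i"
      have "inverse (real (Suc j)) \<le> inverse (real (Suc i))"
        using ij(1) by (intro le_imp_inverse_le) auto
      moreover have "x \<in> space M" "k' + inverse (real (Suc i)) < w x"
        using ij(2) by (auto simp: A_def)
      ultimately have "x \<in> space M" "k' + inverse (real (Suc j)) < w x"
        by linarith+
      then show "x \<in> A j" by (simp add: A_def)
    qed
    moreover have "(\<Union>n. A n) = {x\<in>space M. k' < w x}"
    proof (intro equalityI subsetI)
      fix x assume x: "x \<in> {x\<in>space M. k' < w x}"
      then obtain n where "inverse (real (Suc n)) < w x - k'"
        using reals_Archimedean[of "w x - k'"] by auto
      then show "x \<in> (\<Union>n. A n)" using x by (auto simp: A_def intro!: exI[of _ n])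
    next
      fix x assume "x \<in> (\<Union>n. A n)"
      then obtain n where "x \<in> space M" "k' + inverse (real (Suc n)) < w x" by (auto simp: A_def)
      moreover have "0 < inverse (real (Suc n))" by simp
      ultimately have "x \<in> space M" "k' < w x" by linarith+
      then show "x \<in> {x\<in>space M. k' < w x}" by simp
    qed
    moreover have "range A \<subseteq> sets M" using meas unfolding A_def by blast
    ultimately have "(\<lambda>n. measure M (A n)) \<longlonglongrightarrow> \<mu> k'"
      using finite_Lim_measure_incseq[of A] by (simp add: \<mu>_def)
    moreover have "measure M (A n) \<le> a" for n
      using right[of "k' + inverse (real (Suc n))"] by (simp add: A_def \<mu>_def)
    ultimately show ?thesis by (intro LIMSEQ_le_const2) auto
  qed
  have 2: "measure M {x\<in>space M. k < w x \<and> w x < k'} \<le> b"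
  proof (cases "k < k'")
    case True
    \<comment> \<open>Levels rising from \<open>k\<close> strictly to \<open>k'\<close>; the slices
      ending at them exhaust the open slice.\<close>
    define t where "t n = k' - (k' - k) * inverse (real (Suc n))" for n
    have inv: "0 < inverse (real (Suc n))" "inverse (real (Suc n)) \<le> 1" for n by (auto simp: divide_simps)
    have t: "k \<le> t n" "t n < k'" for n
    proof -
      define c where "c = inverse (real (Suc n))"
      have c: "0 < c" "c \<le> 1" using inv[of n] by (simp_all only: c_def)
      have "(k' - k) * c \<le> (k' - k) * 1" "0 < (k' - k) * c"
        using True c by (auto intro!: mult_left_mono mult_pos_pos)
      then show "k \<le> t n" "t n < k'" unfolding t_def c_def[symmetric] by auto
    qed
    define A where "A n = {x\<in>space M. k < w x \<and> w x \<le> t n}" for n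
    have A: "A n \<in> sets M" for n unfolding A_def using w by measurable
    have "measure M (A n) \<le> b" for n
    proof -
      have eq: "A n = {x\<in>space M. k < w x} - {x\<in>space M. t n < w x}" by (auto simp: A_def)
      have sub: "{x\<in>space M. t n < w x} \<subseteq> {x\<in>space M. k < w x}" using t(1)[of n] by auto
      have "measure M (A n) = \<mu> k - \<mu> (t n)"
        unfolding \<mu>_def eq by (rule finite_measure_Diff[OF meas meas sub])
      then show ?thesis using left[OF t, of n] k by (simp add: \<mu>_def)
    qed
    moreover have "(\<lambda>n. measure M (A n)) \<longlonglongrightarrow> measure M {x\<in>space M. k < w x \<and> w x < k'}"
    proof -
      have "incseq A"
      proof (rule monoI, rule subsetI)
        fix i j :: nat and x assume "i \<le> j" "x \<in> A i"
        moreover from this have "(k' - k) * inverse (real (Suc j)) \<le> (k' - k) * inverse (real (Suc i))"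
          using True by (intro mult_left_mono le_imp_inverse_le) auto
        ultimately show "x \<in> A j" by (simp add: A_def t_def)
      qed
      moreover have "(\<Union>n. A n) = {x\<in>space M. k < w x \<and> w x < k'}"
      proof (intro equalityI subsetI)
        fix x assume x: "x \<in> {x\<in>space M. k < w x \<and> w x < k'}"
        then obtain n where "inverse (real (Suc n)) < (k' - w x) / (k' - k)"
          using reals_Archimedean[of "(k' - w x) / (k' - k)"] True by auto
        then have "w x \<le> t n"
          using True by (simp add: t_def pos_less_divide_eq mult.commute del: of_nat_Suc)
        then show "x \<in> (\<Union>n. A n)" using x by (auto simp: A_def)
      qed (use t in \<open>auto simp: A_def intro: le_less_trans\<close>)
      ultimately show ?thesis
        using finite_Lim_measure_incseq[of A] A by force
    qed
    ultimately show ?thesis by (intro LIMSEQ_le_const2) auto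
  next
    case False
    then have empty: "{x\<in>space M. k < w x \<and> w x < k'} = {}" by auto
    show ?thesis unfolding empty using a(2) by simp
  qed
  show ?thesis using kk' 1 2 unfolding \<mu>_def by (rule that)
qed

end

text \<open>Downward induction over levels: each step lowers the level so that the open slice of \<open>w\<close> has measure at
  most \<open>\<delta>\<close>, where the drift is absorbed by the small set estimate; the gradient vanishes on the
  level sets, which may have positive measure.\<close>

lemma hjb_superlevel_estimate:
  fixes \<Omega> :: "'a::euclidean_space set"
  assumes \<Omega>: "bounded \<Omega>" "open \<Omega>" and \<nu>: "0 < \<nu>" and L: "0 \<le> L"
    and C: "0 < C" "\<And>v g. H0grad \<Omega> v g \<Longrightarrow> norm2 (lebesgue_on \<Omega>) v \<le> C * norm2 (lebesgue_on \<Omega>) g"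
    and \<delta>: "0 < \<delta>" and \<eta>: "0 \<le> \<eta>" "L * \<eta> \<le> \<nu> / 2"
      "\<And>v g E. H0grad \<Omega> v g \<Longrightarrow> E \<in> sets (lebesgue_on \<Omega>) \<Longrightarrow> measure (lebesgue_on \<Omega>) E \<le> \<delta> \<Longrightarrow>
       norm2 (lebesgue_on \<Omega>) (\<lambda>x. indicator E x *\<^sub>R v x) \<le> \<eta> * norm2 (lebesgue_on \<Omega>) g"
  shows "\<exists>B\<ge>0. \<forall>w g q r k. hjb_problem \<Omega> \<nu> L w g q r \<and> 0 \<le> k \<and>
      measure (lebesgue_on \<Omega>) {x\<in>\<Omega>. k < w x} \<le> real (Suc n) * \<delta> \<longrightarrow>
      norm2 (lebesgue_on \<Omega>) (\<lambda>x. indicator {x\<in>\<Omega>. k < w x} x *\<^sub>R g x) \<le> B * r"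
proof (induction n)
  case 0
  let ?M = "lebesgue_on \<Omega>"
  interpret finite_measure ?M by (rule finite_measure_lebesgue_on_bounded_open[OF \<Omega>])
  show ?case
  proof (intro exI[of _ "2 / \<nu>"] conjI allI impI, use \<nu> in simp, elim conjE)
    fix w g q r and k :: real
    assume w: "hjb_problem \<Omega> \<nu> L w g q r" and k: "0 \<le> k" "measure ?M {x\<in>\<Omega>. k < w x} \<le> real (Suc 0) * \<delta>"
    have wg: "H0grad \<Omega> w g" and r: "0 \<le> r" using w by (auto simp: hjb_problem_def)
    define E where "E = {x\<in>\<Omega>. k < w x}"
    define h where "h x = indicator E x *\<^sub>R g x" for x
    define s where "s x = max (w x - k) 0" for x
    have E: "E \<in> sets ?M" unfolding E_def by (rule sets_superlevel(1)[OF H0grad_L2(1)[OF wg]])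
    have sh: "H0grad \<Omega> s h" unfolding s_def h_def E_def by (rule H0grad_ramp_indicator[OF \<Omega> wg k(1)])
    note sL = H0grad_L2[OF sh]
    have energy: "\<nu> * (norm2 ?M h)\<^sup>2 \<le> r * norm2 ?M h + L * (LINT x|?M. norm (g x) * norm (s x))"
      by (rule hjb_energy[OF w L sh]) (auto simp: h_def indicator_def power2_norm_eq_inner)
    have "(LINT x|?M. norm (g x) * norm (s x)) = (LINT x|?M. norm (h x) * norm (indicator E x *\<^sub>R s x))"
      by (intro Bochner_Integration.integral_cong) (auto simp: h_def s_def E_def indicator_def)
    also have "\<dots> \<le> norm2 ?M h * norm2 ?M (\<lambda>x. indicator E x *\<^sub>R s x)"
      by (intro integral_norm_mult_le sL L2_restrict E)
    also have "\<dots> \<le> norm2 ?M h * (\<eta> * norm2 ?M h)"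
      using k(2) by (intro mult_left_mono \<eta>(3)[OF sh E]) (auto simp: E_def)
    finally have "L * (LINT x|?M. norm (g x) * norm (s x)) \<le> L * (norm2 ?M h * (\<eta> * norm2 ?M h))"
      using L by (rule mult_left_mono)
    with energy have "\<nu> * (norm2 ?M h)\<^sup>2 \<le> r * norm2 ?M h + (L * \<eta>) * (norm2 ?M h)\<^sup>2"
      by (simp add: power2_eq_square algebra_simps)
    also have "\<dots> \<le> r * norm2 ?M h + \<nu> / 2 * (norm2 ?M h)\<^sup>2"
      using \<eta>(2) by (intro add_left_mono mult_right_mono) auto
    finally have "norm2 ?M h \<le> 2 / \<nu> * r"
      by (rule cancel_energy) (use \<nu> r in auto)
    then show "norm2 ?M (\<lambda>x. indicator {x\<in>\<Omega>. k < w x} x *\<^sub>R g x) \<le> 2 / \<nu> * r"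
      unfolding h_def[abs_def] E_def .
  qed
next
  case (Suc n)
  let ?M = "lebesgue_on \<Omega>"
  interpret finite_measure ?M by (rule finite_measure_lebesgue_on_bounded_open[OF \<Omega>])
  obtain B where B: "0 \<le> B" and IH: "\<And>w g q r k. hjb_problem \<Omega> \<nu> L w g q r \<Longrightarrow> 0 \<le> k \<Longrightarrow>
      measure ?M {x\<in>\<Omega>. k < w x} \<le> real (Suc n) * \<delta> \<Longrightarrow>
      norm2 ?M (\<lambda>x. indicator {x\<in>\<Omega>. k < w x} x *\<^sub>R g x) \<le> B * r"
    using Suc.IH by blast
  \<comment> \<open>The old constant accounts for the part above \<open>k'\<close>. The slice adds
    \<open>2 / \<nu>\<close> times the source, enlarged by the drift acting above \<open>k'\<close>,
    where the gradient is at most \<open>B * r\<close> and \<open>s\<close> is controlled by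
    Poincare.\<close>
  define B' where "B' = B + 2 / \<nu> * (1 + L * B * C)"
  show ?case
  proof (intro exI[of _ B'] conjI allI impI, use B \<nu> L C in \<open>simp add: B'_def\<close>, elim conjE)
    fix w g q r and k :: real
    assume w: "hjb_problem \<Omega> \<nu> L w g q r" and k: "0 \<le> k" "measure ?M {x\<in>\<Omega>. k < w x} \<le> real (Suc (Suc n)) * \<delta>"
    have wg: "H0grad \<Omega> w g" and r: "0 \<le> r" using w by (auto simp: hjb_problem_def)
    note wL = H0grad_L2[OF wg]
    obtain k' where k': "k \<le> k'" "measure ?M {x\<in>\<Omega>. k' < w x} \<le> real (Suc n) * \<delta>"
        "measure ?M {x\<in>\<Omega>. k < w x \<and> w x < k'} \<le> \<delta>"
    proof -
      have "measure ?M {x\<in>space ?M. k < w x} \<le> real (Suc n) * \<delta> + \<delta>"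
        using k(2) by (simp add: algebra_simps)
      from superlevel_split[OF L2_measurable[OF wL(1)] _ _ this] \<delta> show ?thesis
        using that by auto
    qed
    define F where "F = {x\<in>\<Omega>. k < w x \<and> w x \<le> k'}"
    define E where "E = {x\<in>\<Omega>. k < w x \<and> w x < k'}"
    define U where "U = {x\<in>\<Omega>. k' < w x}"
    define h where "h x = indicator F x *\<^sub>R g x" for x
    define g' where "g' x = indicator U x *\<^sub>R g x" for x
    define s where "s x = max (w x - k) 0 - max (w x - k') 0" for x
    have E: "E \<in> sets ?M" unfolding E_def by (rule sets_superlevel(4)[OF wL(1)])
    have U: "U \<in> sets ?M" unfolding U_def by (rule sets_superlevel(1)[OF wL(1)])
    have g'L: "g' \<in> L2 ?M" unfolding g'_def by (rule L2_restrict[OF wL(2) U])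
    have sh: "H0grad \<Omega> s h" unfolding s_def h_def F_def by (rule H0grad_slice[OF \<Omega> wg k(1) k'(1)])
    note sL = H0grad_L2[OF sh]
    have g'_le: "norm2 ?M g' \<le> B * r"
      unfolding g'_def U_def using k(1) k'(1) by (intro IH[OF w _ k'(2)]) auto
    \<comment> \<open>Closes the gap between the open slice \<open>E\<close>, whose measure is
      controlled, and \<open>F\<close>, which contains the level set of \<open>k'\<close>. If
      \<open>k = k'\<close>, the premises contradict each other.\<close>
    have level: "AE x in ?M. k < w x \<longrightarrow> w x = k' \<longrightarrow> g x = 0"
    proof (cases "k = k'")
      case False
      then have "0 < k'" using k k' by linarith
      from gradient_zero_on_level_set[OF \<Omega> wg this] show ?thesis by eventually_elim auto
    qed auto
    have energy: "\<nu> * (norm2 ?M h)\<^sup>2 \<le> r * norm2 ?M h + L * (LINT x|?M. norm (g x) * norm (s x))"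
      by (rule hjb_energy[OF w L sh]) (auto simp: h_def indicator_def power2_norm_eq_inner)
    \<comment> \<open>At or below \<open>k\<close> the factor \<open>s\<close> is zero, on
      \<open>E\<close> the gradient is \<open>h\<close>, on the level set of \<open>k'\<close> it
      vanishes, and above \<open>k'\<close> it is \<open>g'\<close>, already bounded by the
      induction hypothesis.\<close>
    have "(LINT x|?M. norm (g x) * norm (s x))
        \<le> (LINT x|?M. norm (h x) * norm (indicator E x *\<^sub>R s x) + norm (g' x) * norm (s x))"
    proof (rule integral_mono_AE)
      have "AE x in ?M. x \<in> space ?M" by (rule AE_space)
      with level show "AE x in ?M. norm (g x) * norm (s x)
          \<le> norm (h x) * norm (indicator E x *\<^sub>R s x) + norm (g' x) * norm (s x)"
      proof eventually_elim
        case (elim x)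
        consider "w x \<le> k" | "x \<in> E" | "k < w x" "w x = k'" | "x \<in> U"
          using elim by (force simp: E_def U_def)
        then show ?case
        proof cases
          case 1
          then show ?thesis using k'(1) by (simp add: s_def)
        next
          case 2
          then have "x \<in> F" by (auto simp: E_def F_def)
          then show ?thesis using 2 by (simp add: h_def)
        next
          case 3
          then show ?thesis using elim by simp
        next
          case 4
          then show ?thesis by (simp add: g'_def)
        qed
      qed
    qed (intro integrable_norm_mult Bochner_Integration.integrable_add wL sL g'L L2_restrict E)+
    also have "\<dots> = (LINT x|?M. norm (h x) * norm (indicator E x *\<^sub>R s x)) + (LINT x|?M. norm (g' x) * norm (s x))"
      by (intro Bochner_Integration.integral_add integrable_norm_mult sL g'L L2_restrict E)
    also have "\<dots> \<le> norm2 ?M h * norm2 ?M (\<lambda>x. indicator E x *\<^sub>R s x) + norm2 ?M g' * norm2 ?M s"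
      by (intro add_mono integral_norm_mult_le sL g'L L2_restrict E)
    also have "\<dots> \<le> norm2 ?M h * (\<eta> * norm2 ?M h) + (B * r) * (C * norm2 ?M h)"
      using k'(3) g'_le C B r by (intro add_mono mult_mono \<eta>(3)[OF sh E] C(2)[OF sh]) (auto simp: E_def)
    finally have "L * (LINT x|?M. norm (g x) * norm (s x))
        \<le> L * (norm2 ?M h * (\<eta> * norm2 ?M h) + (B * r) * (C * norm2 ?M h))"
      using L by (rule mult_left_mono)
    with energy have "\<nu> * (norm2 ?M h)\<^sup>2 \<le> r * norm2 ?M h
        + L * (norm2 ?M h * (\<eta> * norm2 ?M h) + (B * r) * (C * norm2 ?M h))"
      by linarith
    also have "\<dots> = ((1 + L * B * C) * r) * norm2 ?M h + (L * \<eta>) * (norm2 ?M h)\<^sup>2"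
      by (simp add: power2_eq_square algebra_simps)
    also have "\<dots> \<le> ((1 + L * B * C) * r) * norm2 ?M h + \<nu> / 2 * (norm2 ?M h)\<^sup>2"
      using \<eta>(2) by (intro add_left_mono mult_right_mono) auto
    finally have h_le: "norm2 ?M h \<le> 2 / \<nu> * ((1 + L * B * C) * r)"
      by (rule cancel_energy) (use \<nu> L B C r in auto)
    have "norm2 ?M (\<lambda>x. indicator {x\<in>\<Omega>. k < w x} x *\<^sub>R g x) = norm2 ?M (\<lambda>x. h x + g' x)"
      using k'(1) by (intro arg_cong[where f="norm2 ?M"]) (auto simp: h_def g'_def F_def U_def indicator_def fun_eq_iff)
    also have "\<dots> \<le> norm2 ?M h + norm2 ?M g'"
      by (rule norm2_triangle[OF sL(2) g'L])
    also have "\<dots> \<le> 2 / \<nu> * ((1 + L * B * C) * r) + B * r"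
      using h_le g'_le by (rule add_mono)
    also have "\<dots> = B' * r" by (simp add: B'_def algebra_simps)
    finally show "norm2 ?M (\<lambda>x. indicator {x\<in>\<Omega>. k < w x} x *\<^sub>R g x) \<le> B' * r" .
  qed
qed

lemma hjb_problem_minus:
  assumes \<Omega>: "bounded \<Omega>" "open \<Omega>" and w: "hjb_problem \<Omega> \<nu> L w g q r"
  shows "hjb_problem \<Omega> \<nu> L (\<lambda>x. - w x) (\<lambda>x. - g x) (\<lambda>x. - q x) r"
proof -
  have "\<bar>LINT x|lebesgue_on \<Omega>. \<nu> * (- g x \<bullet> h x) + - q x * \<psi> x\<bar> \<le> r * norm2 (lebesgue_on \<Omega>) h"
    if "H0grad \<Omega> \<psi> h" for \<psi> h
  proof -
    have "(LINT x|lebesgue_on \<Omega>. \<nu> * (- g x \<bullet> h x) + - q x * \<psi> x)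
        = - (LINT x|lebesgue_on \<Omega>. \<nu> * (g x \<bullet> h x) + q x * \<psi> x)"
      by (subst Bochner_Integration.integral_minus[symmetric]) (simp add: algebra_simps)
    then show ?thesis using w that by (simp add: hjb_problem_def)
  qed
  then show ?thesis
    using w H0grad_minus[OF \<Omega>] by (auto simp: hjb_problem_def)
qed

text \<open>Enough steps of size \<delta> cover the measure of \<Omega>, so the induction reaches
  level 0. Applied to \<open>w\<close> and \<open>- w\<close> it bounds the gradients of both parts,
  hence the factor 2.\<close>

lemma hjb_estimate:
  fixes \<Omega> :: "'a::euclidean_space set"
  assumes \<Omega>: "bounded \<Omega>" "open \<Omega>" and \<nu>: "0 < \<nu>" and L: "0 \<le> L"
  obtains K where "0 \<le> K" "\<And>w g q r. hjb_problem \<Omega> \<nu> L w g q r \<Longrightarrow> norm2 (lebesgue_on \<Omega>) g \<le> K * r"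
proof -
  let ?M = "lebesgue_on \<Omega>"
  interpret finite_measure ?M by (rule finite_measure_lebesgue_on_bounded_open[OF \<Omega>])
  obtain C where C: "0 < C" "\<And>v g. H0grad \<Omega> v g \<Longrightarrow> norm2 ?M v \<le> C * norm2 ?M g"
    using poincare[OF \<Omega>] by blast
  define \<eta> where "\<eta> = \<nu> / (2 * (L + 1))"
  have \<eta>: "0 < \<eta>" "L * \<eta> \<le> \<nu> / 2" using \<nu> L by (auto simp: \<eta>_def field_simps)
  obtain \<delta> where \<delta>: "0 < \<delta>"
    "\<And>v g E. H0grad \<Omega> v g \<Longrightarrow> E \<in> sets ?M \<Longrightarrow> measure ?M E \<le> \<delta> \<Longrightarrow>
       norm2 ?M (\<lambda>x. indicator E x *\<^sub>R v x) \<le> \<eta> * norm2 ?M g"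
    using small_set_estimate[OF \<Omega> \<eta>(1)] by blast
  obtain n where n: "measure ?M \<Omega> / \<delta> \<le> real n" using real_arch_simple by blast
  have n': "measure ?M E \<le> real (Suc n) * \<delta>" for E
  proof -
    have "measure ?M E \<le> measure ?M \<Omega>" using bounded_measure by simp
    also have "\<dots> \<le> real n * \<delta>" using n \<delta>(1) by (simp add: field_simps)
    finally show ?thesis using \<delta>(1) by (simp add: algebra_simps)
  qed
  obtain B where B0: "0 \<le> B" and B1: "\<forall>w g q r k. hjb_problem \<Omega> \<nu> L w g q r \<and> 0 \<le> k \<and>
      measure ?M {x\<in>\<Omega>. k < w x} \<le> real (Suc n) * \<delta> \<longrightarrow>
      norm2 ?M (\<lambda>x. indicator {x\<in>\<Omega>. k < w x} x *\<^sub>R g x) \<le> B * r"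
    using hjb_superlevel_estimate[OF \<Omega> \<nu> L C \<delta>(1) less_imp_le[OF \<eta>(1)] \<eta>(2) \<delta>(2), of n] by blast
  have B: "norm2 ?M (\<lambda>x. indicator {x\<in>\<Omega>. 0 < w x} x *\<^sub>R g x) \<le> B * r"
    if "hjb_problem \<Omega> \<nu> L w g q r" for w g q r
    using B1 n' that by blast
  show ?thesis
  proof (rule that[of "2 * B"])
    fix w g q r assume w: "hjb_problem \<Omega> \<nu> L w g q r"
    note w' = hjb_problem_minus[OF \<Omega> w]
    have wg: "H0grad \<Omega> w g" and wg': "H0grad \<Omega> (\<lambda>x. - w x) (\<lambda>x. - g x)"
      using w w' by (auto simp: hjb_problem_def)
    define p where "p x = indicator {x\<in>\<Omega>. 0 < w x} x *\<^sub>R g x" for x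
    define n where "n x = indicator {x\<in>\<Omega>. 0 < - w x} x *\<^sub>R - g x" for x
    have P: "H0grad \<Omega> (\<lambda>x. max (w x - 0) 0) p" and N: "H0grad \<Omega> (\<lambda>x. max (- w x - 0) 0) n"
      unfolding p_def n_def
      using H0grad_ramp_indicator[OF \<Omega> wg, of 0] H0grad_ramp_indicator[OF \<Omega> wg', of 0] by simp_all
    \<comment> \<open>Reassembling the positive and negative parts and using uniqueness of the
      gradient identifies \<open>g\<close> with \<open>p x - n x\<close> also on the set where
      \<open>w\<close> is zero.\<close>
    have "H0grad \<Omega> (\<lambda>x. 1 * max (w x - 0) 0 + (-1) * max (- w x - 0) 0) (\<lambda>x. 1 *\<^sub>R p x + (-1) *\<^sub>R n x)"
      by (rule H0grad_lincomb[OF \<Omega> P N])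
    moreover have "(\<lambda>x. 1 * max (w x - 0) 0 + (-1) * max (- w x - 0) 0) = w"
      by (auto simp: fun_eq_iff max_def)
    ultimately have "H0grad \<Omega> w (\<lambda>x. p x - n x)" by simp
    from H0grad_gradient_unique[OF \<Omega> wg this] have ae: "AE x in ?M. g x = p x - n x" .
    note L2s = H0grad_L2(2)[OF P] H0grad_L2(2)[OF N] H0grad_L2(2)[OF wg]
    have "norm2 ?M g = norm2 ?M (\<lambda>x. p x + - n x)"
      using ae L2s by (intro norm2_cong_AE) (auto simp: L2_def elim!: eventually_mono)
    also have "\<dots> \<le> norm2 ?M p + norm2 ?M n"
      using norm2_triangle[OF L2s(1) L2_minus[OF L2s(2)]] by (simp add: norm2_minus)
    also have "\<dots> \<le> B * r + B * r"
      using B[OF w] B[OF w'] unfolding p_def[abs_def] n_def[abs_def] by (rule add_mono)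
    finally show "norm2 ?M g \<le> 2 * B * r" by simp
  qed (use B0 in simp)
qed

section \<open>Functionals, Hamiltonians and weak formulations\<close>

lemma H1_norm_H0grad:
  assumes \<Omega>: "bounded \<Omega>" "open \<Omega>" and v: "H0grad \<Omega> v g"
  shows "H1_norm \<Omega> v = sqrt ((norm2 (lebesgue_on \<Omega>) v)\<^sup>2 + (norm2 (lebesgue_on \<Omega>) g)\<^sup>2)"
  by (rule H1_norm_eq[OF \<Omega>(2) H0grad_has_weak_gradient[OF \<Omega> v] H0grad_L2(2)[OF v]])

lemma H1_norm_le_gradient:
  assumes \<Omega>: "bounded \<Omega>" "open \<Omega>"
    and C: "\<And>v g. H0grad \<Omega> v g \<Longrightarrow> norm2 (lebesgue_on \<Omega>) v \<le> C * norm2 (lebesgue_on \<Omega>) g"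
    and v: "H0grad \<Omega> v g"
  shows "H1_norm \<Omega> v \<le> (C + 1) * norm2 (lebesgue_on \<Omega>) g"
proof -
  have "H1_norm \<Omega> v \<le> norm2 (lebesgue_on \<Omega>) v + norm2 (lebesgue_on \<Omega>) g"
    unfolding H1_norm_H0grad[OF \<Omega> v] by (rule sqrt_sum_squares_le_sum) auto
  then show ?thesis using C[OF v] by (simp add: algebra_simps)
qed

lemma Hm1_norm_bound:
  fixes \<Omega> :: "'a::euclidean_space set"
  assumes \<Omega>: "bounded \<Omega>" "open \<Omega>" and G: "G \<in> Hm1 \<Omega>" and \<phi>: "\<phi> \<in> H10 \<Omega>"
  shows "\<bar>G \<phi>\<bar> \<le> Hm1_norm \<Omega> G * H1_norm \<Omega> \<phi>"
proof -
  obtain B where B: "\<And>\<phi>. \<phi> \<in> H10 \<Omega> \<Longrightarrow> \<bar>G \<phi>\<bar> \<le> B * H1_norm \<Omega> \<phi>"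
    using G unfolding Hm1_def by blast
  have lin: "G (\<lambda>x. s * \<phi> x + t * \<psi> x) = s * G \<phi> + t * G \<psi>" if "\<phi> \<in> H10 \<Omega>" "\<psi> \<in> H10 \<Omega>" for \<phi> \<psi> s t
    using G that by (auto simp: Hm1_def)
  have nonneg: "0 \<le> H1_norm \<Omega> \<psi>" for \<psi> by (simp add: H1_norm_def)
  define n where "n = H1_norm \<Omega> \<phi>"
  show ?thesis
  proof (cases "n = 0")
    case True
    then show ?thesis using B[OF \<phi>] by (simp add: n_def)
  next
    case False
    then have n: "0 < n" using nonneg[of \<phi>] by (simp add: n_def)
    note \<phi>g = H10_imp_H0grad[OF \<Omega> \<phi>]
    \<comment> \<open>Normalization of \<phi>, written as a linear combination to match the
      linearity clause of \<open>Hm1\<close>.\<close>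
    define \<psi> where "\<psi> = (\<lambda>x. inverse n * \<phi> x + 0 * \<phi> x)"
    have \<psi>g: "H0grad \<Omega> \<psi> (\<lambda>x. inverse n *\<^sub>R wgrad \<Omega> \<phi> x + 0 *\<^sub>R wgrad \<Omega> \<phi> x)"
      unfolding \<psi>_def by (rule H0grad_lincomb[OF \<Omega> \<phi>g \<phi>g])
    have "norm2 (lebesgue_on \<Omega>) \<psi> = inverse n * norm2 (lebesgue_on \<Omega>) \<phi>"
      using norm2_scaleR[of "lebesgue_on \<Omega>" "inverse n" \<phi>] n by (simp add: \<psi>_def)
    moreover have "norm2 (lebesgue_on \<Omega>) (\<lambda>x. inverse n *\<^sub>R wgrad \<Omega> \<phi> x + 0 *\<^sub>R wgrad \<Omega> \<phi> x)
        = inverse n * norm2 (lebesgue_on \<Omega>) (wgrad \<Omega> \<phi>)"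
      using norm2_scaleR[of "lebesgue_on \<Omega>" "inverse n" "wgrad \<Omega> \<phi>"] n by simp
    ultimately have "H1_norm \<Omega> \<psi> = inverse n * n"
      using n unfolding n_def H1_norm_H0grad[OF \<Omega> \<psi>g] H1_norm_H0grad[OF \<Omega> \<phi>g]
      by (simp add: power_mult_distrib real_sqrt_mult flip: distrib_left)
    then have "H1_norm \<Omega> \<psi> \<le> 1" using n by simp
    then have "\<psi> \<in> {\<phi> \<in> H10 \<Omega>. H1_norm \<Omega> \<phi> \<le> 1}"
      using H0grad_imp_H10(1)[OF \<Omega> \<psi>g] by simp
    \<comment> \<open>A real supremum is an upper bound only for a set bounded above; the
      boundedness clause of \<open>Hm1\<close> provides this.\<close>
    moreover have "bdd_above ((\<lambda>\<phi>. \<bar>G \<phi>\<bar>) ` {\<phi> \<in> H10 \<Omega>. H1_norm \<Omega> \<phi> \<le> 1})"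
    proof (rule bdd_aboveI2)
      fix \<zeta> assume \<zeta>: "\<zeta> \<in> {\<phi> \<in> H10 \<Omega>. H1_norm \<Omega> \<phi> \<le> 1}"
      have "\<bar>G \<zeta>\<bar> \<le> \<bar>B\<bar> * H1_norm \<Omega> \<zeta>"
        using order_trans[OF B[of \<zeta>] mult_right_mono[OF abs_ge_self nonneg]] \<zeta> by simp
      also have "\<dots> \<le> \<bar>B\<bar> * 1" using \<zeta> by (intro mult_left_mono) auto
      finally show "\<bar>G \<zeta>\<bar> \<le> \<bar>B\<bar>" by simp
    qed
    ultimately have "\<bar>G \<psi>\<bar> \<le> Hm1_norm \<Omega> G"
      unfolding Hm1_norm_def by (intro cSUP_upper)
    moreover have "G \<psi> = inverse n * G \<phi>"
      unfolding \<psi>_def using lin[OF \<phi> \<phi>, of "inverse n" 0] by simp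
    ultimately have "inverse n * \<bar>G \<phi>\<bar> \<le> Hm1_norm \<Omega> G"
      using n by (simp add: abs_mult)
    then show ?thesis using n by (simp add: n_def[symmetric] field_simps)
  qed
qed

lemma Hm1_diff:
  assumes "G \<in> Hm1 \<Omega>" "G' \<in> Hm1 \<Omega>"
  shows "(\<lambda>\<phi>. G \<phi> - G' \<phi>) \<in> Hm1 \<Omega>"
proof -
  obtain B where B: "\<And>\<phi>. \<phi> \<in> H10 \<Omega> \<Longrightarrow> \<bar>G \<phi>\<bar> \<le> B * H1_norm \<Omega> \<phi>"
    using assms(1) unfolding Hm1_def by blast
  obtain B' where B': "\<And>\<phi>. \<phi> \<in> H10 \<Omega> \<Longrightarrow> \<bar>G' \<phi>\<bar> \<le> B' * H1_norm \<Omega> \<phi>"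
    using assms(2) unfolding Hm1_def by blast
  have "\<bar>G \<phi> - G' \<phi>\<bar> \<le> (B + B') * H1_norm \<Omega> \<phi>" if "\<phi> \<in> H10 \<Omega>" for \<phi>
    using abs_triangle_ineq4[of "G \<phi>" "G' \<phi>"] B[OF that] B'[OF that] unfolding distrib_right by linarith
  then have "\<exists>B. \<forall>\<phi>\<in>H10 \<Omega>. \<bar>G \<phi> - G' \<phi>\<bar> \<le> B * H1_norm \<Omega> \<phi>"
    by blast
  then show ?thesis
    using assms unfolding Hm1_def by (simp add: algebra_simps)
qed

lemma H10_diff:
  assumes \<Omega>: "bounded \<Omega>" "open \<Omega>" and "v \<in> H10 \<Omega>" "w \<in> H10 \<Omega>"
  shows "H0grad \<Omega> (\<lambda>x. v x - w x) (\<lambda>x. wgrad \<Omega> v x - wgrad \<Omega> w x)"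
  using H0grad_lincomb[OF \<Omega> H10_imp_H0grad[OF \<Omega> assms(3)] H10_imp_H0grad[OF \<Omega> assms(4)], of 1 "-1"] by simp

text \<open>Replaces the chosen gradient of the test function by any gradient in the graph, so that
  explicit truncations can be inserted.\<close>

lemma KFP_weak_H0grad:
  assumes \<Omega>: "bounded \<Omega>" "open \<Omega>" and m: "m \<in> H10 \<Omega>" "KFP_weak \<Omega> \<nu> \<beta> G m"
    and \<beta>: "\<beta> \<in> borel_measurable (lebesgue_on \<Omega>)" and \<phi>: "H0grad \<Omega> \<phi> h"
  shows "(LINT x|lebesgue_on \<Omega>. \<nu> * (wgrad \<Omega> m x \<bullet> h x) + m x * (\<beta> x \<bullet> h x)) = G \<phi>"
proof -
  let ?M = "lebesgue_on \<Omega>"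
  note mL = H0grad_L2[OF H10_imp_H0grad[OF \<Omega> m(1)]]
  note H = H0grad_imp_H10[OF \<Omega> \<phi>]
  have [measurable]: "m \<in> borel_measurable ?M" "wgrad \<Omega> m \<in> borel_measurable ?M" "h \<in> borel_measurable ?M"
      "wgrad \<Omega> \<phi> \<in> borel_measurable ?M"
    using mL H0grad_L2[OF \<phi>] H0grad_L2[OF H10_imp_H0grad[OF \<Omega> H(1)]] by (auto simp: L2_def)
  note [measurable] = \<beta>
  have "(LINT x|?M. \<nu> * (wgrad \<Omega> m x \<bullet> h x) + m x * (\<beta> x \<bullet> h x))
      = (LINT x|?M. \<nu> * (wgrad \<Omega> m x \<bullet> wgrad \<Omega> \<phi> x) + m x * (\<beta> x \<bullet> wgrad \<Omega> \<phi> x))"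
  proof (rule integral_cong_AE)
    show "AE x in ?M. \<nu> * (wgrad \<Omega> m x \<bullet> h x) + m x * (\<beta> x \<bullet> h x)
        = \<nu> * (wgrad \<Omega> m x \<bullet> wgrad \<Omega> \<phi> x) + m x * (\<beta> x \<bullet> wgrad \<Omega> \<phi> x)"
      using H(2) by eventually_elim simp
  qed measurable
  also have "\<dots> = G \<phi>"
    using m(2) H(1) by (simp add: KFP_weak_def)
  finally show ?thesis .
qed

lemma HJB_weak_H0grad:
  assumes \<Omega>: "bounded \<Omega>" "open \<Omega>" and u: "u \<in> H10 \<Omega>" "HJB_weak \<Omega> \<nu> H R u"
    and H: "(\<lambda>x. H x (wgrad \<Omega> u x)) \<in> borel_measurable (lebesgue_on \<Omega>)" and \<psi>: "H0grad \<Omega> \<psi> h"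
  shows "(LINT x|lebesgue_on \<Omega>. \<nu> * (wgrad \<Omega> u x \<bullet> h x) + H x (wgrad \<Omega> u x) * \<psi> x) = R \<psi>"
proof -
  let ?M = "lebesgue_on \<Omega>"
  note uL = H0grad_L2[OF H10_imp_H0grad[OF \<Omega> u(1)]]
  note E = H0grad_imp_H10[OF \<Omega> \<psi>]
  have [measurable]: "\<psi> \<in> borel_measurable ?M" "wgrad \<Omega> u \<in> borel_measurable ?M" "h \<in> borel_measurable ?M"
      "wgrad \<Omega> \<psi> \<in> borel_measurable ?M"
    using uL H0grad_L2[OF \<psi>] H0grad_L2[OF H10_imp_H0grad[OF \<Omega> E(1)]] by (auto simp: L2_def)
  note [measurable] = H
  have "(LINT x|?M. \<nu> * (wgrad \<Omega> u x \<bullet> h x) + H x (wgrad \<Omega> u x) * \<psi> x)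
      = (LINT x|?M. \<nu> * (wgrad \<Omega> u x \<bullet> wgrad \<Omega> \<psi> x) + H x (wgrad \<Omega> u x) * \<psi> x)"
  proof (rule integral_cong_AE)
    show "AE x in ?M. \<nu> * (wgrad \<Omega> u x \<bullet> h x) + H x (wgrad \<Omega> u x) * \<psi> x
        = \<nu> * (wgrad \<Omega> u x \<bullet> wgrad \<Omega> \<psi> x) + H x (wgrad \<Omega> u x) * \<psi> x"
      using E(2) by eventually_elim simp
  qed measurable
  also have "\<dots> = R \<psi>"
    using u(2) E(1) by (simp add: HJB_weak_def)
  finally show ?thesis .
qed

text \<open>Continuity is available only over the closed set
  \<open>closure \<Omega> \<times> UNIV\<close>; extension by zero is Borel measurable and can be
  composed with the measurable map to the pair of \<open>x\<close> and \<open>g x\<close>.\<close>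

lemma borel_measurable_superposition:
  fixes \<Omega> :: "'a::euclidean_space set" and K :: "'a \<Rightarrow> 'a \<Rightarrow> 'b::euclidean_space"
  assumes K: "continuous_on (closure \<Omega> \<times> UNIV) (\<lambda>(x, p). K x p)"
    and g: "g \<in> borel_measurable (lebesgue_on \<Omega>)"
  shows "(\<lambda>x. K x (g x)) \<in> borel_measurable (lebesgue_on \<Omega>)"
proof -
  have F: "(\<lambda>z. if z \<in> closure \<Omega> \<times> UNIV then (\<lambda>(x, p). K x p) z else 0) \<in> borel_measurable borel"
    using K by (intro borel_measurable_continuous_on_if) (auto intro!: borel_closed closed_Times)
  have "(\<lambda>x. (x, g x)) \<in> borel_measurable (lebesgue_on \<Omega>)"
    using g id_borel_measurable_lebesgue_on[of \<Omega>] by (intro borel_measurable_Pair) (auto simp: id_def)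
  from measurable_compose[OF this F]
  have "(\<lambda>x. if (x, g x) \<in> closure \<Omega> \<times> UNIV then K x (g x) else 0) \<in> borel_measurable (lebesgue_on \<Omega>)"
    by (simp cong: if_cong)
  then show ?thesis
    by (rule measurable_lebesgue_cong[THEN iffD1, rotated]) (use closure_subset[of \<Omega>] in auto)
qed

section \<open>Subgradients and the convexity inequality between the two systems\<close>

lemma subdiff_p_bound:
  assumes "\<beta> \<in> subdiff_p H x p" "p_lipschitz \<Omega> L H" "x \<in> closure \<Omega>"
  shows "norm \<beta> \<le> max L 0"
proof (cases "\<beta> = 0")
  case False
  \<comment> \<open>Moving from \<open>p\<close> in the direction of the subgradient itself gives
    the square of \<open>norm \<beta>\<close> as a lower bound for the increment.\<close>
  have "H x (p + \<beta>) \<ge> H x p + \<beta> \<bullet> ((p + \<beta>) - p)"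
    using assms(1) unfolding subdiff_p_def by blast
  moreover have "\<bar>H x (p + \<beta>) - H x p\<bar> \<le> L * norm ((p + \<beta>) - p)"
    using assms(2,3) unfolding p_lipschitz_def by blast
  ultimately have "norm \<beta> * norm \<beta> \<le> L * norm \<beta>"
    by (simp add: dot_square_norm power2_eq_square)
  then show ?thesis using False by simp
qed simp

lemma GDERIV_grad_p:
  assumes "\<exists>D. GDERIV (H x) p :> D"
  shows "GDERIV (H x) p :> grad_p H x p"
proof -
  obtain D where D: "GDERIV (H x) p :> D" using assms by blast
  have unique: "D' = D" if "GDERIV (H x) p :> D'" for D'
  proof -
    have "(\<lambda>h. h \<bullet> D') = (\<lambda>h. h \<bullet> D)"
      using has_derivative_unique[OF that[unfolded gderiv_def] D[unfolded gderiv_def]] .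
    then have "\<forall>h. h \<bullet> D' = h \<bullet> D" by (simp add: fun_eq_iff)
    then show ?thesis by (simp only: vector_eq_ldot)
  qed
  show ?thesis
    unfolding grad_p_def by (rule theI[of "\<lambda>D. GDERIV (H x) p :> D", OF D unique])
qed

text \<open>By convexity the difference quotients along the segment from \<open>p\<close> to
  \<open>q\<close> are at most \<open>H x q - H x p\<close> for parameters between 0 and 1; the
  limit from the right is the derivative.\<close>

lemma convex_GDERIV_subdiff:
  fixes H :: "'a::euclidean_space \<Rightarrow> 'a \<Rightarrow> real"
  assumes conv: "convex_on UNIV (H x)" and D: "GDERIV (H x) p :> D"
  shows "D \<in> subdiff_p H x p"
  unfolding subdiff_p_def
proof (intro CollectI allI)
  fix q
  have line: "((\<lambda>t::real. p + t *\<^sub>R (q - p)) has_derivative (\<lambda>t. t *\<^sub>R (q - p))) (at 0)"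
    by (auto intro!: derivative_eq_intros)
  have "((\<lambda>t::real. H x (p + t *\<^sub>R (q - p))) has_derivative (\<lambda>t. (t *\<^sub>R (q - p)) \<bullet> D)) (at 0)"
    using diff_chain_at[OF line, of "H x" "\<lambda>h. h \<bullet> D"] D by (simp add: o_def gderiv_def)
  then have "((\<lambda>t. H x (p + t *\<^sub>R (q - p))) has_real_derivative (D \<bullet> (q - p))) (at 0)"
    by (simp add: has_field_derivative_def inner_commute mult.commute[of _ "D \<bullet> (q - p)"])
  then have "((\<lambda>t. (H x (p + t *\<^sub>R (q - p)) - H x p) / t) \<longlongrightarrow> D \<bullet> (q - p)) (at 0)"
    by (simp add: DERIV_def)
  then have lim: "((\<lambda>t. (H x (p + t *\<^sub>R (q - p)) - H x p) / t) \<longlongrightarrow> D \<bullet> (q - p)) (at_right 0)"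
    by (rule filterlim_mono[OF _ order_refl at_le]) simp
  have "\<forall>\<^sub>F t in at_right (0::real). t < 1"
    by (rule eventually_at_right_less[THEN eventually_mono, of 0 "\<lambda>_. True", THEN eventually_rev_mp])
       (auto simp: eventually_at_right[of 0 1] intro!: exI[of _ 1])
  moreover have "\<forall>\<^sub>F t in at_right (0::real). 0 < t"
    by (simp add: eventually_at_right_less)
  ultimately have "\<forall>\<^sub>F t in at_right 0. (H x (p + t *\<^sub>R (q - p)) - H x p) / t \<le> H x q - H x p"
  proof eventually_elim
    case (elim t)
    have "H x ((1 - t) *\<^sub>R p + t *\<^sub>R q) \<le> (1 - t) * H x p + t * H x q"
      using conv elim by (intro convex_onD) auto
    moreover have "(1 - t) *\<^sub>R p + t *\<^sub>R q = p + t *\<^sub>R (q - p)"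
      by (simp add: algebra_simps)
    ultimately have "H x (p + t *\<^sub>R (q - p)) - H x p \<le> (H x q - H x p) * t"
      by (simp add: algebra_simps)
    then show ?case using elim by (simp add: pos_divide_le_eq)
  qed
  then have "D \<bullet> (q - p) \<le> H x q - H x p"
    by (intro tendsto_upperbound[OF lim]) auto
  then show "H x p + D \<bullet> (q - p) \<le> H x q" by simp
qed

text \<open>Each subgradient inequality is multiplied by its own density, which preserves it because
  the density is nonnegative. Exchanging one Hamiltonian for the other costs \<omega>, once at
  \<open>q\<close> with weight \<open>m\<close> and once at \<open>p\<close> with weight
  \<open>m'\<close>.\<close>

lemma mfg_pointwise_bound:
  assumes m: "0 \<le> m" "0 \<le> m'" and b: "b \<in> subdiff_p H x p" and b': "b' \<in> subdiff_p K x q"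
    and close: "\<And>r. \<bar>K x r - H x r\<bar> \<le> \<omega>"
  shows "(H x p - K x q) * (m - m') - (m * (b \<bullet> (p - q)) - m' * (b' \<bullet> (p - q))) \<le> \<omega> * (m + m')"
proof -
  have "H x p + b \<bullet> (q - p) \<le> H x q" using b by (simp add: subdiff_p_def)
  then have "m * (H x p - K x q - b \<bullet> (p - q)) \<le> m * \<omega>"
    using close[of q] by (intro mult_left_mono m) (simp add: inner_diff_right)
  moreover have "K x q + b' \<bullet> (p - q) \<le> K x p" using b' by (simp add: subdiff_p_def)
  then have "m' * (K x q - H x p + b' \<bullet> (p - q)) \<le> m' * \<omega>"
    using close[of p] by (intro mult_left_mono m) simp
  ultimately show ?thesis by (simp add: algebra_simps)
qed

text \<open>The crossed choice of test functions makes the diffusion terms of the two systems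
  coincide, so they cancel, and so does the common right-hand side \<open>g\<close>. Only the
  integrand of the pointwise inequality remains.\<close>

lemma mfg_difference_energy:
  fixes p q a a' \<beta> \<beta>' :: "'a::euclidean_space \<Rightarrow> 'a"
  assumes L2: "p \<in> L2 M" "q \<in> L2 M" "a \<in> L2 M" "a' \<in> L2 M" "m \<in> L2 M" "m' \<in> L2 M" "k \<in> L2 M" "k' \<in> L2 M"
    and fin: "finite_measure M"
    and \<beta>: "\<beta> \<in> borel_measurable M" "AE x in M. norm (\<beta> x) \<le> L"
    and \<beta>': "\<beta>' \<in> borel_measurable M" "AE x in M. norm (\<beta>' x) \<le> L"
    and pw: "AE x in M. (k x - k' x) * (m x - m' x)
        - (m x * (\<beta> x \<bullet> (p x - q x)) - m' x * (\<beta>' x \<bullet> (p x - q x))) \<le> \<omega> * (m x + m' x)"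
    and hjb: "(LINT x|M. \<nu> * (p x \<bullet> (a x - a' x)) + k x * (m x - m' x)) = R"
      "(LINT x|M. \<nu> * (q x \<bullet> (a x - a' x)) + k' x * (m x - m' x)) = R'"
    and kfp: "(LINT x|M. \<nu> * (a x \<bullet> (p x - q x)) + m x * (\<beta> x \<bullet> (p x - q x))) = g"
      "(LINT x|M. \<nu> * (a' x \<bullet> (p x - q x)) + m' x * (\<beta>' x \<bullet> (p x - q x))) = g"
  shows "R - R' \<le> \<omega> * ((LINT x|M. m x) + (LINT x|M. m' x))"
proof -
  interpret finite_measure M by fact
  note d = L2_diff[OF L2(1,2)] L2_diff[OF L2(3,4)] L2_diff[OF L2(5,6)]
  note b = L2_bounded_drift(1)[OF d(1) \<beta>] L2_bounded_drift(1)[OF d(1) \<beta>']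
  note i = integrable_inner_L2[OF L2(1) d(2)] integrable_inner_L2[OF L2(2) d(2)]
    integrable_inner_L2[OF L2(3) d(1)] integrable_inner_L2[OF L2(4) d(1)]
    integrable_mult_L2[OF L2(7) d(3)] integrable_mult_L2[OF L2(8) d(3)]
    integrable_mult_L2[OF L2(5) b(1)] integrable_mult_L2[OF L2(6) b(2)]
  let ?X = "\<lambda>x. \<nu> * (p x \<bullet> (a x - a' x)) + k x * (m x - m' x)"
  let ?Y = "\<lambda>x. \<nu> * (q x \<bullet> (a x - a' x)) + k' x * (m x - m' x)"
  let ?Z = "\<lambda>x. \<nu> * (a x \<bullet> (p x - q x)) + m x * (\<beta> x \<bullet> (p x - q x))"
  let ?W = "\<lambda>x. \<nu> * (a' x \<bullet> (p x - q x)) + m' x * (\<beta>' x \<bullet> (p x - q x))"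
  have int: "integrable M ?X" "integrable M ?Y" "integrable M ?Z" "integrable M ?W"
    using i by simp_all
  have "R - R' = ((LINT x|M. ?X x) - (LINT x|M. ?Y x)) - ((LINT x|M. ?Z x) - (LINT x|M. ?W x))"
    unfolding hjb kfp by simp
  also have "\<dots> = (LINT x|M. (?X x - ?Y x) - (?Z x - ?W x))"
    by (simp only: Bochner_Integration.integral_diff Bochner_Integration.integrable_diff int)
  also have "\<dots> = (LINT x|M. (k x - k' x) * (m x - m' x)
        - (m x * (\<beta> x \<bullet> (p x - q x)) - m' x * (\<beta>' x \<bullet> (p x - q x))))"
    by (intro Bochner_Integration.integral_cong refl)
      (simp add: inner_diff_left inner_diff_right inner_commute algebra_simps)
  also have "\<dots> \<le> (LINT x|M. \<omega> * (m x + m' x))"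
    using i L2_imp_integrable[OF L2(5)] L2_imp_integrable[OF L2(6)]
    by (intro integral_mono_AE[OF _ _ pw]) (auto simp: left_diff_distrib)
  also have "\<dots> = \<omega> * ((LINT x|M. m x) + (LINT x|M. m' x))"
    using L2_imp_integrable[OF L2(5)] L2_imp_integrable[OF L2(6)] by simp
  finally show ?thesis by simp
qed

lemma L2_linear_growth:
  fixes g :: "'a \<Rightarrow> 'b::euclidean_space" and k :: "'a \<Rightarrow> real"
  assumes fin: "finite_measure M" and g: "g \<in> L2 M" and k: "k \<in> borel_measurable M"
    and bound: "\<And>x. x \<in> space M \<Longrightarrow> \<bar>k x\<bar> \<le> c + L * norm (g x)"
  shows "k \<in> L2 M"
proof -
  interpret finite_measure M by fact
  have "(\<lambda>x. c + L *\<^sub>R norm (g x)) \<in> L2 M"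
    by (intro L2_add L2_const L2_scaleR L2_norm g)
  then show ?thesis
    by (rule L2_dominated[OF _ k]) (use bound in \<open>force intro!: AE_I2\<close>)
qed

section \<open>Consequences of admissibility\<close>

lemma admissible_regularizationD:
  assumes adm: "admissible_regularization \<Omega> L_H H Hreg \<omega>" and l: "l \<in> {0<..1}"
  shows "0 \<le> \<omega> l" "continuous_on (closure \<Omega> \<times> UNIV) (\<lambda>(x, p). Hreg l x p)" "p_lipschitz \<Omega> L_H (Hreg l)"
    "continuous_on (closure \<Omega> \<times> UNIV) (\<lambda>(x, p). grad_p (Hreg l) x p)"
    "\<And>x p. x \<in> closure \<Omega> \<Longrightarrow> \<bar>Hreg l x p - H x p\<bar> \<le> \<omega> l"
    "\<And>x p. x \<in> closure \<Omega> \<Longrightarrow> grad_p (Hreg l) x p \<in> subdiff_p (Hreg l) x p"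
proof -
  note d = adm[unfolded admissible_regularization_def]
  show "0 \<le> \<omega> l" "continuous_on (closure \<Omega> \<times> UNIV) (\<lambda>(x, p). Hreg l x p)" "p_lipschitz \<Omega> L_H (Hreg l)"
    "continuous_on (closure \<Omega> \<times> UNIV) (\<lambda>(x, p). grad_p (Hreg l) x p)"
    "\<And>x p. x \<in> closure \<Omega> \<Longrightarrow> \<bar>Hreg l x p - H x p\<bar> \<le> \<omega> l"
    using d l by auto
  show "grad_p (Hreg l) x p \<in> subdiff_p (Hreg l) x p" if "x \<in> closure \<Omega>" for x p
    using d l that by (intro convex_GDERIV_subdiff GDERIV_grad_p) auto
qed

text \<open>Serves measurability: along a gradient, \<open>H\<close> is a pointwise limit of
  superpositions with the continuous regularizations.\<close>

lemma admissible_regularization_tendsto: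
  assumes adm: "admissible_regularization \<Omega> L_H H Hreg \<omega>" and x: "x \<in> closure \<Omega>"
  shows "(\<lambda>n. Hreg (inverse (real (Suc n))) x p) \<longlonglongrightarrow> H x p"
proof -
  have l: "inverse (real (Suc n)) \<in> {0<..1}" for n
    by (auto simp: divide_simps)
  have "(\<lambda>n. \<omega> (inverse (real (Suc n)))) \<longlonglongrightarrow> \<omega> 0"
  proof (rule continuous_on_tendsto_compose[OF _ LIMSEQ_inverse_real_of_nat])
    show "continuous_on {0..1} \<omega>" using adm by (simp add: admissible_regularization_def)
    show "\<forall>\<^sub>F n in sequentially. inverse (real (Suc n)) \<in> {0..1}"
      using l by (intro always_eventually) (auto simp del: of_nat_Suc intro: less_imp_le)
  qed simp
  then have "(\<lambda>n. \<omega> (inverse (real (Suc n)))) \<longlonglongrightarrow> 0"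
    using adm by (simp add: admissible_regularization_def)
  then have "(\<lambda>n. Hreg (inverse (real (Suc n))) x p - H x p) \<longlonglongrightarrow> 0"
    by (rule Lim_null_comparison[rotated])
       (use admissible_regularizationD(5)[OF adm l x] in \<open>auto simp del: of_nat_Suc intro!: always_eventually\<close>)
  then show ?thesis by (simp only: LIM_zero_cancel)
qed

lemma admissible_regularization_L2:
  fixes \<Omega> :: "'a::euclidean_space set"
  assumes \<Omega>: "bounded \<Omega>" "open \<Omega>" and adm: "admissible_regularization \<Omega> L_H H Hreg \<omega>"
    and lip: "p_lipschitz \<Omega> L_H H" and l: "l \<in> {0<..1}" and g: "g \<in> L2 (lebesgue_on \<Omega>)"
  shows "(\<lambda>x. H x (g x)) \<in> L2 (lebesgue_on \<Omega>)" "(\<lambda>x. Hreg l x (g x)) \<in> L2 (lebesgue_on \<Omega>)"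
proof -
  let ?M = "lebesgue_on \<Omega>"
  note fin = finite_measure_lebesgue_on_bounded_open[OF \<Omega>]
  note cl = subsetD[OF closure_subset]
  have gm: "g \<in> borel_measurable ?M" using g by (simp add: L2_def)
  have regm: "(\<lambda>x. Hreg l x (g x)) \<in> borel_measurable ?M" if "l \<in> {0<..1}" for l
    by (rule borel_measurable_superposition[OF admissible_regularizationD(2)[OF adm that] gm])
  have Hm: "(\<lambda>x. H x (g x)) \<in> borel_measurable ?M"
  proof (rule borel_measurable_LIMSEQ_real)
    show "(\<lambda>n. Hreg (inverse (real (Suc n))) x (g x)) \<longlonglongrightarrow> H x (g x)" if "x \<in> space ?M" for x
      using that by (intro admissible_regularization_tendsto[OF adm]) (auto intro: cl)
    show "(\<lambda>x. Hreg (inverse (real (Suc n))) x (g x)) \<in> borel_measurable ?M" for n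
      by (intro regm) (auto simp: divide_simps)
  qed
  have one: "(1::real) \<in> {0<..1}" by simp
  have "continuous_on (closure \<Omega>) (\<lambda>x. (\<lambda>(x, p). Hreg 1 x p) (x, 0))"
    by (rule continuous_on_compose2[OF admissible_regularizationD(2)[OF adm one]]) (auto intro!: continuous_intros)
  then have "bounded ((\<lambda>x. Hreg 1 x 0) ` closure \<Omega>)"
    using \<Omega>(1) by (intro compact_imp_bounded compact_continuous_image) (auto simp: compact_closure)
  then obtain c where c: "\<And>x. x \<in> closure \<Omega> \<Longrightarrow> \<bar>Hreg 1 x 0\<bar> \<le> c"
    by (auto simp: bounded_iff)
  \<comment> \<open>Linear growth anchored at \<open>p = 0\<close>: \<open>Hreg 1\<close> is bounded
    by \<open>c\<close> on the compact closure, \<open>H\<close> differs from it by at most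
    \<open>\<omega> 1\<close>, and the Lipschitz bound covers the remaining increment.\<close>
  have Hb: "\<bar>H x r\<bar> \<le> (c + \<omega> 1) + L_H * norm r" if "x \<in> closure \<Omega>" for x r
  proof -
    have "\<bar>H x r - H x 0\<bar> \<le> L_H * norm (r - 0)"
      using lip that unfolding p_lipschitz_def by blast
    then show ?thesis
      using c[OF that] admissible_regularizationD(5)[OF adm one that, of 0] unfolding diff_zero by linarith
  qed
  show "(\<lambda>x. H x (g x)) \<in> L2 ?M"
    by (rule L2_linear_growth[OF fin g Hm Hb]) (auto intro: cl)
  show "(\<lambda>x. Hreg l x (g x)) \<in> L2 ?M"
  proof (rule L2_linear_growth[OF fin g regm[OF l]])
    fix x assume "x \<in> space ?M"
    then have x: "x \<in> closure \<Omega>" by (auto intro: cl)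
    show "\<bar>Hreg l x (g x)\<bar> \<le> (c + \<omega> 1 + \<omega> l) + L_H * norm (g x)"
      using Hb[OF x, of "g x"] admissible_regularizationD(5)[OF adm l x, of "g x"] by linarith
  qed
qed

text \<open>The factor is written out in \<open>C\<close>, \<open>K1\<close>, \<open>K2\<close> and
  the scalar data so that it can be fixed before all functional data. Its last root is the bound for
  the densities; the product with \<open>(C + 1) * K2\<close> comes from the linearized equation for
  the value functions.\<close>

lemma mfg_estimate_at:
  fixes \<Omega> :: "'a::euclidean_space set" and \<iota> :: "('a \<Rightarrow> real) \<Rightarrow> 'x::banach"
  assumes \<Omega>: "bounded \<Omega>" "open \<Omega>" and \<nu>: "0 < \<nu>" and c_F: "0 < c_F" and L_F: "0 \<le> L_F"
    and C: "0 < C" "\<And>v g. H0grad \<Omega> v g \<Longrightarrow> norm2 (lebesgue_on \<Omega>) v \<le> C * norm2 (lebesgue_on \<Omega>) g"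
    and L: "L = max L_H 0"
    and K1: "\<And>m g \<beta>. kfp_problem \<Omega> \<nu> L (\<bar>N\<bar> * (C + 1)) m g \<beta> \<Longrightarrow> (LINT x|lebesgue_on \<Omega>. m x) \<le> K1"
    and K2: "0 \<le> K2" "\<And>w g q r. hjb_problem \<Omega> \<nu> L w g q r \<Longrightarrow> norm2 (lebesgue_on \<Omega>) g \<le> K2 * r"
    and G: "G \<in> Hm1 \<Omega>" "Hm1_norm \<Omega> G = N"
    and \<iota>: "compactly_embedded \<Omega> \<iota> X" and F: "coupling_operator \<Omega> X F"
    and lip: "p_lipschitz \<Omega> L_H H"
    and adm: "admissible_regularization \<Omega> L_H H Hreg \<omega>" and W: "(SUP \<sigma>\<in>{0..1}. \<omega> \<sigma>) = W"
    and G_nonneg: "nonneg_functional \<Omega> G" and mono: "strongly_monotone \<Omega> \<iota> F c_F"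
    and F_lip: "lipschitz_coupling \<Omega> X F L_F"
    and sol: "mfg_pdi_solution \<Omega> \<nu> G \<iota> F H u m" and l: "l \<in> {0<..1}"
    and sol': "regularized_solution \<Omega> \<nu> G \<iota> F (Hreg l) u' m'"
  shows "H1_norm \<Omega> (\<lambda>x. u x - u' x) + norm (\<iota> m - \<iota> m')
    \<le> ((C + 1) * K2 * (L_F * (C + 1) * sqrt (2 * max K1 0 / c_F) + sqrt \<bar>W\<bar> * sqrt (measure (lebesgue_on \<Omega>) \<Omega>) * C)
        + sqrt (2 * max K1 0 / c_F)) * \<omega> l powr (1/2)"
proof -
  let ?M = "lebesgue_on \<Omega>"
  interpret finite_measure ?M by (rule finite_measure_lebesgue_on_bounded_open[OF \<Omega>])
  note cl = subsetD[OF closure_subset]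
  note reg = admissible_regularizationD[OF adm l]
  note HL2 = admissible_regularization_L2[OF \<Omega> adm lip l]
  define V where "V = measure ?M \<Omega>"
  have V: "0 \<le> V" by (simp add: V_def)
  have L0: "0 \<le> L" by (simp add: L)
  obtain \<beta> where sols: "u \<in> H10 \<Omega>" "m \<in> H10 \<Omega>" "\<beta> \<in> DpH \<Omega> H u" "HJB_weak \<Omega> \<nu> H (F (\<iota> m)) u" "KFP_weak \<Omega> \<nu> \<beta> G m"
    using sol unfolding mfg_pdi_solution_def by blast
  define p where "p = wgrad \<Omega> u"
  define q where "q = wgrad \<Omega> u'"
  define a where "a = wgrad \<Omega> m"
  define a' where "a' = wgrad \<Omega> m'"
  define \<beta>' where "\<beta>' x = grad_p (Hreg l) x (q x)" for x
  have sols': "u' \<in> H10 \<Omega>" "m' \<in> H10 \<Omega>" "HJB_weak \<Omega> \<nu> (Hreg l) (F (\<iota> m')) u'" "KFP_weak \<Omega> \<nu> \<beta>' G m'"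
    using sol' unfolding regularized_solution_def \<beta>'_def[abs_def] q_def by auto
  have H0: "H0grad \<Omega> u p" "H0grad \<Omega> u' q" "H0grad \<Omega> m a" "H0grad \<Omega> m' a'"
    unfolding p_def q_def a_def a'_def
    by (intro H10_imp_H0grad[OF \<Omega>] sols sols')+
  note uL = H0grad_L2[OF H0(1)] H0grad_L2[OF H0(2)] and mL = H0grad_L2[OF H0(3)] H0grad_L2[OF H0(4)]
  have du: "H0grad \<Omega> (\<lambda>x. u x - u' x) (\<lambda>x. p x - q x)" and dm: "H0grad \<Omega> (\<lambda>x. m x - m' x) (\<lambda>x. a x - a' x)"
    unfolding p_def q_def a_def a'_def by (intro H10_diff[OF \<Omega>] sols sols')+
  have space: "AE x in ?M. x \<in> closure \<Omega>"
    by (rule AE_I2) (auto intro: cl)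

  have \<beta>: "\<beta> \<in> borel_measurable ?M" "AE x in ?M. \<beta> x \<in> subdiff_p H x (p x)"
    using sols(3) by (auto simp: DpH_def Linf_on_def p_def)
  have \<beta>': "\<beta>' \<in> borel_measurable ?M" "AE x in ?M. \<beta>' x \<in> subdiff_p (Hreg l) x (q x)"
    unfolding \<beta>'_def using uL(4)
    by (auto intro!: borel_measurable_superposition[OF reg(4)] reg(6) AE_I2 cl simp: L2_def)
  have \<beta>L: "AE x in ?M. norm (\<beta> x) \<le> L"
    using \<beta>(2) space unfolding L by eventually_elim (rule subdiff_p_bound[OF _ lip])
  have \<beta>'L: "AE x in ?M. norm (\<beta>' x) \<le> L"
    using \<beta>'(2) space unfolding L by eventually_elim (rule subdiff_p_bound[OF _ reg(3)])

  \<comment> \<open>Poincare replaces \<open>H1_norm\<close> by the gradient norm, the form in which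
    \<open>kfp_problem\<close> measures the right-hand side. The absolute value keeps the factor
    nonnegative for a general real \<open>N\<close>.\<close>
  have G_bound: "G \<phi> \<le> \<bar>N\<bar> * (C + 1) * norm2 ?M h" if "H0grad \<Omega> \<phi> h" for \<phi> h
  proof -
    have "\<bar>G \<phi>\<bar> \<le> Hm1_norm \<Omega> G * H1_norm \<Omega> \<phi>"
      by (rule Hm1_norm_bound[OF \<Omega> G(1) H0grad_imp_H10(1)[OF \<Omega> that]])
    also have "\<dots> \<le> \<bar>N\<bar> * H1_norm \<Omega> \<phi>"
      unfolding G(2) by (intro mult_right_mono) (auto simp: H1_norm_def)
    also have "\<dots> \<le> \<bar>N\<bar> * ((C + 1) * norm2 ?M h)"
      by (intro mult_left_mono H1_norm_le_gradient[OF \<Omega> C(2) that]) auto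
    finally show ?thesis by (simp add: mult.assoc)
  qed
  note kfp = KFP_weak_H0grad[OF \<Omega> sols(2,5) \<beta>(1), folded a_def]
    and kfp' = KFP_weak_H0grad[OF \<Omega> sols'(2,4) \<beta>'(1), folded a'_def]
  note hjb = HJB_weak_H0grad[OF \<Omega> sols(1,4) L2_measurable[OF HL2(1)[OF uL(2)[unfolded p_def]]], folded p_def]
    and hjb' = HJB_weak_H0grad[OF \<Omega> sols'(1,3) L2_measurable[OF HL2(2)[OF uL(4)[unfolded q_def]]], folded q_def]
  have G0: "0 \<le> G \<phi>" if "H0grad \<Omega> \<phi> h" "AE x in ?M. 0 \<le> \<phi> x" for \<phi> h
    using G_nonneg H0grad_imp_H10(1)[OF \<Omega> that(1)] that(2) unfolding nonneg_functional_def by blast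
  have m_nonneg: "AE x in ?M. 0 \<le> m x"
    by (rule kfp_nonneg[OF \<Omega> \<nu> L0 H0(3) \<beta>(1) \<beta>L]) (use kfp G0 in metis)
  have m'_nonneg: "AE x in ?M. 0 \<le> m' x"
    by (rule kfp_nonneg[OF \<Omega> \<nu> L0 H0(4) \<beta>'(1) \<beta>'L]) (use kfp' G0 in metis)
  have m_int: "(LINT x|?M. m x) \<le> K1"
    by (rule K1[of m a \<beta>]) (simp add: kfp_problem_def H0 \<beta> \<beta>L kfp G_bound)
  have m'_int: "(LINT x|?M. m' x) \<le> K1"
    by (rule K1[of m' a' \<beta>']) (simp add: kfp_problem_def H0 \<beta>' \<beta>'L kfp' G_bound)

  have \<omega>: "0 \<le> \<omega> l" by (rule reg(1))
  have pw: "AE x in ?M. (H x (p x) - Hreg l x (q x)) * (m x - m' x)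
      - (m x * (\<beta> x \<bullet> (p x - q x)) - m' x * (\<beta>' x \<bullet> (p x - q x))) \<le> \<omega> l * (m x + m' x)"
    using m_nonneg m'_nonneg \<beta>(2) \<beta>'(2) space
    by eventually_elim (rule mfg_pointwise_bound, auto intro: reg(5))
  define d where "d = norm (\<iota> m - \<iota> m')"
  have "c_F * d\<^sup>2 \<le> F (\<iota> m) (\<lambda>x. m x - m' x) - F (\<iota> m') (\<lambda>x. m x - m' x)"
    using mono sols(2) sols'(2) unfolding strongly_monotone_def d_def by blast
  also have "\<dots> \<le> \<omega> l * ((LINT x|?M. m x) + (LINT x|?M. m' x))"
    by (rule mfg_difference_energy[OF uL(2,4) mL(2,4) mL(1,3) HL2(1)[OF uL(2)] HL2(2)[OF uL(4)] _
          \<beta>(1) \<beta>L \<beta>'(1) \<beta>'L pw hjb[OF dm] hjb'[OF dm] kfp[OF du] kfp'[OF du]])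
       (rule finite_measure_axioms)
  \<comment> \<open>\<open>K1\<close> is merely some upper bound for the integrals; the maximum with
    0 keeps the quantity under the later square root nonnegative.\<close>
  also have "\<dots> \<le> \<omega> l * (2 * max K1 0)"
    using m_int m'_int \<omega> by (intro mult_left_mono) auto
  finally have d2: "d\<^sup>2 \<le> 2 * max K1 0 / c_F * \<omega> l"
    using c_F by (simp add: field_simps)
  define \<kappa> where "\<kappa> = sqrt (2 * max K1 0 / c_F)"
  have d: "d \<le> \<kappa> * sqrt (\<omega> l)"
    using real_le_rsqrt[OF d2] unfolding \<kappa>_def real_sqrt_mult[symmetric] .
  have d0: "0 \<le> d" by (simp add: d_def)

  \<comment> \<open>The two sources of the linearized equation: the difference of the couplings,
    Lipschitz in \<open>d\<close>, and the regularization error, whose L2 norm is at most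
    \<open>\<omega> l * sqrt V\<close>.\<close>
  define r where "r = L_F * d * (C + 1) + \<omega> l * sqrt V * C"
  have r0: "0 \<le> r" unfolding r_def using L_F d0 C(1) \<omega> V by (intro add_nonneg_nonneg mult_nonneg_nonneg) auto
  have "hjb_problem \<Omega> \<nu> L (\<lambda>x. u x - u' x) (\<lambda>x. p x - q x) (\<lambda>x. H x (p x) - H x (q x)) r"
    unfolding hjb_problem_def
  proof (intro conjI du r0 allI impI)
    show "(\<lambda>x. H x (p x) - H x (q x)) \<in> borel_measurable ?M"
      by (intro L2_measurable[OF L2_diff] HL2 uL)
    show "AE x in ?M. \<bar>H x (p x) - H x (q x)\<bar> \<le> L * norm (p x - q x)"
      using space
    proof eventually_elim
      case (elim x)
      have "\<bar>H x (p x) - H x (q x)\<bar> \<le> L_H * norm (p x - q x)"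
        using lip elim unfolding p_lipschitz_def by blast
      also have "\<dots> \<le> L * norm (p x - q x)" unfolding L by (intro mult_right_mono) auto
      finally show ?case .
    qed
    fix \<psi> h assume \<psi>: "H0grad \<Omega> \<psi> h"
    note \<psi>L = H0grad_L2[OF \<psi>]
    have eL: "(\<lambda>x. Hreg l x (q x) - H x (q x)) \<in> L2 ?M" by (intro L2_diff HL2 uL)
    note i = integrable_inner_L2[OF uL(2) \<psi>L(2)] integrable_inner_L2[OF uL(4) \<psi>L(2)]
      integrable_mult_L2[OF HL2(1)[OF uL(2)] \<psi>L(1)] integrable_mult_L2[OF HL2(2)[OF uL(4)] \<psi>L(1)]
      integrable_mult_L2[OF eL \<psi>L(1)]
    have int: "integrable ?M (\<lambda>x. \<nu> * (p x \<bullet> h x) + H x (p x) * \<psi> x)"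
      "integrable ?M (\<lambda>x. \<nu> * (q x \<bullet> h x) + Hreg l x (q x) * \<psi> x)"
      using i by simp_all
    \<comment> \<open>The regularized equation contains \<open>Hreg l\<close> at \<open>q\<close>,
      but the linearization compares \<open>H\<close> with itself at \<open>p\<close> and
      \<open>q\<close>; the discrepancy at \<open>q\<close> is moved to the source.\<close>
    have "(LINT x|?M. \<nu> * ((p x - q x) \<bullet> h x) + (H x (p x) - H x (q x)) * \<psi> x)
        = (LINT x|?M. (\<nu> * (p x \<bullet> h x) + H x (p x) * \<psi> x) - (\<nu> * (q x \<bullet> h x) + Hreg l x (q x) * \<psi> x)
            + (Hreg l x (q x) - H x (q x)) * \<psi> x)"
      by (intro Bochner_Integration.integral_cong refl) (simp add: inner_diff_left algebra_simps)
    also have "\<dots> = (F (\<iota> m) \<psi> - F (\<iota> m') \<psi>) + (LINT x|?M. (Hreg l x (q x) - H x (q x)) * \<psi> x)"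
      using int i(5) hjb[OF \<psi>] hjb'[OF \<psi>]
      by (simp only: Bochner_Integration.integral_add Bochner_Integration.integral_diff Bochner_Integration.integrable_diff)
    finally have eq: "(LINT x|?M. \<nu> * ((p x - q x) \<bullet> h x) + (H x (p x) - H x (q x)) * \<psi> x) = \<dots>" .
    have in_X: "\<iota> m \<in> X" "\<iota> m' \<in> X"
      using \<iota> sols(2) sols'(2) by (auto simp: compactly_embedded_def)
    have "(\<lambda>\<phi>. F (\<iota> m) \<phi> - F (\<iota> m') \<phi>) \<in> Hm1 \<Omega>"
      using F in_X by (intro Hm1_diff) (auto simp: coupling_operator_def)
    from Hm1_norm_bound[OF \<Omega> this H0grad_imp_H10(1)[OF \<Omega> \<psi>]]
    have "\<bar>F (\<iota> m) \<psi> - F (\<iota> m') \<psi>\<bar> \<le> Hm1_norm \<Omega> (\<lambda>\<phi>. F (\<iota> m) \<phi> - F (\<iota> m') \<phi>) * H1_norm \<Omega> \<psi>" .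
    also have "\<dots> \<le> (L_F * d) * H1_norm \<Omega> \<psi>"
      using F_lip in_X unfolding lipschitz_coupling_def d_def by (intro mult_right_mono) (auto simp: H1_norm_def)
    also have "\<dots> \<le> (L_F * d) * ((C + 1) * norm2 ?M h)"
      using L_F d0 by (intro mult_left_mono H1_norm_le_gradient[OF \<Omega> C(2) \<psi>]) auto
    finally have 1: "\<bar>F (\<iota> m) \<psi> - F (\<iota> m') \<psi>\<bar> \<le> L_F * d * (C + 1) * norm2 ?M h" by (simp add: mult.assoc)
    have "\<bar>LINT x|?M. (Hreg l x (q x) - H x (q x)) * \<psi> x\<bar> \<le> norm2 ?M (\<lambda>x. Hreg l x (q x) - H x (q x)) * norm2 ?M \<psi>"
      using abs_integral_inner_le[OF eL \<psi>L(1)] by simp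
    also have "\<dots> \<le> (\<omega> l * sqrt V) * (C * norm2 ?M h)"
    proof (intro mult_mono C(2)[OF \<psi>])
      have "norm2 ?M (\<lambda>x. Hreg l x (q x) - H x (q x)) \<le> norm2 ?M (\<lambda>x. \<omega> l *\<^sub>R indicator \<Omega> x :: real)"
        using reg(5) \<omega> by (intro norm2_mono L2_scaleR L2_indicator L2_measurable[OF eL] AE_I2) (auto intro: cl)
      also have "\<dots> = \<omega> l * sqrt V"
        using \<omega> norm2_indicator[of \<Omega>] by (simp add: norm2_scaleR V_def del: real_scaleR_def)
      finally show "norm2 ?M (\<lambda>x. Hreg l x (q x) - H x (q x)) \<le> \<omega> l * sqrt V" .
    qed (use \<omega> V in auto)
    finally have 2: "\<bar>LINT x|?M. (Hreg l x (q x) - H x (q x)) * \<psi> x\<bar> \<le> \<omega> l * sqrt V * C * norm2 ?M h"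
      by (simp add: mult.assoc)
    show "\<bar>LINT x|?M. \<nu> * ((p x - q x) \<bullet> h x) + (H x (p x) - H x (q x)) * \<psi> x\<bar> \<le> r * norm2 ?M h"
      unfolding eq r_def distrib_right using abs_triangle_ineq 1 2 by linarith
  qed
  then have "norm2 ?M (\<lambda>x. p x - q x) \<le> K2 * r" by (rule K2(2))
  then have 3: "H1_norm \<Omega> (\<lambda>x. u x - u' x) \<le> (C + 1) * (K2 * r)"
    using H1_norm_le_gradient[OF \<Omega> C(2) du] mult_left_mono[of "norm2 ?M (\<lambda>x. p x - q x)" "K2 * r" "C + 1"] C(1)
    by linarith

  have "\<omega> l \<le> W"
  proof -
    have "continuous_on {0..1} \<omega>" using adm by (simp add: admissible_regularization_def)
    then have "bdd_above (\<omega> ` {0..1})"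
      by (intro bounded_imp_bdd_above compact_imp_bounded compact_continuous_image) auto
    then show ?thesis unfolding W[symmetric] using l by (intro cSUP_upper) auto
  qed
  \<comment> \<open>Writes \<omega> as a product of two square roots and bounds one of them by the
    supremum, which lowers the linear term to the power 1/2.\<close>
  then have "sqrt (\<omega> l) * sqrt (\<omega> l) \<le> sqrt \<bar>W\<bar> * sqrt (\<omega> l)"
    using \<omega> by (intro mult_right_mono real_sqrt_le_mono) auto
  then have \<omega>W: "\<omega> l \<le> sqrt \<bar>W\<bar> * sqrt (\<omega> l)" using \<omega> by simp
  have "r \<le> L_F * (\<kappa> * sqrt (\<omega> l)) * (C + 1) + sqrt \<bar>W\<bar> * sqrt (\<omega> l) * sqrt V * C"
    unfolding r_def using d \<omega>W L_F C(1) V by (intro add_mono mult_right_mono mult_left_mono) auto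
  also have "\<dots> = (L_F * (C + 1) * \<kappa> + sqrt \<bar>W\<bar> * sqrt V * C) * sqrt (\<omega> l)"
    by (simp add: algebra_simps)
  finally have "(C + 1) * (K2 * r) \<le> (C + 1) * (K2 * ((L_F * (C + 1) * \<kappa> + sqrt \<bar>W\<bar> * sqrt V * C) * sqrt (\<omega> l)))"
    using C(1) K2(1) by (intro mult_left_mono) auto
  then have "H1_norm \<Omega> (\<lambda>x. u x - u' x) + d
      \<le> (C + 1) * (K2 * ((L_F * (C + 1) * \<kappa> + sqrt \<bar>W\<bar> * sqrt V * C) * sqrt (\<omega> l))) + \<kappa> * sqrt (\<omega> l)"
    using 3 d by linarith
  also have "\<dots> = ((C + 1) * K2 * (L_F * (C + 1) * \<kappa> + sqrt \<bar>W\<bar> * sqrt V * C) + \<kappa>) * \<omega> l powr (1/2)"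
    using \<omega> by (simp add: powr_half_sqrt algebra_simps)
  finally show ?thesis
    unfolding d_def \<kappa>_def V_def .
qed

theorem theorem4p3:
  fixes \<Omega> :: "'a::euclidean_space set"
    and \<nu> L_H L_F W c_F N :: real
  assumes "lipschitz_domain \<Omega>" and "\<nu> > 0" and "c_F > 0" and "L_F \<ge> 0"
  shows "\<exists>C::real.
    \<forall>(G :: ('a \<Rightarrow> real) \<Rightarrow> real) (X :: 'x::banach set) (\<iota> :: ('a \<Rightarrow> real) \<Rightarrow> 'x)
      (F :: 'x \<Rightarrow> ('a \<Rightarrow> real) \<Rightarrow> real)
      (A :: 'c::metric_space set) (b :: 'a \<Rightarrow> 'c \<Rightarrow> 'a) (f :: 'a \<Rightarrow> 'c \<Rightarrow> real)
      (H :: 'a \<Rightarrow> 'a \<Rightarrow> real) (Hreg :: real \<Rightarrow> 'a \<Rightarrow> 'a \<Rightarrow> real) (\<omega> :: real \<Rightarrow> real)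
      (u :: 'a \<Rightarrow> real) (m :: 'a \<Rightarrow> real)
      (ureg :: real \<Rightarrow> 'a \<Rightarrow> real) (mreg :: real \<Rightarrow> 'a \<Rightarrow> real).
      G \<in> Hm1 \<Omega> \<and> Hm1_norm \<Omega> G = N \<and>
      compactly_embedded \<Omega> \<iota> X \<and> coupling_operator \<Omega> X F \<and>
      control_data \<Omega> A b f \<and> H = hamiltonian A b f \<and> p_lipschitz \<Omega> L_H H \<and>
      admissible_regularization \<Omega> L_H H Hreg \<omega> \<and> (SUP \<sigma>\<in>{0..1}. \<omega> \<sigma>) = W \<and>
      nonneg_functional \<Omega> G \<and>
      strongly_monotone \<Omega> \<iota> F c_F \<and>
      lipschitz_coupling \<Omega> X F L_F \<and>
      mfg_pdi_solution \<Omega> \<nu> G \<iota> F H u m \<and>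
      (\<forall>l\<in>{0<..1}. regularized_solution \<Omega> \<nu> G \<iota> F (Hreg l) (ureg l) (mreg l))
      \<longrightarrow>
      (\<exists>l0\<in>{0<..1}. \<forall>l\<in>{0<..l0}.
        H1_norm \<Omega> (\<lambda>x. u x - ureg l x) + norm (\<iota> m - \<iota> (mreg l)) \<le> C * \<omega> l powr (1/2))"
proof -
  have \<Omega>: "bounded \<Omega>" "open \<Omega>"
    using assms(1) by (auto simp: lipschitz_domain_def)
  obtain C where C: "0 < C" "\<And>v g. H0grad \<Omega> v g \<Longrightarrow> norm2 (lebesgue_on \<Omega>) v \<le> C * norm2 (lebesgue_on \<Omega>) g"
    using poincare[OF \<Omega>] by blast
  define L where "L = max L_H 0"
  have L: "0 \<le> L" by (simp add: L_def)
  have \<gamma>: "0 \<le> \<bar>N\<bar> * (C + 1)" using C(1) by simp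
  obtain K1 where K1: "\<And>m g \<beta>. kfp_problem \<Omega> \<nu> L (\<bar>N\<bar> * (C + 1)) m g \<beta> \<Longrightarrow> (LINT x|lebesgue_on \<Omega>. m x) \<le> K1"
    using kfp_integral_bound[OF \<Omega> assms(2) L \<gamma>] by blast
  obtain K2 where K2: "0 \<le> K2" "\<And>w g q r. hjb_problem \<Omega> \<nu> L w g q r \<Longrightarrow> norm2 (lebesgue_on \<Omega>) g \<le> K2 * r"
    using hjb_estimate[OF \<Omega> assms(2) L] by blast
  define B where "B = (C + 1) * K2 * (L_F * (C + 1) * sqrt (2 * max K1 0 / c_F)
      + sqrt \<bar>W\<bar> * sqrt (measure (lebesgue_on \<Omega>) \<Omega>) * C) + sqrt (2 * max K1 0 / c_F)"
  show ?thesis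
  \<comment> \<open>The estimate holds on the whole parameter interval, so 1 is the witness for the
    smallness threshold.\<close>
  proof (intro exI[of _ B] allI impI, elim conjE, intro bexI[of _ 1] ballI)
    fix G \<iota> F H Hreg \<omega> u m ureg mreg and X :: "'x set" and l :: real
    assume data: "G \<in> Hm1 \<Omega>" "Hm1_norm \<Omega> G = N" "compactly_embedded \<Omega> \<iota> X" "coupling_operator \<Omega> X F"
        "p_lipschitz \<Omega> L_H H" "admissible_regularization \<Omega> L_H H Hreg \<omega>" "(SUP \<sigma>\<in>{0..1}. \<omega> \<sigma>) = W"
        "nonneg_functional \<Omega> G" "strongly_monotone \<Omega> \<iota> F c_F" "lipschitz_coupling \<Omega> X F L_F"
        "mfg_pdi_solution \<Omega> \<nu> G \<iota> F H u m"
      and reg: "\<forall>l\<in>{0<..1}. regularized_solution \<Omega> \<nu> G \<iota> F (Hreg l) (ureg l) (mreg l)"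
      and l: "l \<in> {0<..1::real}"
    show "H1_norm \<Omega> (\<lambda>x. u x - ureg l x) + norm (\<iota> m - \<iota> (mreg l)) \<le> B * \<omega> l powr (1/2)"
      unfolding B_def
      by (rule mfg_estimate_at[OF \<Omega> assms(2-4) C(1) _ L_def _ K2(1) _ data l reg[rule_format, OF l]])
         (rule C(2) K1 K2(2), assumption)+
  qed simp
qed

end
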